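(* Let $\gamma$ be a closed loop on the lattice $\Lambda=(\mathbb{Z}/N\mathbb{Z})^4$ that bounds an oriented lattice surface, and let $u\in\mathbb{R}$, $v\in\mathbb{Z}$ and the dyonic Wilson loop expectation values $\langle W_d^{(q_e,q_m)}(\gamma)\rangle^p_{\beta,\theta}$ be as defined in the context. For $\tau=\frac{\theta}{2\pi}+2\pi i\beta$ with $\beta>0$, $\theta\in\mathbb{R}$, for $q=q_e+\tau q_m$ with $q_e,q_m\in\mathbb{Z}$, and for $\alpha_1,\alpha_2\in\frac12\mathbb{Z}$ define $$F\begin{bmatrix}\alpha_1\\\alpha_2\end{bmatrix}(q,\tau)=\exp(2\pi^2u\beta q_m^2)\,(-1)^{2\alpha_1vq_e^2}\,\langle W_d^{(q_e,q_m)}(\gamma)\rangle^{p=2\alpha_2}_{\beta,\theta},$$ which also equals $\exp(2\pi^2u\beta q_m^2)(-1)^{2\alpha_1vq_e^2+2\alpha_2vq_m^2}\langle W_d^{(q_e,q_m)}(\gamma)\rangle^{p=0}_{\beta,\theta}$. Then $$F\begin{bmatrix}\alpha_1\\\alpha_2\end{bmatrix}\Big(\frac{q}{\tau},-\frac1\tau\Big)=\exp\Big(iu\pi\frac{q^2}{\tau}\Big)F\begin{bmatrix}\alpha_2\\-\alpha_1\end{bmatrix}(q,\tau),$$ $$F\begin{bmatrix}\alpha_1\\\alpha_2\end{bmatrix}(q,\tau+1)=F\begin{bmatrix}\alpha_1\\\alpha_1+\alpha_2+1/2\end{bmatrix}(q,\tau).$$ (Here the left-hand sides are evaluated using $\frac{q}{\tau}=q_m+(-\frac1\tau)(-q_e)$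 and $q=(q_e-q_m)+(\tau+1)q_m$.) Moreover, if $v$ is even, the functions $F\begin{bmatrix}\alpha_1\\\alpha_2\end{bmatrix}$ for the four classes of $(\alpha_1,\alpha_2)$ modulo $\mathbb{Z}^2$ coincide.
   Context: Lattice and forms. $\Lambda=(\mathbb{Z}/N\mathbb{Z})^4$, $N\ge1$, unit vectors $\hat\mu$ ($\mu=1,\dots,4$). An $r$-form $\alpha$ assigns $\alpha_{x,\mu_1\cdots\mu_r}$ to each site $x$ and indices $\mu_i$, antisymmetric in the indices. For $r$-forms, $\alpha\cdot\beta=\sum_x\sum_{\mu_1<\dots<\mu_r}\alpha_{x,\mu_1\cdots\mu_r}\beta_{x,\mu_1\cdots\mu_r}$. For an $r$-form $\alpha$: $(d\alpha)_{x,\mu_1\cdots\mu_{r+1}}=\sum_{j}(-1)^{j+1}[\alpha_{x+\hat\mu_j,\mu_1\cdots\mathring\mu_j\cdots\mu_{r+1}}-\alpha_{x,\mu_1\cdots\mathring\mu_j\cdots\mu_{r+1}}]$ ($\mathring\mu_j$ omitted), $(\partial\alpha)_{x,\mu_1\cdots\mu_{r-1}}=\sum_{\nu=1}^4[\alpha_{x,\mu_1\cdots\mu_{r-1}\nu}-\alpha_{x-\hat\nu,\mu_1\cdots\mu_{r-1}\nu}]$. $P_\partial$ is the orthogonal projection (w.r.t. $\cdot$) of 2-forms onto $\partial(\text{3-forms})$. Cup product of an $r$-form and a $t$-form: $(\alpha\cup\beta)_{x,\mu_1\cdots\mu_{r+t}}=\sum_{\sigma\in\mathfrak S_{r+t}}\frac{\mathrm{sgn}\,\sigma}{r!\,t!}\alpha_{x,\mu_{\sigma(1)}\cdots\mu_{\sigma(r)}}\beta_{x+\hat\mu_{\sigma(1)}+\cdots+\hat\mu_{\sigma(r)},\mu_{\sigma(r+1)}\cdots\mu_{\sigma(r+t)}}$.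 For a 4-form $\omega$, $\sum_x\omega$ means $\sum_x\omega_{x,1234}$. Higher cup product: for $\mu_1<\dots<\mu_{r+t-1}$, $(\alpha\cup_1\beta)_{x,\mu_1\cdots\mu_{r+t-1}}=(-1)^t\sum_{a=1}^{r+t-1}(-1)^a\big[R_{\mu_a}(R_{\mu_a}\iota_{\mu_a}\alpha\cup R_{\mu_a}\iota_{\mu_a}\beta)\big]_{x,\mu_1\cdots\mathring\mu_a\cdots\mu_{r+t-1}}$, where $(\iota_\mu\alpha)_{x,\mu_1\cdots\mu_{k}}=\alpha_{x,\mu\mu_1\cdots\mu_{k}}$; $R_\mu$ acts on sites by reversing the sign of coordinates $x_\mu,x_{\mu+1},\dots,x_4$; and on a $k$-form, for $\mu_1<\dots<\mu_k$ and $b$ with $\mu_{b-1}<\mu\le\mu_b$ ($b=k+1$ if all $\mu_i<\mu$), $(R_\mu\alpha)_{x,\mu_1\cdots\mu_k}=(-1)^{k-b+1}\alpha_{R_\mu x-\sum_{i=b}^k\hat\mu_i,\mu_1\cdots\mu_k}$. Theory. Fields: 1-form $A^e$ and 3-form $A^m$ with components in $[-\pi,\pi)$, integer-valued 2-form $n$; $F^e=dA^e+2\pi n$. Define $Q[F^e]=\sum_x\big(\frac1{8\pi^2}F^e\cup F^e+\frac1{4\pi}F^e\cup_1dn\big)$ and the (integer) Pontryagin square $\mathfrak P(n)=\sum_x(n\cup n+n\cup_1dn)$. Measures: $\int DA^e=\prod_{x,\mu}\int_{-\pi}^\pi\frac{dA^e_{x,\mu}}{2\pi}$, $\int DA^m=\prod_x\prod_{\mu<\nu<\rho}\int_{-\pi}^\pi\frac{dA^m_{x,\mu\nu\rho}}{2\pi}$;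 $\sum_{\{n\}}$ runs over all integer 2-forms. Partition function: $Z[\beta,\theta]=\int DA^eDA^m\sum_{\{n\}}\exp(-\frac\beta2F^e\cdot F^e-\frac{i\theta}{8\pi^2}\sum_xF^e\cup F^e+\frac{i}{2\pi}\partial A^m\cdot F^e)$. Loop. $\gamma$ is a closed loop of oriented links, each link traversed at most once; $\dot\gamma$ is the 1-form with $\dot\gamma_{x,\mu}=1$ if $\gamma$ contains the link from $x$ to $x+\hat\mu$, $-1$ if it contains that link with reversed orientation, $0$ otherwise. The dyonic Wilson loop with charges $q_e,q_m\in\mathbb{Z}$ is $W_d^{(q_e,q_m)}(\gamma)=\exp\big(i(q_e\,\dot\gamma\cdot A^e-q_m\sum_x\dot\gamma\cup A^m)\big)$. For $p\in\mathbb{Z}$ (only $p$ mod 2 matters), $$\langle W_d^{(q_e,q_m)}(\gamma)\rangle^p_{\beta,\theta}=\frac1{Z[\beta,\theta]}\int DA^eDA^m\sum_{\{n\}}e^{-\frac\beta2F^e\cdot F^e-i\theta Q[F^e]+\frac i{2\pi}\partial A^m\cdot F^e-ip\pi\mathfrak P(n)}\,W_d^{(q_e,q_m)}(\gamma).$$ Numbers $u,v$. Since $\gamma$ bounds, there is an integer-valued 2-form $l$ with $\epsilon_{\mu\nu\rho\sigma}(dl)_{x+\hat\mu,\nu\rho\sigma}=-\dot\gamma_{x,\mu}$ for all $x$, $\mu$ and $\nu<\rho<\sigma$ the three remaining indices. Fix such an $l$ and set $u=\sum_xP_\partial l\cup_1dP_\partial l\in\mathbb{R}$, $v=\mathfrak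 P(l)\in\mathbb{Z}$. *)

theory Defs
  imports
    "HOL-Analysis.Analysis"
    "HOL-Combinatorics.Permutations"
    "Berlekamp_Zassenhaus.Finite_Field"
begin

section \<open>The periodic lattice\<close>

datatype dir = X1 | X2 | X3 | X4

primrec dir_index :: "dir \<Rightarrow> nat" where
  "dir_index X1 = 1"
| "dir_index X2 = 2"
| "dir_index X3 = 3"
| "dir_index X4 = 4"

instantiation dir :: linorder
begin

definition less_eq_dir :: "dir \<Rightarrow> dir \<Rightarrow> bool" where
  "\<mu> \<le> \<nu> \<longleftrightarrow> dir_index \<mu> \<le> dir_index \<nu>"

definition less_dir :: "dir \<Rightarrow> dir \<Rightarrow> bool" where
  "\<mu> < \<nu> \<longleftrightarrow> dir_index \<mu> < dir_index \<nu>"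

instance
proof
  fix \<mu> \<nu> :: dir
  show "\<mu> \<le> \<nu> \<Longrightarrow> \<nu> \<le> \<mu> \<Longrightarrow> \<mu> = \<nu>"
    by (cases \<mu>; cases \<nu>) (simp_all add: less_eq_dir_def)
qed (auto simp: less_eq_dir_def less_dir_def)

end

lemma UNIV_dir: "(UNIV :: dir set) = {X1, X2, X3, X4}"
  using dir.exhaust by blast

instance dir :: finite
  by standard (simp add: UNIV_dir)

text \<open>The lattice is \<open>(\<int>/N\<int>)\<^sup>4\<close> with \<open>N = CARD('n) \<ge> 1\<close>. For \<open>N = 1\<close> the type
  \<open>'n mod_ring\<close> has no constant \<open>1\<close>, hence the use of \<^const>\<open>of_int_mod_ring\<close>.\<close>

type_synonym 'n site = "('n mod_ring, dir) vec"

definition hat :: "dir \<Rightarrow> ('n::finite) site" where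
  "hat \<mu> = axis \<mu> (of_int_mod_ring 1)"


section \<open>Forms\<close>

text \<open>A form of any degree is a function of a site and a list of indices; an \<open>r\<close>-form vanishes on
  lists of length other than \<open>r\<close>, so that it is determined by its components.\<close>

type_synonym 'n form = "'n site \<Rightarrow> dir list \<Rightarrow> real"

definition forms :: "nat \<Rightarrow> ('n::finite) form set" where
  "forms r = {\<alpha>. \<forall>x \<mu>s.
     (length \<mu>s \<noteq> r \<longrightarrow> \<alpha> x \<mu>s = 0) \<and>
     (\<forall>\<sigma>. \<sigma> permutes {..<length \<mu>s} \<longrightarrow> \<alpha> x (permute_list \<sigma> \<mu>s) = of_int (sign \<sigma>) * \<alpha> x \<mu>s)}"

definition int_forms :: "nat \<Rightarrow> ('n::finite) form set" where
  "int_forms r = {\<alpha> \<in> forms r. \<forall>x \<mu>s. \<alpha> x \<mu>s \<in> \<int>}"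

definition increasing_indices :: "nat \<Rightarrow> dir list set" where
  "increasing_indices r = {\<mu>s. length \<mu>s = r \<and> sorted_wrt (<) \<mu>s}"

definition form_dot :: "nat \<Rightarrow> ('n::finite) form \<Rightarrow> 'n form \<Rightarrow> real" where
  "form_dot r \<alpha> \<beta> = (\<Sum>x\<in>UNIV. \<Sum>\<mu>s\<in>increasing_indices r. \<alpha> x \<mu>s * \<beta> x \<mu>s)"

definition remove_at :: "nat \<Rightarrow> 'a list \<Rightarrow> 'a list" where
  "remove_at j xs = take j xs @ drop (Suc j) xs"

text \<open>List positions are counted from \<open>0\<close>, so the sign \<open>(-1)\<^bsup>j+1\<^esup>\<close> of position \<open>j\<close> counted from
  \<open>1\<close> becomes \<open>(-1)\<^bsup>j\<^esup>\<close>.\<close>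

definition ext_d :: "('n::finite) form \<Rightarrow> 'n form" where
  "ext_d \<alpha> x \<mu>s =
     (\<Sum>j<length \<mu>s. (-1) ^ j * (\<alpha> (x + hat (\<mu>s ! j)) (remove_at j \<mu>s) - \<alpha> x (remove_at j \<mu>s)))"

definition codiff :: "('n::finite) form \<Rightarrow> 'n form" where
  "codiff \<alpha> x \<mu>s = (\<Sum>\<nu>\<in>UNIV. \<alpha> x (\<mu>s @ [\<nu>]) - \<alpha> (x - hat \<nu>) (\<mu>s @ [\<nu>]))"

definition codiff_proj :: "('n::finite) form \<Rightarrow> 'n form" where
  "codiff_proj \<alpha> = (THE w. w \<in> codiff ` forms 3 \<and>
     (\<forall>b\<in>forms 3. form_dot 2 (\<lambda>x \<mu>s. \<alpha> x \<mu>s - w x \<mu>s) (codiff b) = 0))"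


section \<open>Cup products\<close>

text \<open>The degrees \<open>r\<close> and \<open>t\<close> of the two factors are passed explicitly.\<close>

definition cup :: "nat \<Rightarrow> nat \<Rightarrow> ('n::finite) form \<Rightarrow> 'n form \<Rightarrow> 'n form" where
  "cup r t \<alpha> \<beta> x \<mu>s =
     (if length \<mu>s = r + t then
        (\<Sum>\<sigma> | \<sigma> permutes {..<r + t}. of_int (sign \<sigma>) / (fact r * fact t) *
           \<alpha> x (map (\<lambda>i. \<mu>s ! \<sigma> i) [0..<r]) *
           \<beta> (x + (\<Sum>i<r. hat (\<mu>s ! \<sigma> i))) (map (\<lambda>i. \<mu>s ! \<sigma> i) [r..<r + t]))
      else 0)"

definition contract :: "dir \<Rightarrow> ('n::finite) form \<Rightarrow> 'n form" where
  "contract \<mu> \<alpha> x \<mu>s = \<alpha> x (\<mu> # \<mu>s)"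

definition reflect_site :: "dir \<Rightarrow> ('n::finite) site \<Rightarrow> 'n site" where
  "reflect_site \<mu> x = (\<chi> \<nu>. if \<mu> \<le> \<nu> then - x $ \<nu> else x $ \<nu>)"

text \<open>For \<open>\<mu>\<^sub>1 < \<dots> < \<mu>\<^sub>k\<close> and \<open>\<mu>\<^bsub>b-1\<^esub> < \<mu> \<le> \<mu>\<^sub>b\<close>, the indices \<open>\<mu>\<^sub>b, \<dots>, \<mu>\<^sub>k\<close> are exactly those that
  are \<open>\<ge> \<mu>\<close>, and there are \<open>k - b + 1\<close> of them. Written in this way the formula is antisymmetric
  in the indices and holds for unordered indices as well.\<close>

definition reflect :: "dir \<Rightarrow> ('n::finite) form \<Rightarrow> 'n form" where
  "reflect \<mu> \<alpha> x \<mu>s =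
     (let high = filter (\<lambda>\<nu>. \<mu> \<le> \<nu>) \<mu>s
      in (-1) ^ length high * \<alpha> (reflect_site \<mu> x - sum_list (map hat high)) \<mu>s)"

text \<open>The defining formula for increasing indices is antisymmetric, so it is used for all indices.
  A position \<open>a\<close> counted from \<open>1\<close> is \<open>Suc a\<close> with \<open>a\<close> counted from \<open>0\<close>.\<close>

definition cup1 :: "nat \<Rightarrow> nat \<Rightarrow> ('n::finite) form \<Rightarrow> 'n form \<Rightarrow> 'n form" where
  "cup1 r t \<alpha> \<beta> x \<mu>s =
     (if length \<mu>s + 1 = r + t then
        (-1) ^ t * (\<Sum>a<length \<mu>s. (-1) ^ Suc a *
          reflect (\<mu>s ! a)
            (cup (r - 1) (t - 1)
              (reflect (\<mu>s ! a) (contract (\<mu>s ! a) \<alpha>))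
              (reflect (\<mu>s ! a) (contract (\<mu>s ! a) \<beta>)))
            x (remove_at a \<mu>s))
      else 0)"

definition sum4 :: "('n::finite) form \<Rightarrow> real" where
  "sum4 \<omega> = (\<Sum>x\<in>UNIV. \<omega> x [X1, X2, X3, X4])"

definition pontryagin :: "('n::finite) form \<Rightarrow> real" where
  "pontryagin n = sum4 (\<lambda>x \<mu>s. cup 2 2 n n x \<mu>s + cup1 2 3 n (ext_d n) x \<mu>s)"


section \<open>Fields, measures and the partition function\<close>

definition field_strength :: "('n::finite) form \<Rightarrow> 'n form \<Rightarrow> 'n form" where
  "field_strength A n = (\<lambda>x \<mu>s. ext_d A x \<mu>s + 2 * pi * n x \<mu>s)"

text \<open>Since \<open>F = dA + 2\<pi>n\<close> gives \<open>dn = dF/(2\<pi>)\<close>, the charge depends on \<open>F\<close> only; \<open>n\<close> is nevertheless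
  kept as an argument.\<close>

definition top_charge :: "('n::finite) form \<Rightarrow> 'n form \<Rightarrow> real" where
  "top_charge F n =
     sum4 (\<lambda>x \<mu>s. 1 / (8 * pi\<^sup>2) * cup 2 2 F F x \<mu>s + 1 / (4 * pi) * cup1 2 3 F (ext_d n) x \<mu>s)"

definition cells :: "nat \<Rightarrow> (('n::finite) site \<times> dir list) set" where
  "cells r = UNIV \<times> increasing_indices r"

text \<open>The sign of the permutation sorting a list of distinct indices (for four distinct indices, the
  Levi-Civita symbol).\<close>

definition index_sign :: "dir list \<Rightarrow> real" where
  "index_sign \<mu>s =
     (if distinct \<mu>s then (-1) ^ card {(i, j). i < j \<and> j < length \<mu>s \<and> \<mu>s ! j < \<mu>s ! i} else 0)"

definition form_of :: "nat \<Rightarrow> (('n::finite) site \<times> dir list \<Rightarrow> real) \<Rightarrow> 'n form" where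
  "form_of r a x \<mu>s = (if length \<mu>s = r then index_sign \<mu>s * a (x, sort \<mu>s) else 0)"

text \<open>The measure \<open>\<Prod> dA/2\<pi>\<close> over \<open>[-\<pi>, \<pi>)\<close> on the independent components of an \<open>r\<close>-form.\<close>

definition field_measure :: "nat \<Rightarrow> (('n::finite) site \<times> dir list \<Rightarrow> real) measure" where
  "field_measure r = (\<Pi>\<^sub>M c\<in>cells r. uniform_measure lborel {-pi..<pi})"

definition field_integral :: "(('n::finite) form \<Rightarrow> 'n form \<Rightarrow> complex) \<Rightarrow> complex" where
  "field_integral f =
     (LINT ab|(field_measure 1 \<Otimes>\<^sub>M field_measure 3). f (form_of 1 (fst ab)) (form_of 3 (snd ab)))"

definition partition_fun :: "('n::finite) itself \<Rightarrow> real \<Rightarrow> real \<Rightarrow> complex" where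
  "partition_fun N \<beta> \<theta> =
     field_integral (\<lambda>(Ae :: 'n form) Am. \<Sum>\<^sub>\<infinity>n\<in>int_forms 2.
       let F = field_strength Ae n in
       exp (- of_real (\<beta> / 2 * form_dot 2 F F)
            - \<i> * of_real (\<theta> / (8 * pi\<^sup>2) * sum4 (cup 2 2 F F))
            + \<i> * of_real (1 / (2 * pi) * form_dot 2 (codiff Am) F)))"


section \<open>Dyonic Wilson loops\<close>

text \<open>The link \<open>(x, \<mu>, True)\<close> runs from \<open>x\<close> to \<open>x + hat \<mu>\<close>, and \<open>(x, \<mu>, False)\<close> is the same link with
  reversed orientation.\<close>

type_synonym 'n link = "'n site \<times> dir \<times> bool"

fun link_start :: "('n::finite) link \<Rightarrow> 'n site" where
  "link_start (x, \<mu>, s) = (if s then x else x + hat \<mu>)"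

fun link_end :: "('n::finite) link \<Rightarrow> 'n site" where
  "link_end (x, \<mu>, s) = (if s then x + hat \<mu> else x)"

definition closed_loop :: "('n::finite) link list \<Rightarrow> bool" where
  "closed_loop \<gamma> \<longleftrightarrow>
     \<gamma> \<noteq> [] \<and>
     (\<forall>i<length \<gamma>. link_end (\<gamma> ! i) = link_start (\<gamma> ! (Suc i mod length \<gamma>))) \<and>
     distinct (map (\<lambda>(x, \<mu>, s). (x, \<mu>)) \<gamma>)"

definition loop_form :: "('n::finite) link list \<Rightarrow> 'n form" where
  "loop_form \<gamma> x \<mu>s =
     (case \<mu>s of
        [\<mu>] \<Rightarrow> (if (x, \<mu>, True) \<in> set \<gamma> then 1 else if (x, \<mu>, False) \<in> set \<gamma> then -1 else 0)
      | _ \<Rightarrow> 0)"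

text \<open>The integer 2-form \<open>l\<close> represents, on the dual lattice, an oriented surface bounded by \<open>\<gamma>\<close>.\<close>

definition spanned_by :: "('n::finite) link list \<Rightarrow> 'n form \<Rightarrow> bool" where
  "spanned_by \<gamma> l \<longleftrightarrow>
     l \<in> int_forms 2 \<and>
     (\<forall>x \<mu> \<nu> \<rho> \<sigma>. {\<mu>, \<nu>, \<rho>, \<sigma>} = UNIV \<and> \<nu> < \<rho> \<and> \<rho> < \<sigma> \<longrightarrow>
        index_sign [\<mu>, \<nu>, \<rho>, \<sigma>] * ext_d l (x + hat \<mu>) [\<nu>, \<rho>, \<sigma>] = - loop_form \<gamma> x [\<mu>])"

definition dyonic_wilson ::
    "('n::finite) link list \<Rightarrow> int \<Rightarrow> int \<Rightarrow> 'n form \<Rightarrow> 'n form \<Rightarrow> complex" where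
  "dyonic_wilson \<gamma> qe qm Ae Am =
     exp (\<i> * of_real (of_int qe * form_dot 1 (loop_form \<gamma>) Ae
                      - of_int qm * sum4 (cup 1 3 (loop_form \<gamma>) Am)))"

definition wilson_expectation ::
    "('n::finite) link list \<Rightarrow> int \<Rightarrow> int \<Rightarrow> int \<Rightarrow> real \<Rightarrow> real \<Rightarrow> complex" where
  "wilson_expectation \<gamma> qe qm p \<beta> \<theta> =
     1 / partition_fun TYPE('n) \<beta> \<theta> *
     field_integral (\<lambda>Ae Am. \<Sum>\<^sub>\<infinity>n\<in>int_forms 2.
       let F = field_strength Ae n in
       exp (- of_real (\<beta> / 2 * form_dot 2 F F)
            - \<i> * of_real (\<theta> * top_charge F n)
            + \<i> * of_real (1 / (2 * pi) * form_dot 2 (codiff Am) F)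
            - \<i> * of_real (of_int p * pi * pontryagin n)) *
       dyonic_wilson \<gamma> qe qm Ae Am)"


section \<open>The functions \<open>F[\<alpha>\<^sub>1, \<alpha>\<^sub>2](q, \<tau>)\<close>\<close>

text \<open>For \<open>Im \<tau> > 0\<close> and \<open>q \<in> \<int> + \<tau>\<int>\<close> the charges are uniquely determined by \<open>q\<close> and \<open>\<tau>\<close>.\<close>

definition charges :: "complex \<Rightarrow> complex \<Rightarrow> int \<times> int" where
  "charges q \<tau> = (THE c. q = of_int (fst c) + \<tau> * of_int (snd c))"

text \<open>The arguments \<open>\<alpha>1\<close>, \<open>\<alpha>2\<close> are meant to be half-integers, so that the floors are just \<open>2\<alpha>1\<close> and
  \<open>2\<alpha>2\<close> as integers; \<open>\<beta>\<close> and \<open>\<theta>\<close> are read off from \<open>\<tau> = \<theta>/(2\<pi>) + 2\<pi>\<i>\<beta>\<close>.\<close>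

definition dyon_F ::
    "('n::finite) link list \<Rightarrow> real \<Rightarrow> int \<Rightarrow> real \<Rightarrow> real \<Rightarrow> complex \<Rightarrow> complex \<Rightarrow> complex" where
  "dyon_F \<gamma> u v \<alpha>1 \<alpha>2 q \<tau> =
     (let (qe, qm) = charges q \<tau>; \<beta> = Im \<tau> / (2 * pi); \<theta> = 2 * pi * Re \<tau> in
      of_real (exp (2 * pi\<^sup>2 * u * \<beta> * (of_int qm)\<^sup>2)) *
      (-1) powi (\<lfloor>2 * \<alpha>1\<rfloor> * v * qe\<^sup>2) *
      wilson_expectation \<gamma> qe qm \<lfloor>2 * \<alpha>2\<rfloor> \<beta> \<theta>)"

end

theory Submission
  imports Defs "HOL-Probability.Probability" "HOL-Complex_Analysis.Complex_Analysis"
begin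

text \<open>
  Integrating out \<open>A\<^sup>m\<close> forces \<open>n - q\<^sub>m l\<close> to be closed. The Hodge decomposition then splits \<open>F\<^sup>e\<close> orthogonally
  into \<open>2\<pi>q\<^sub>m P\<^sub>\<partial> l\<close>, an exact part and a constant part. Summing over the integer 2-forms of given fluxes unwraps the
  compact \<open>A\<^sup>e\<close>, so the exact part becomes a Gaussian variable; the loop couples to it linearly, which produces
  only an explicit exponential. The constant part runs over a shifted lattice of fluxes in \<open>\<int>\<^sup>6\<close> and yields a theta
  function of signature \<open>(3,3)\<close>, a product of three two-dimensional ones. Poisson summation gives its behaviour
  under \<open>\<tau> \<mapsto> -1/\<tau>\<close>, and \<open>\<tau> \<mapsto> \<tau> + 1\<close> is read off term by term. The remaining phases depend on the linking term
  \<open>y = P\<^sub>\<partial> l \<union> d a\<close> and the flux product \<open>s\<close> of \<open>l\<close> only through \<open>2y + 2s - u\<close>, an integer of the same parity as \<open>v\<close>.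
\<close>

section \<open>Sites\<close>

text \<open>The loop couples through cup products, while translating the unwrapped field yields only
  inner products with exact forms. The bridge is that the dual of a coexact 2-form is exact, so a
  cup product with the coexact part \<open>w\<close> of \<open>l\<close> is an inner product with
  some \<open>ext_d g0\<close>. Translations are real but the coupling is imaginary, hence the
  analytic continuation of a moment generating function. The lattice cup product does not commute;
  the \<open>cup1\<close> term of the charge turns the symmetrised pairing with \<open>w\<close>
  into a one-sided one, so that the electric and the theta-induced coupling merge into one real
  parameter. Under inversion the theta function acquires |tau|^3, which cancels in the quotient by
  its value at charge zero, the theta factor of the partition function. The factor exp(2 pi^2 u beta
  q_m^2) is such that its change under inversion is the modulus of exp(i u pi q^2/tau). Inversion
  uses only that 2y + 2s - u is an integer; its parity enters under the unit shift of tau.\<close>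

lemma sum_site_shift: "(\<Sum>x\<in>UNIV. f (x + s)) = (\<Sum>x\<in>UNIV. f (x :: 'n::finite site))"
  by (rule sum.reindex_bij_witness[of _ "\<lambda>x. x - s" "\<lambda>x. x + s"]) auto

lemma reflect_site_simps:
  "reflect_site \<mu> (x + y) = reflect_site \<mu> x + reflect_site \<mu> (y :: 'n::finite site)"
  "reflect_site \<mu> (x - y) = reflect_site \<mu> x - reflect_site \<mu> y"
  "reflect_site \<mu> (- x) = - reflect_site \<mu> x"
  "reflect_site \<mu> 0 = 0"
  "reflect_site \<mu> (reflect_site \<mu> x) = x"
  "reflect_site \<mu> (hat \<nu>) = (if \<mu> \<le> \<nu> then - hat \<nu> else hat \<nu>)"
  by (auto simp: reflect_site_def vec_eq_iff hat_def axis_def)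

lemma less_dir_simps [simp]:
  "X1 < X2" "X1 < X3" "X1 < X4" "X2 < X3" "X2 < X4" "X3 < X4"
  "\<not> X2 < X1" "\<not> X3 < X1" "\<not> X4 < X1" "\<not> X3 < X2" "\<not> X4 < X2" "\<not> X4 < X3"
  "X1 \<le> X2" "X1 \<le> X3" "X1 \<le> X4" "X2 \<le> X3" "X2 \<le> X4" "X3 \<le> X4"
  "\<not> X2 \<le> X1" "\<not> X3 \<le> X1" "\<not> X4 \<le> X1" "\<not> X3 \<le> X2" "\<not> X4 \<le> X2" "\<not> X4 \<le> X3"
  by (auto simp: less_dir_def less_eq_dir_def)

lemma sum_dir: "(\<Sum>\<mu>\<in>UNIV. f \<mu>) = f X1 + f X2 + f X3 + f X4"
  by (simp add: UNIV_dir add.assoc)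

lemma increasing_indices_1: "increasing_indices 1 = {[X1], [X2], [X3], [X4]}"
proof -
  have "\<mu>s \<in> {[X1], [X2], [X3], [X4]}" if len: "length \<mu>s = 1" for \<mu>s
  proof -
    obtain a where "\<mu>s = [a]" using len by (auto simp: length_Suc_conv)
    then show ?thesis by (cases a) auto
  qed
  then show ?thesis by (auto simp: increasing_indices_def)
qed

lemma increasing_indices_2:
  "increasing_indices 2 = {[X1,X2], [X1,X3], [X1,X4], [X2,X3], [X2,X4], [X3,X4]}"
proof -
  have "\<mu>s \<in> {[X1,X2], [X1,X3], [X1,X4], [X2,X3], [X2,X4], [X3,X4]}"
    if len: "length \<mu>s = 2" "sorted_wrt (<) \<mu>s" for \<mu>s
  proof -
    obtain a b where "\<mu>s = [a, b]" using len by (auto simp: length_Suc_conv numeral_2_eq_2)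
    with that show ?thesis by (cases a; cases b) auto
  qed
  then show ?thesis by (auto simp: increasing_indices_def)
qed

lemma increasing_indices_3:
  "increasing_indices 3 = {[X1,X2,X3], [X1,X2,X4], [X1,X3,X4], [X2,X3,X4]}"
proof -
  have "\<mu>s \<in> {[X1,X2,X3], [X1,X2,X4], [X1,X3,X4], [X2,X3,X4]}"
    if len: "length \<mu>s = 3" "sorted_wrt (<) \<mu>s" for \<mu>s
  proof -
    obtain a b c where "\<mu>s = [a, b, c]" using len by (auto simp: length_Suc_conv numeral_3_eq_3)
    with that show ?thesis by (cases a; cases b; cases c) auto
  qed
  then show ?thesis by (auto simp: increasing_indices_def)
qed

lemma form_dot_2:
  "form_dot 2 \<alpha> \<beta> = (\<Sum>x\<in>UNIV. \<alpha> x [X1,X2] * \<beta> x [X1,X2] + \<alpha> x [X1,X3] * \<beta> x [X1,X3]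
     + \<alpha> x [X1,X4] * \<beta> x [X1,X4] + \<alpha> x [X2,X3] * \<beta> x [X2,X3]
     + \<alpha> x [X2,X4] * \<beta> x [X2,X4] + \<alpha> x [X3,X4] * \<beta> x [X3,X4])"
  by (simp add: form_dot_def increasing_indices_2 add.assoc)

lemma form_dot_3:
  "form_dot 3 \<alpha> \<beta> = (\<Sum>x\<in>UNIV. \<alpha> x [X1,X2,X3] * \<beta> x [X1,X2,X3] + \<alpha> x [X1,X2,X4] * \<beta> x [X1,X2,X4]
     + \<alpha> x [X1,X3,X4] * \<beta> x [X1,X3,X4] + \<alpha> x [X2,X3,X4] * \<beta> x [X2,X3,X4])"
  by (simp add: form_dot_def increasing_indices_3 add.assoc)

lemma form_dot_1:
  "form_dot 1 \<alpha> \<beta> = (\<Sum>x\<in>UNIV. \<alpha> x [X1] * \<beta> x [X1] + \<alpha> x [X2] * \<beta> x [X2]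
     + \<alpha> x [X3] * \<beta> x [X3] + \<alpha> x [X4] * \<beta> x [X4])"
  by (simp add: form_dot_def increasing_indices_1[unfolded One_nat_def] add.assoc)

section \<open>Permutations of small sets\<close>

text \<open>Every permutation of \<open>{..<Suc n}\<close> is in a unique way a permutation of
  \<open>{..<n}\<close> followed by \<open>transpose n b\<close>. Iterating this expands the signed
  sums over three and four indices into explicit terms.\<close>

lemma sum_permutes_Suc:
  fixes f :: "(nat \<Rightarrow> nat) \<Rightarrow> real"
  shows "(\<Sum>\<sigma> | \<sigma> permutes {..<Suc n}. of_int (sign \<sigma>) * f \<sigma>) =
     (\<Sum>b\<le>n. (if b = n then 1 else -1) *
        (\<Sum>\<sigma> | \<sigma> permutes {..<n}. of_int (sign \<sigma>) * f (Transposition.transpose n b \<circ> \<sigma>)))"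
proof -
  have "(\<Sum>\<sigma> | \<sigma> permutes {..<Suc n}. of_int (sign \<sigma>) * f \<sigma>) =
      (\<Sum>b\<in>insert n {..<n}. \<Sum>\<sigma> | \<sigma> permutes {..<n}.
          of_int (sign (Transposition.transpose n b \<circ> \<sigma>)) * f (Transposition.transpose n b \<circ> \<sigma>))"
    unfolding lessThan_Suc by (rule sum_over_permutations_insert) auto
  also have "\<dots> = (\<Sum>b\<in>insert n {..<n}. (if b = n then 1 else -1) *
        (\<Sum>\<sigma> | \<sigma> permutes {..<n}. of_int (sign \<sigma>) * f (Transposition.transpose n b \<circ> \<sigma>)))"
  proof (intro sum.cong refl)
    fix b
    have "sign (Transposition.transpose n b \<circ> \<sigma>) = (if b = n then 1 else -1) * sign \<sigma>"
      if "\<sigma> permutes {..<n}" for \<sigma>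
      using that permutes_imp_permutation[OF finite_lessThan that]
      by (simp add: sign_compose permutation_swap_id sign_swap_id)
    then show "(\<Sum>\<sigma> | \<sigma> permutes {..<n}. of_int (sign (Transposition.transpose n b \<circ> \<sigma>)) * f (Transposition.transpose n b \<circ> \<sigma>)) =
       (if b = n then 1 else -1) *
        (\<Sum>\<sigma> | \<sigma> permutes {..<n}. of_int (sign \<sigma>) * f (Transposition.transpose n b \<circ> \<sigma>))"
      by (auto simp: sum_distrib_left intro!: sum.cong)
  qed
  also have "insert n {..<n} = {..n}" by auto
  finally show ?thesis .
qed

lemma sum_permutes_0:
  fixes f :: "(nat \<Rightarrow> nat) \<Rightarrow> real"
  shows "(\<Sum>\<sigma> | \<sigma> permutes {..<0}. of_int (sign \<sigma>) * f \<sigma>) = f id"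
  by (simp add: sign_id)

section \<open>Cup products in components and antisymmetry of forms\<close>

lemma cup_alt:
  "length \<mu>s = r + t \<Longrightarrow> cup r t \<alpha> \<beta> x \<mu>s = (\<Sum>\<sigma> | \<sigma> permutes {..<r + t}. of_int (sign \<sigma>) *
      (\<alpha> x (map (\<lambda>i. \<mu>s ! \<sigma> i) [0..<r]) *
           \<beta> (x + (\<Sum>i<r. hat (\<mu>s ! \<sigma> i))) (map (\<lambda>i. \<mu>s ! \<sigma> i) [r..<r + t]) / (fact r * fact t)))"
  by (auto simp: cup_def intro!: sum.cong)

lemma sum_permutes_3:
  fixes g :: "nat \<Rightarrow> nat \<Rightarrow> nat \<Rightarrow> real"
  shows "(\<Sum>\<sigma> | \<sigma> permutes {..<3}. of_int (sign \<sigma>) * g (\<sigma> 0) (\<sigma> 1) (\<sigma> 2)) =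
    g 0 1 2 - g 0 2 1 - g 1 0 2 + g 1 2 0 + g 2 0 1 - g 2 1 0"
  unfolding numeral_3_eq_3 numeral_2_eq_2 One_nat_def
  apply (simp only: sum_permutes_Suc sum_permutes_0[unfolded lessThan_0] lessThan_0 atMost_Suc atMost_0)
  apply (simp add: Transposition.transpose_def)
  done

lemma sum_permutes_4:
  fixes g :: "nat \<Rightarrow> nat \<Rightarrow> nat \<Rightarrow> nat \<Rightarrow> real"
  shows "(\<Sum>\<sigma> | \<sigma> permutes {..<4}. of_int (sign \<sigma>) * g (\<sigma> 0) (\<sigma> 1) (\<sigma> 2) (\<sigma> 3)) =
    g 0 1 2 3 - g 0 1 3 2 - g 0 2 1 3 + g 0 2 3 1 + g 0 3 1 2 - g 0 3 2 1
    - g 1 0 2 3 + g 1 0 3 2 + g 1 2 0 3 - g 1 2 3 0 - g 1 3 0 2 + g 1 3 2 0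
    + g 2 0 1 3 - g 2 0 3 1 - g 2 1 0 3 + g 2 1 3 0 + g 2 3 0 1 - g 2 3 1 0
    - g 3 0 1 2 + g 3 0 2 1 + g 3 1 0 2 - g 3 1 2 0 - g 3 2 0 1 + g 3 2 1 0"
proof -
  have 4: "4 = Suc (Suc (Suc (Suc 0)))" by simp
  show ?thesis
  unfolding 4 numeral_3_eq_3 numeral_2_eq_2 One_nat_def
  apply (simp only: sum_permutes_Suc sum_permutes_0[unfolded lessThan_0] lessThan_0 atMost_Suc atMost_0)
  apply (simp add: Transposition.transpose_def)
  done
qed

text \<open>All six terms are kept because the factors it is applied to are reflected contractions,
  whose antisymmetry is used only after they have been unfolded.\<close>

lemma cup_1_2:
  "cup 1 2 \<alpha> \<beta> x [a,b,c] = 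
    ((\<alpha> x [a] * \<beta> (x + hat a) [b,c] - \<alpha> x [a] * \<beta> (x + hat a) [c,b])
     - (\<alpha> x [b] * \<beta> (x + hat b) [a,c] - \<alpha> x [b] * \<beta> (x + hat b) [c,a])
     + (\<alpha> x [c] * \<beta> (x + hat c) [a,b] - \<alpha> x [c] * \<beta> (x + hat c) [b,a])) / 2"
proof -
  let ?m = "[a,b,c]"
  have l: "[0..<1] = [0]" "[Suc 0..<3] = [1,2]" "Suc (Suc (Suc 0)) = 3" by (simp_all add: upt_rec)
  define g where "g = (\<lambda>i j k. \<alpha> x [?m ! i] * \<beta> (x + hat (?m ! i)) [?m ! j, ?m ! k] / 2)"
  have "cup 1 2 \<alpha> \<beta> x ?m = (\<Sum>\<sigma> | \<sigma> permutes {..<3}. of_int (sign \<sigma>) * g (\<sigma> 0) (\<sigma> 1) (\<sigma> 2))"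
    by (subst cup_alt) (simp_all add: l g_def)
  then show ?thesis unfolding sum_permutes_3 by (simp add: g_def diff_divide_distrib add_divide_distrib)
qed

lemma cup_2_2:
  "cup 2 2 \<alpha> \<beta> x [X1,X2,X3,X4] = 
   (let f = (\<lambda>a b c d. \<alpha> x [a,b] * \<beta> (x + hat a + hat b) [c,d] / 4) in
    f X1 X2 X3 X4 - f X1 X2 X4 X3 - f X1 X3 X2 X4 + f X1 X3 X4 X2 + f X1 X4 X2 X3 - f X1 X4 X3 X2
    - f X2 X1 X3 X4 + f X2 X1 X4 X3 + f X2 X3 X1 X4 - f X2 X3 X4 X1 - f X2 X4 X1 X3 + f X2 X4 X3 X1
    + f X3 X1 X2 X4 - f X3 X1 X4 X2 - f X3 X2 X1 X4 + f X3 X2 X4 X1 + f X3 X4 X1 X2 - f X3 X4 X2 X1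
    - f X4 X1 X2 X3 + f X4 X1 X3 X2 + f X4 X2 X1 X3 - f X4 X2 X3 X1 - f X4 X3 X1 X2 + f X4 X3 X2 X1)"
proof -
  let ?m = "[X1,X2,X3,X4]"
  have l: "[0..<2] = [0,1]" "[2..<4] = [2,3]" by (simp_all add: upt_rec)
  have s: "{..<2} = {0, Suc 0}" by auto
  define g where "g = (\<lambda>i j k m. \<alpha> x [?m ! i, ?m ! j] * \<beta> (x + hat (?m ! i) + hat (?m ! j)) [?m ! k, ?m ! m] / 4)"
  have "cup 2 2 \<alpha> \<beta> x ?m = (\<Sum>\<sigma> | \<sigma> permutes {..<4}. of_int (sign \<sigma>) * g (\<sigma> 0) (\<sigma> 1) (\<sigma> 2) (\<sigma> 3))"
    by (subst cup_alt) (simp_all add: l s add.assoc g_def)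
  then show ?thesis unfolding sum_permutes_4 by (simp add: g_def Let_def)
qed

lemma cup_1_3:
  "cup 1 3 \<alpha> \<beta> x [X1,X2,X3,X4] = 
   (let f = (\<lambda>a b c d. \<alpha> x [a] * \<beta> (x + hat a) [b,c,d] / 6) in
    f X1 X2 X3 X4 - f X1 X2 X4 X3 - f X1 X3 X2 X4 + f X1 X3 X4 X2 + f X1 X4 X2 X3 - f X1 X4 X3 X2
    - f X2 X1 X3 X4 + f X2 X1 X4 X3 + f X2 X3 X1 X4 - f X2 X3 X4 X1 - f X2 X4 X1 X3 + f X2 X4 X3 X1
    + f X3 X1 X2 X4 - f X3 X1 X4 X2 - f X3 X2 X1 X4 + f X3 X2 X4 X1 + f X3 X4 X1 X2 - f X3 X4 X2 X1
    - f X4 X1 X2 X3 + f X4 X1 X3 X2 + f X4 X2 X1 X3 - f X4 X2 X3 X1 - f X4 X3 X1 X2 + f X4 X3 X2 X1)"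
proof -
  let ?m = "[X1,X2,X3,X4]"
  have l: "[0..<1] = [0]" "[Suc 0..<4] = [1,2,3]" by (simp_all add: upt_rec)
  define g where "g = (\<lambda>i j k m. \<alpha> x [?m ! i] * \<beta> (x + hat (?m ! i)) [?m ! j, ?m ! k, ?m ! m] / 6)"
  have "cup 1 3 \<alpha> \<beta> x ?m = (\<Sum>\<sigma> | \<sigma> permutes {..<4}. of_int (sign \<sigma>) * g (\<sigma> 0) (\<sigma> 1) (\<sigma> 2) (\<sigma> 3))"
    by (subst cup_alt) (simp_all add: l fact_numeral g_def)
  then show ?thesis unfolding sum_permutes_4 by (simp add: g_def Let_def)
qed

lemma forms_2_iff:
  "\<alpha> \<in> forms 2 \<longleftrightarrow> (\<forall>x \<mu>s. length \<mu>s \<noteq> 2 \<longrightarrow> \<alpha> x \<mu>s = 0) \<and> (\<forall>x a b. \<alpha> x [b,a] = - \<alpha> x [a,b])"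
  (is "?L \<longleftrightarrow> ?R")
proof
  assume L: ?L
  have "\<alpha> x [b,a] = - \<alpha> x [a,b]" for x a b
  proof -
    have "Transposition.transpose 0 (Suc 0) permutes {..<length [a,b]}"
      by (rule permutes_swap_id) auto
    then have "\<alpha> x (permute_list (Transposition.transpose 0 (Suc 0)) [a,b]) = 
       of_int (sign (Transposition.transpose 0 (Suc 0))) * \<alpha> x [a,b]"
      using L unfolding forms_def by blast
    then show ?thesis by (simp add: permute_list_def sign_swap_id)
  qed
  moreover have "\<forall>x \<mu>s. length \<mu>s \<noteq> 2 \<longrightarrow> \<alpha> x \<mu>s = 0" using L unfolding forms_def by blast
  ultimately show ?R by blast
next
  assume R: ?R
  have "\<alpha> x (permute_list \<sigma> \<mu>s) = of_int (sign \<sigma>) * \<alpha> x \<mu>s" if "\<sigma> permutes {..<length \<mu>s}" for x \<sigma> \<mu>s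
  proof (cases "length \<mu>s = 2")
    case False
    then have "\<alpha> x (permute_list \<sigma> \<mu>s) = 0" "\<alpha> x \<mu>s = 0" using R[THEN conjunct1] by simp_all
    then show ?thesis by simp
  next
    case True
    then obtain a b where ab: "\<mu>s = [a,b]" by (auto simp: length_Suc_conv numeral_2_eq_2)
    have "\<sigma> permutes {0, Suc 0}" using that ab by (simp add: lessThan_Suc insert_commute)
    then have "\<sigma> = id \<or> \<sigma> = Transposition.transpose 0 (Suc 0)"
      by (simp add: permutes_doubleton_iff)
    moreover have "\<alpha> x [b,a] = - \<alpha> x [a,b]" using R by blast
    ultimately show ?thesis by (elim disjE) (simp_all add: ab permute_list_def sign_swap_id)
  qed
  then show ?L using R unfolding forms_def by blast
qed

lemma forms_1_iff: "\<alpha> \<in> forms 1 \<longleftrightarrow> (\<forall>x \<mu>s. length \<mu>s \<noteq> 1 \<longrightarrow> \<alpha> x \<mu>s = 0)"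
proof -
  have "\<alpha> x (permute_list \<sigma> \<mu>s) = of_int (sign \<sigma>) * \<alpha> x \<mu>s"
    if "\<sigma> permutes {..<length \<mu>s}" "length \<mu>s = 1" for x \<sigma> \<mu>s
  proof -
    have "\<sigma> = id" using that by (simp add: lessThan_Suc permutes_sing)
    then show ?thesis by simp
  qed
  moreover have "\<alpha> x (permute_list \<sigma> \<mu>s) = of_int (sign \<sigma>) * \<alpha> x \<mu>s"
    if "\<forall>x \<mu>s. length \<mu>s \<noteq> 1 \<longrightarrow> \<alpha> x \<mu>s = 0" "length \<mu>s \<noteq> 1" for x \<sigma> \<mu>s
    using that by simp
  ultimately show ?thesis unfolding forms_def by blast
qed

text \<open>Adjacent transpositions generate the symmetric group: the converse goes by induction
  over products of transpositions, after checking the three transpositions of three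
  positions.\<close>

lemma forms_3_iff:
  "\<alpha> \<in> forms 3 \<longleftrightarrow> (\<forall>x \<mu>s. length \<mu>s \<noteq> 3 \<longrightarrow> \<alpha> x \<mu>s = 0) \<and>
     (\<forall>x a b c. \<alpha> x [b,a,c] = - \<alpha> x [a,b,c] \<and> \<alpha> x [a,c,b] = - \<alpha> x [a,b,c])"
  (is "?L \<longleftrightarrow> ?R")
proof
  assume L: ?L
  have *: "\<alpha> x (permute_list (Transposition.transpose i j) [a,b,c]) = - \<alpha> x [a,b,c]"
    if "i < 3" "j < 3" "i \<noteq> j" for x a b c i j
  proof -
    have "Transposition.transpose i j permutes {..<length [a,b,c]}"
      by (rule permutes_swap_id) (use that in auto)
    then have "\<alpha> x (permute_list (Transposition.transpose i j) [a,b,c]) = 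
       of_int (sign (Transposition.transpose i j)) * \<alpha> x [a,b,c]"
      using L unfolding forms_def by blast
    then show ?thesis using that by (simp add: sign_swap_id)
  qed
  have l: "[0..<3] = [0,1,2]" by (simp add: upt_rec)
  have "\<forall>x \<mu>s. length \<mu>s \<noteq> 3 \<longrightarrow> \<alpha> x \<mu>s = 0" using L unfolding forms_def by blast
  moreover have "\<alpha> x [b,a,c] = - \<alpha> x [a,b,c]" "\<alpha> x [a,c,b] = - \<alpha> x [a,b,c]" for x a b c
    using *[of 0 1 x a b c] *[of 1 2 x a b c]
    by (simp_all add: permute_list_def l Transposition.transpose_def)
  ultimately show ?R by blast
next
  assume R: ?R
  have l: "[0..<3] = [0,1,2]" by (simp add: upt_rec)
  have "\<alpha> x (permute_list \<sigma> \<mu>s) = of_int (sign \<sigma>) * \<alpha> x \<mu>s"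
    if "\<sigma> permutes {..<length \<mu>s}" "length \<mu>s = 3" for x \<sigma> \<mu>s
  proof -
    have "\<sigma> permutes {..<3}" using that by simp
    moreover have "finite {..<3::nat}" by simp
    ultimately show ?thesis using that(2)
    proof (induction arbitrary: \<mu>s rule: permutes_induct)
      case id
      then show ?case by simp
    next
      case (swap i j \<sigma>)
      have p: "permute_list (Transposition.transpose i j \<circ> \<sigma>) \<mu>s = permute_list \<sigma> (permute_list (Transposition.transpose i j) \<mu>s)"
        by (rule permute_list_compose) (use swap in auto)
      have q: "\<alpha> x (permute_list (Transposition.transpose i j) \<mu>s) = - \<alpha> x \<mu>s"
      proof -
        obtain a b c where abc: "\<mu>s = [a,b,c]" using swap.prems by (auto simp: length_Suc_conv numeral_3_eq_3)
        have "i = 0 \<or> i = 1 \<or> i = 2" "j = 0 \<or> j = 1 \<or> j = 2" using swap by auto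
        moreover have "\<alpha> x [c,b,a] = - \<alpha> x [b,c,a]" "\<alpha> x [b,c,a] = - \<alpha> x [b,a,c]"
          "\<alpha> x [b,a,c] = - \<alpha> x [a,b,c]" "\<alpha> x [a,c,b] = - \<alpha> x [a,b,c]" using R by blast+
        ultimately show ?thesis using swap.hyps(3) unfolding abc permute_list_def
          by (elim disjE) (simp_all add: l Transposition.transpose_def)
      qed
      have sg: "sign (Transposition.transpose i j \<circ> \<sigma>) = - sign \<sigma>"
        using swap permutes_imp_permutation[OF finite_lessThan swap.hyps(4)]
        by (simp add: sign_compose permutation_swap_id sign_swap_id)
      then show ?case using swap.IH[of "permute_list (Transposition.transpose i j) \<mu>s"] swap.prems q
        unfolding p sg by simp
    qed
  qed
  moreover have "\<alpha> x (permute_list \<sigma> \<mu>s) = of_int (sign \<sigma>) * \<alpha> x \<mu>s"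
    if "length \<mu>s \<noteq> 3" for x \<sigma> \<mu>s
    using that R[THEN conjunct1] by simp
  ultimately show ?L using R unfolding forms_def by blast
qed

lemma cup_2_1:
  "cup 2 1 \<alpha> \<beta> x [a,b,c] = 
    ((\<alpha> x [a,b] * \<beta> (x + (hat a + hat b)) [c] - \<alpha> x [a,c] * \<beta> (x + (hat a + hat c)) [b])
     - (\<alpha> x [b,a] * \<beta> (x + (hat b + hat a)) [c] - \<alpha> x [b,c] * \<beta> (x + (hat b + hat c)) [a])
     + (\<alpha> x [c,a] * \<beta> (x + (hat c + hat a)) [b] - \<alpha> x [c,b] * \<beta> (x + (hat c + hat b)) [a])) / 2"
proof -
  let ?m = "[a,b,c]"
  have l: "[0..<2] = [0,1]" "[2..<3] = [2]" "Suc (Suc (Suc 0)) = 3" "{..<2} = {0, Suc 0}" by (auto simp add: upt_rec)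
  define g where "g = (\<lambda>i j k. \<alpha> x [?m ! i, ?m ! j] * \<beta> (x + (hat (?m ! i) + hat (?m ! j))) [?m ! k] / 2)"
  have "cup 2 1 \<alpha> \<beta> x ?m = (\<Sum>\<sigma> | \<sigma> permutes {..<3}. of_int (sign \<sigma>) * g (\<sigma> 0) (\<sigma> 1) (\<sigma> 2))"
    by (subst cup_alt) (simp_all add: l g_def)
  then show ?thesis unfolding sum_permutes_3 by (simp add: g_def diff_divide_distrib add_divide_distrib)
qed

lemma forms_2_flip:
  assumes "\<alpha> \<in> forms 2"
  shows "\<alpha> x [X2,X1] = - \<alpha> x [X1,X2]" "\<alpha> x [X3,X1] = - \<alpha> x [X1,X3]" "\<alpha> x [X4,X1] = - \<alpha> x [X1,X4]"
    "\<alpha> x [X3,X2] = - \<alpha> x [X2,X3]" "\<alpha> x [X4,X2] = - \<alpha> x [X2,X4]" "\<alpha> x [X4,X3] = - \<alpha> x [X3,X4]"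
    "\<alpha> x [\<mu>,\<mu>] = 0"
proof -
  have *: "\<alpha> x [b,a] = - \<alpha> x [a,b]" for a b using assms unfolding forms_2_iff by blast
  show "\<alpha> x [X2,X1] = - \<alpha> x [X1,X2]" "\<alpha> x [X3,X1] = - \<alpha> x [X1,X3]" "\<alpha> x [X4,X1] = - \<alpha> x [X1,X4]"
    "\<alpha> x [X3,X2] = - \<alpha> x [X2,X3]" "\<alpha> x [X4,X2] = - \<alpha> x [X2,X4]" "\<alpha> x [X4,X3] = - \<alpha> x [X3,X4]"
    by (rule *)+
  show "\<alpha> x [\<mu>,\<mu>] = 0" using *[of \<mu> \<mu>] by simp
qed

lemma ext_d_2: "ext_d \<alpha> x [a,b] = \<alpha> (x + hat a) [b] - \<alpha> x [b] - (\<alpha> (x + hat b) [a] - \<alpha> x [a])"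
  by (simp add: ext_d_def remove_at_def)

lemma ext_d_3: "ext_d \<alpha> x [a,b,c] = \<alpha> (x + hat a) [b,c] - \<alpha> x [b,c] - (\<alpha> (x + hat b) [a,c] - \<alpha> x [a,c])
   + (\<alpha> (x + hat c) [a,b] - \<alpha> x [a,b])"
  by (simp add: ext_d_def remove_at_def)

text \<open>By antisymmetry of both factors the 24 permutations fall into six groups of four equal
  terms, which absorb the 1/4. One term remains for each ordered splitting of the four directions
  into two planes.\<close>

lemma sum4_cup_2_2:
  assumes "\<alpha> \<in> forms 2" "\<beta> \<in> forms 2"
  shows "sum4 (cup 2 2 \<alpha> \<beta>) = (\<Sum>x\<in>UNIV.
      \<alpha> x [X1,X2] * \<beta> (x + (hat X1 + hat X2)) [X3,X4] - \<alpha> x [X1,X3] * \<beta> (x + (hat X1 + hat X3)) [X2,X4]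
    + \<alpha> x [X1,X4] * \<beta> (x + (hat X1 + hat X4)) [X2,X3] + \<alpha> x [X2,X3] * \<beta> (x + (hat X2 + hat X3)) [X1,X4]
    - \<alpha> x [X2,X4] * \<beta> (x + (hat X2 + hat X4)) [X1,X3] + \<alpha> x [X3,X4] * \<beta> (x + (hat X3 + hat X4)) [X1,X2])"
  unfolding sum4_def cup_2_2 Let_def
  by (intro sum.cong refl) (simp add: forms_2_flip[OF assms(1)] forms_2_flip[OF assms(2)] add.assoc
      add.commute[of "hat X2" "hat X1"] add.commute[of "hat X3" "hat X1"] add.commute[of "hat X4" "hat X1"]
      add.commute[of "hat X3" "hat X2"] add.commute[of "hat X4" "hat X2"] add.commute[of "hat X4" "hat X3"])

lemma forms_3_flip:
  assumes "\<alpha> \<in> forms 3"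
  shows "\<alpha> x [X1,X3,X2] = - \<alpha> x [X1,X2,X3]"
    "\<alpha> x [X2,X1,X3] = - \<alpha> x [X1,X2,X3]"
    "\<alpha> x [X2,X3,X1] = \<alpha> x [X1,X2,X3]"
    "\<alpha> x [X3,X1,X2] = \<alpha> x [X1,X2,X3]"
    "\<alpha> x [X3,X2,X1] = - \<alpha> x [X1,X2,X3]"
    "\<alpha> x [X1,X4,X2] = - \<alpha> x [X1,X2,X4]"
    "\<alpha> x [X2,X1,X4] = - \<alpha> x [X1,X2,X4]"
    "\<alpha> x [X2,X4,X1] = \<alpha> x [X1,X2,X4]"
    "\<alpha> x [X4,X1,X2] = \<alpha> x [X1,X2,X4]"
    "\<alpha> x [X4,X2,X1] = - \<alpha> x [X1,X2,X4]"
    "\<alpha> x [X1,X4,X3] = - \<alpha> x [X1,X3,X4]"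
    "\<alpha> x [X3,X1,X4] = - \<alpha> x [X1,X3,X4]"
    "\<alpha> x [X3,X4,X1] = \<alpha> x [X1,X3,X4]"
    "\<alpha> x [X4,X1,X3] = \<alpha> x [X1,X3,X4]"
    "\<alpha> x [X4,X3,X1] = - \<alpha> x [X1,X3,X4]"
    "\<alpha> x [X2,X4,X3] = - \<alpha> x [X2,X3,X4]"
    "\<alpha> x [X3,X2,X4] = - \<alpha> x [X2,X3,X4]"
    "\<alpha> x [X3,X4,X2] = \<alpha> x [X2,X3,X4]"
    "\<alpha> x [X4,X2,X3] = \<alpha> x [X2,X3,X4]"
    "\<alpha> x [X4,X3,X2] = - \<alpha> x [X2,X3,X4]"
    "\<alpha> x [\<mu>,\<mu>,\<nu>] = 0" "\<alpha> x [\<mu>,\<nu>,\<mu>] = 0" "\<alpha> x [\<nu>,\<mu>,\<mu>] = 0"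
proof -
  have *: "\<alpha> x [b,a,c] = - \<alpha> x [a,b,c]" "\<alpha> x [a,c,b] = - \<alpha> x [a,b,c]" for a b c
    using assms unfolding forms_3_iff by blast+
  have **: "\<alpha> x [b,c,a] = \<alpha> x [a,b,c]" for a b c
    using *(2)[where a=b and b=c and c=a] *(1)[where a=a and b=b and c=c] by linarith
  have ***: "\<alpha> x [c,a,b] = \<alpha> x [a,b,c]" for a b c
    using **[where a=c and b=a and c=b] by (rule sym)
  have ****: "\<alpha> x [c,b,a] = - \<alpha> x [a,b,c]" for a b c
    using *(1)[where a=b and b=c and c=a] **[where a=a and b=b and c=c] by linarith
  show "\<alpha> x [X1,X3,X2] = - \<alpha> x [X1,X2,X3]"
    "\<alpha> x [X2,X1,X3] = - \<alpha> x [X1,X2,X3]"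
    "\<alpha> x [X2,X3,X1] = \<alpha> x [X1,X2,X3]"
    "\<alpha> x [X3,X1,X2] = \<alpha> x [X1,X2,X3]"
    "\<alpha> x [X3,X2,X1] = - \<alpha> x [X1,X2,X3]"
    "\<alpha> x [X1,X4,X2] = - \<alpha> x [X1,X2,X4]"
    "\<alpha> x [X2,X1,X4] = - \<alpha> x [X1,X2,X4]"
    "\<alpha> x [X2,X4,X1] = \<alpha> x [X1,X2,X4]"
    "\<alpha> x [X4,X1,X2] = \<alpha> x [X1,X2,X4]"
    "\<alpha> x [X4,X2,X1] = - \<alpha> x [X1,X2,X4]"
    "\<alpha> x [X1,X4,X3] = - \<alpha> x [X1,X3,X4]"
    "\<alpha> x [X3,X1,X4] = - \<alpha> x [X1,X3,X4]"
    "\<alpha> x [X3,X4,X1] = \<alpha> x [X1,X3,X4]"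
    "\<alpha> x [X4,X1,X3] = \<alpha> x [X1,X3,X4]"
    "\<alpha> x [X4,X3,X1] = - \<alpha> x [X1,X3,X4]"
    "\<alpha> x [X2,X4,X3] = - \<alpha> x [X2,X3,X4]"
    "\<alpha> x [X3,X2,X4] = - \<alpha> x [X2,X3,X4]"
    "\<alpha> x [X3,X4,X2] = \<alpha> x [X2,X3,X4]"
    "\<alpha> x [X4,X2,X3] = \<alpha> x [X2,X3,X4]"
    "\<alpha> x [X4,X3,X2] = - \<alpha> x [X2,X3,X4]"
    by (rule * ** *** ****)+
  show "\<alpha> x [\<mu>,\<mu>,\<nu>] = 0" "\<alpha> x [\<nu>,\<mu>,\<mu>] = 0" 
    using *(1)[of \<mu> \<mu> \<nu>] *(2)[of \<nu> \<mu> \<mu>] by simp_all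
  then show "\<alpha> x [\<mu>,\<nu>,\<mu>] = 0" using *(1)[of \<nu> \<mu> \<mu>] by simp
qed

lemma site_minus_minus: "x - (- a - b) = x + (a + (b :: 'a :: ab_group_add))"
  by simp

text \<open>Each of the four removed directions contributes an ordinary cup product of a 1-form with
  a 2-form, that is three terms. The outer and inner reflections compose to the identity on sites,
  so only shifts by unit vectors survive.\<close>

lemma cup1_2_3:
  assumes a: "\<alpha> \<in> forms 2" and b: "\<beta> \<in> forms 3"
  shows "cup1 2 3 \<alpha> \<beta> x [X1,X2,X3,X4] = \<alpha> (x + (hat X3 + hat X4)) [X1,X2] * \<beta> x [X1,X3,X4] - \<alpha> (x + (hat X2 + hat X4)) [X1,X3] * \<beta> x [X1,X2,X4] + \<alpha> (x + (hat X2 + hat X3)) [X1,X4] * \<beta> x [X1,X2,X3] + \<alpha> (x + (hat X3 + hat X4)) [X1,X2] * \<beta> (x + hat X1) [X2,X3,X4] - \<alpha> (x + hat X4) [X2,X3] * \<beta> x [X1,X2,X4] + \<alpha> (x + hat X3) [X2,X4] * \<beta> x [X1,X2,X3] + \<alpha> (x + hat X4) [X1,X3] * \<beta> (x + hat X1) [X2,X3,X4] - \<alpha> (x + hat X4) [X2,X3] * \<beta> (x + hat X2) [X1,X3,X4] + \<alpha> x [X3,X4] * \<beta> x [X1,X2,X3] + \<alpha> x [X1,X4] * \<beta> (x + hat X1) [X2,X3,X4] - \<alpha> x [X2,X4] * \<beta> (x + hat X2) [X1,X3,X4] + \<alpha> x [X3,X4] * \<beta> (x + hat X3) [X1,X2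,X4]"
  apply (simp add: cup1_def reflect_def contract_def remove_at_def cup_1_2[unfolded One_nat_def]
     reflect_site_simps lessThan_Suc forms_2_flip[OF a] forms_3_flip[OF b] site_minus_minus 
      add.commute[of "hat X2" "hat X1"] add.commute[of "hat X3" "hat X1"] add.commute[of "hat X4" "hat X1"]
      add.commute[of "hat X3" "hat X2"] add.commute[of "hat X4" "hat X2"] add.commute[of "hat X4" "hat X3"]
      cong del: if_weak_cong)
  apply (simp add: field_simps)
  done

lemma cup1_3_2:
  assumes a: "\<alpha> \<in> forms 3" and b: "\<beta> \<in> forms 2"
  shows "cup1 3 2 \<alpha> \<beta> x [X1,X2,X3,X4] = - \<alpha> (x + hat X4) [X1,X2,X3] * \<beta> x [X1,X4] + \<alpha> (x + hat X3) [X1,X2,X4] * \<beta> x [X1,X3] - \<alpha> (x + hat X2) [X1,X3,X4] * \<beta> x [X1,X2] - \<alpha> (x + hat X4) [X1,X2,X3] * \<beta> (x + hat X1) [X2,X4] + \<alpha> (x + hat X3) [X1,X2,X4] * \<beta> (x + hat X1) [X2,X3] - \<alpha> x [X2,X3,X4] * \<beta> x [X1,X2] - \<alpha> (x + hat X4) [X1,X2,X3] * \<beta> (x + (hat X1 + hat X2)) [X3,X4] + \<alpha> x [X1,X3,X4] * \<beta> (x + hat X1) [X2,X3] - \<alpha> x [X2,X3,X4] * \<beta> (x + hat X2) [X1,X3] - \<alpha> x [X1,X2,X4] * \<beta> (x + (hat X1 + hat X2)) [X3,X4] + \<alpha> x [X1,X3,X4] * \<beta> (x + (hat X1 + hat X3))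 [X2,X4] - \<alpha> x [X2,X3,X4] * \<beta> (x + (hat X2 + hat X3)) [X1,X4]"
  apply (simp add: cup1_def reflect_def contract_def remove_at_def cup_2_1[unfolded One_nat_def]
     reflect_site_simps lessThan_Suc forms_2_flip[OF b] forms_3_flip[OF a] 
      add.commute[of "hat X2" "hat X1"] add.commute[of "hat X3" "hat X1"] add.commute[of "hat X4" "hat X1"]
      add.commute[of "hat X3" "hat X2"] add.commute[of "hat X4" "hat X2"] add.commute[of "hat X4" "hat X3"]
     cong del: if_weak_cong)
  apply (simp add: field_simps)
  done

lemma sum4_cup_1_3:
  assumes b: "\<beta> \<in> forms 3"
  shows "sum4 (cup 1 3 \<alpha> \<beta>) = (\<Sum>x\<in>UNIV. \<alpha> x [X1] * \<beta> (x + hat X1) [X2,X3,X4] - \<alpha> x [X2] * \<beta> (x + hat X2) [X1,X3,X4] + \<alpha> x [X3] * \<beta> (x + hat X3) [X1,X2,X4] - \<alpha> x [X4] * \<beta> (x + hat X4) [X1,X2,X3])"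
  unfolding sum4_def cup_1_3 Let_def by (intro sum.cong refl) (simp add: forms_3_flip[OF b])

section \<open>Increasing components determine a form; degrees of \<open>ext_d\<close> and
  \<open>codiff\<close>\<close>

lemma forms_3_vanish: 
  assumes "\<alpha> \<in> forms 3" "\<And>L. L \<in> increasing_indices 3 \<Longrightarrow> \<alpha> x L = 0" 
  shows "\<alpha> x L = 0"
proof (cases "length L = 3")
  case True
  then obtain a b c where L: "L = [a,b,c]" by (auto simp: length_Suc_conv numeral_3_eq_3)
  have "\<alpha> x [X1,X2,X3] = 0" "\<alpha> x [X1,X2,X4] = 0" "\<alpha> x [X1,X3,X4] = 0" "\<alpha> x [X2,X3,X4] = 0"
    by (rule assms(2), simp add: increasing_indices_3)+
  then show ?thesis unfolding L
    by (cases a; cases b; cases c) (simp_all add: forms_3_flip[OF assms(1)])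
next
  case False
  then show ?thesis using assms(1) unfolding forms_3_iff by blast
qed

lemma forms_2_vanish: 
  assumes "\<alpha> \<in> forms 2" "\<And>L. L \<in> increasing_indices 2 \<Longrightarrow> \<alpha> x L = 0" 
  shows "\<alpha> x L = 0"
proof (cases "length L = 2")
  case True
  then obtain a b where L: "L = [a,b]" by (auto simp: length_Suc_conv numeral_2_eq_2)
  have "\<alpha> x [X1,X2] = 0" "\<alpha> x [X1,X3] = 0" "\<alpha> x [X1,X4] = 0" "\<alpha> x [X2,X3] = 0" "\<alpha> x [X2,X4] = 0" "\<alpha> x [X3,X4] = 0"
    by (rule assms(2), simp add: increasing_indices_2)+
  then show ?thesis unfolding L
    by (cases a; cases b) (simp_all add: forms_2_flip[OF assms(1)])
next
  case False
  then show ?thesis using assms(1) unfolding forms_2_iff by blast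
qed

lemma forms_length: "\<alpha> \<in> forms r \<Longrightarrow> length L \<noteq> r \<Longrightarrow> \<alpha> x L = 0"
  unfolding forms_def by blast

lemma length_remove_at: "j < length L \<Longrightarrow> length (remove_at j L) = length L - 1"
  by (auto simp: remove_at_def)

lemma ext_d_length:
  assumes "\<alpha> \<in> forms r" "length L \<noteq> Suc r"
  shows "ext_d \<alpha> x L = 0"
  unfolding ext_d_def
proof (intro sum.neutral ballI)
  fix j assume "j \<in> {..<length L}"
  then have "length (remove_at j L) \<noteq> r" using assms(2) by (auto simp: length_remove_at)
  then show "(-1) ^ j * (\<alpha> (x + hat (L ! j)) (remove_at j L) - \<alpha> x (remove_at j L)) = 0"
    by (simp add: forms_length[OF assms(1)])
qed

lemma ext_d_forms_2:
  assumes "\<alpha> \<in> forms 1"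
  shows "ext_d \<alpha> \<in> forms 2"
  unfolding forms_2_iff using ext_d_length[OF assms] by (simp add: ext_d_2 numeral_2_eq_2)

lemma ext_d_forms_3:
  assumes "\<alpha> \<in> forms 2"
  shows "ext_d \<alpha> \<in> forms 3"
proof -
  have *: "\<alpha> x [b,a] = - \<alpha> x [a,b]" for x a b using assms unfolding forms_2_iff by blast
  have "ext_d \<alpha> x L = 0" if "length L \<noteq> 3" for x L
    using ext_d_length[OF assms] that by simp
  moreover have "ext_d \<alpha> x [b,a,c] = - ext_d \<alpha> x [a,b,c]" for x a b c
    unfolding ext_d_3 using *[of _ b a] by simp
  moreover have "ext_d \<alpha> x [a,c,b] = - ext_d \<alpha> x [a,b,c]" for x a b c
    unfolding ext_d_3 using *[of _ c b] by simp
  ultimately show ?thesis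
    unfolding forms_3_iff by blast
qed

lemma codiff_length:
  assumes "\<alpha> \<in> forms (Suc r)" "length L \<noteq> r"
  shows "codiff \<alpha> x L = 0"
  unfolding codiff_def by (intro sum.neutral) (simp add: forms_length[OF assms(1)] assms(2))

lemma codiff_forms_2:
  assumes "\<alpha> \<in> forms 3"
  shows "codiff \<alpha> \<in> forms 2"
proof -
  have *: "\<alpha> x [b,a,c] = - \<alpha> x [a,b,c]" for x a b c using assms unfolding forms_3_iff by blast
  have "codiff \<alpha> x [b,a] = - codiff \<alpha> x [a,b]" for x a b
    unfolding codiff_def sum_negf[symmetric] by (intro sum.cong refl) (simp add: *[of _ b a])
  moreover have "codiff \<alpha> x L = 0" if "length L \<noteq> 2" for x L
    using codiff_length[of \<alpha> 2 L x] assms that by (simp add: numeral_3_eq_3)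
  ultimately show ?thesis unfolding forms_2_iff by blast
qed

lemma codiff_forms_1:
  assumes "\<alpha> \<in> forms 2"
  shows "codiff \<alpha> \<in> forms 1"
  unfolding forms_1_iff using codiff_length[of \<alpha> 1] assms by (simp add: numeral_2_eq_2)

section \<open>Summation by parts\<close>

text \<open>On the periodic lattice a sum of products depends only on the relative displacement of
  its two factors. Rewriting a bilinear identity with \<open>sum_to_corr\<close> therefore leaves an
  identity between finitely many correlations, to be checked by rearranging terms. All partial
  summations of this section are carried out in this way.\<close>

definition corr :: "('n::finite) form \<Rightarrow> dir list \<Rightarrow> 'n form \<Rightarrow> dir list \<Rightarrow> 'n site \<Rightarrow> real" where
  "corr \<alpha> L \<beta> M s = (\<Sum>x\<in>UNIV. \<alpha> x L * \<beta> (x + s) M)"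

lemma sum_eq_corr:
  "(\<Sum>x\<in>UNIV. \<alpha> x L * \<beta> x M) = corr \<alpha> L \<beta> M 0"
  "(\<Sum>x\<in>UNIV. \<alpha> x L * \<beta> (x + t) M) = corr \<alpha> L \<beta> M t"
  "(\<Sum>x\<in>UNIV. \<alpha> (x + s) L * \<beta> x M) = corr \<alpha> L \<beta> M (- s)"
  "(\<Sum>x\<in>UNIV. \<alpha> (x + s) L * \<beta> (x + t) M) = corr \<alpha> L \<beta> M (t - s)"
  for \<alpha> \<beta> :: "('n::finite) form"
proof -
  have *: "(\<Sum>x\<in>UNIV. \<alpha> (x + s) L * \<beta> (x + t) M) = corr \<alpha> L \<beta> M (t - s)" for s t
    using sum_site_shift[of "\<lambda>x. \<alpha> (x + s) L * \<beta> (x + t) M" "- s"] by (simp add: corr_def algebra_simps)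
  show "(\<Sum>x\<in>UNIV. \<alpha> x L * \<beta> x M) = corr \<alpha> L \<beta> M 0"
    "(\<Sum>x\<in>UNIV. \<alpha> x L * \<beta> (x + t) M) = corr \<alpha> L \<beta> M t"
    by (simp_all add: corr_def)
  show "(\<Sum>x\<in>UNIV. \<alpha> (x + s) L * \<beta> x M) = corr \<alpha> L \<beta> M (- s)" using *[of s 0] by simp
  show "(\<Sum>x\<in>UNIV. \<alpha> (x + s) L * \<beta> (x + t) M) = corr \<alpha> L \<beta> M (t - s)" by (rule *)
qed

lemmas sum_to_corr = sum.distrib sum_subtractf sum_negf ring_distribs
  sum_eq_corr mult_minus_left mult_minus_right minus_mult_minus minus_minus mult_zero_left mult_zero_right
  add_0_right add_0_left diff_0 diff_0_right minus_zero sum.neutral_const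

text \<open>Summed form of Steenrod's relation: \<open>cup1\<close> measures the failure of the cup
  product to commute, up to a total derivative, whose sum over the torus vanishes.\<close>

lemma cup_commutator:
  assumes a: "\<alpha> \<in> forms 2" and b: "\<beta> \<in> forms 2"
  shows "sum4 (cup 2 2 \<alpha> \<beta>) - sum4 (cup 2 2 \<beta> \<alpha>) =
    sum4 (cup1 2 3 \<alpha> (ext_d \<beta>)) + sum4 (cup1 3 2 (ext_d \<alpha>) \<beta>)"
proof -
  have c: "sum4 (cup 2 2 \<beta> \<alpha>) = (\<Sum>x\<in>UNIV.
      \<alpha> (x + (hat X1 + hat X2)) [X3,X4] * \<beta> x [X1,X2] - \<alpha> (x + (hat X1 + hat X3)) [X2,X4] * \<beta> x [X1,X3]
    + \<alpha> (x + (hat X1 + hat X4)) [X2,X3] * \<beta> x [X1,X4] + \<alpha> (x + (hat X2 + hat X3)) [X1,X4] * \<beta> x [X2,X3]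
    - \<alpha> (x + (hat X2 + hat X4)) [X1,X3] * \<beta> x [X2,X4] + \<alpha> (x + (hat X3 + hat X4)) [X1,X2] * \<beta> x [X3,X4])"
    by (simp add: sum4_cup_2_2[OF b a] mult.commute)
  show ?thesis
    unfolding sum4_cup_2_2[OF a b] c
    unfolding sum4_def cup1_2_3[OF a ext_d_forms_3[OF b]] cup1_3_2[OF ext_d_forms_3[OF a] b] ext_d_3
    by (simp only: sum_to_corr add.assoc) (simp add: algebra_simps)
qed

text \<open>Leibniz rule for the cup product; the total derivative sums to zero on the
  torus.\<close>

lemma stokes:
  assumes a: "\<alpha> \<in> forms 1" and b: "\<beta> \<in> forms 2"
  shows "sum4 (cup 2 2 (ext_d \<alpha>) \<beta>) = sum4 (cup 1 3 \<alpha> (ext_d \<beta>))"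
  unfolding sum4_cup_2_2[OF ext_d_forms_2[OF a] b] sum4_cup_1_3[OF ext_d_forms_3[OF b]] ext_d_3 ext_d_2
    by (simp only: sum_to_corr add.assoc) (simp add: algebra_simps)

text \<open>Backward differences are written as shifts by \<open>- hat\<close>, the shape that
  \<open>sum_eq_corr\<close> recognises.\<close>

lemma codiff_eq: "codiff \<alpha> x L = (\<alpha> x (L @ [X1]) - \<alpha> (x + - hat X1) (L @ [X1])) + (\<alpha> x (L @ [X2]) - \<alpha> (x + - hat X2) (L @ [X2]))
   + (\<alpha> x (L @ [X3]) - \<alpha> (x + - hat X3) (L @ [X3])) + (\<alpha> x (L @ [X4]) - \<alpha> (x + - hat X4) (L @ [X4]))"
  by (simp add: codiff_def sum_dir)

text \<open>The adjoint of a forward difference is minus a backward one, and \<open>codiff\<close>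
  appends its index in the last position, where \<open>ext_d\<close> carries the sign (-1)^2. One
  degree lower that last sign is -1 and the two signs cancel.\<close>

lemma form_dot_codiff_3:
  assumes a: "\<alpha> \<in> forms 3" and b: "\<beta> \<in> forms 2"
  shows "form_dot 2 (codiff \<alpha>) \<beta> = - form_dot 3 \<alpha> (ext_d \<beta>)"
  unfolding form_dot_2 form_dot_3 ext_d_3 codiff_eq append.simps forms_3_flip[OF a]
    by (simp only: sum_to_corr add.assoc)

lemma form_dot_codiff_2:
  assumes a: "\<alpha> \<in> forms 2" and b: "\<beta> \<in> forms 1"
  shows "form_dot 1 (codiff \<alpha>) \<beta> = form_dot 2 \<alpha> (ext_d \<beta>)"
  unfolding form_dot_2 form_dot_1 ext_d_2 codiff_eq append.simps forms_2_flip[OF a]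
    by (simp only: sum_to_corr add.assoc)

text \<open>Analogue, on the dual lattice, of the vanishing of the summed cup product of two exact
  forms. It is what makes the dual of a coexact form closed.\<close>

lemma cup_codiff_codiff:
  assumes a: "\<alpha> \<in> forms 3" and b: "\<beta> \<in> forms 3"
  shows "sum4 (cup 2 2 (codiff \<alpha>) (codiff \<beta>)) = 0"
  unfolding sum4_cup_2_2[OF codiff_forms_2[OF a] codiff_forms_2[OF b]] codiff_eq append.simps forms_3_flip[OF a] forms_3_flip[OF b]
    by (simp only: sum_to_corr add.assoc) (simp add: algebra_simps)

text \<open>On the flat torus the Hodge Laplacian acts on each component as the scalar lattice
  Laplacian. A 2-form that is both closed and coclosed is therefore constant.\<close>

lemma weitzenboeck:
  assumes a: "\<alpha> \<in> forms 2" and b: "\<beta> \<in> forms 2"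
  shows "form_dot 3 (ext_d \<alpha>) (ext_d \<beta>) + form_dot 1 (codiff \<alpha>) (codiff \<beta>) =
    (\<Sum>\<mu>\<in>UNIV. form_dot 2 (\<lambda>x L. \<alpha> (x + hat \<mu>) L - \<alpha> x L) (\<lambda>x L. \<beta> (x + hat \<mu>) L - \<beta> x L))"
  unfolding form_dot_2 form_dot_1 form_dot_3 sum_dir ext_d_3 codiff_eq append.simps forms_2_flip[OF a]  forms_2_flip[OF b]
    by (simp only: sum_to_corr add.assoc) (simp add: algebra_simps)

section \<open>Linear combinations of forms\<close>

text \<open>One combinator serves for sums, differences (coefficient -1) and multiples
  (\<open>lin c b 0 b\<close>), so that a single linearity rule per operation suffices.\<close>

definition lin :: "real \<Rightarrow> ('n::finite) form \<Rightarrow> real \<Rightarrow> 'n form \<Rightarrow> 'n form" where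
  "lin a \<alpha> b \<beta> = (\<lambda>x L. a * \<alpha> x L + b * \<beta> x L)"

lemma lin_apply: "lin a \<alpha> b \<beta> x L = a * \<alpha> x L + b * \<beta> x L"
  by (simp add: lin_def)

lemma lin_forms: "\<alpha> \<in> forms r \<Longrightarrow> \<beta> \<in> forms r \<Longrightarrow> lin a \<alpha> b \<beta> \<in> forms r"
  by (auto simp: forms_def lin_def algebra_simps)

lemma lin_int_forms: "\<alpha> \<in> int_forms r \<Longrightarrow> \<beta> \<in> int_forms r \<Longrightarrow> a \<in> \<int> \<Longrightarrow> b \<in> \<int> \<Longrightarrow> lin a \<alpha> b \<beta> \<in> int_forms r"
  unfolding int_forms_def using lin_forms[of \<alpha> r \<beta> a b] by (simp add: lin_def)

lemma zero_forms: "(\<lambda>x L. 0) \<in> forms r"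
  by (simp add: forms_def)

lemma int_forms_forms: "\<alpha> \<in> int_forms r \<Longrightarrow> \<alpha> \<in> forms r"
  by (simp add: int_forms_def)

lemma ext_d_lin: "ext_d (lin a \<alpha> b \<beta>) = lin a (ext_d \<alpha>) b (ext_d \<beta>)"
  by (intro ext) (simp add: ext_d_def lin_def sum_distrib_left sum.distrib[symmetric] algebra_simps)

lemma codiff_lin: "codiff (lin a \<alpha> b \<beta>) = lin a (codiff \<alpha>) b (codiff \<beta>)"
  by (intro ext) (simp add: codiff_eq lin_def algebra_simps)

lemma form_dot_commute: "form_dot r \<alpha> \<beta> = form_dot r \<beta> \<alpha>"
  by (simp add: form_dot_def mult.commute)

lemma form_dot_lin_left: "form_dot r (lin a \<alpha> b \<beta>) \<gamma> = a * form_dot r \<alpha> \<gamma> + b * form_dot r \<beta> \<gamma>"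
  by (simp add: form_dot_def lin_def sum_distrib_left sum.distrib[symmetric] algebra_simps)

lemma form_dot_lin_right: "form_dot r \<gamma> (lin a \<alpha> b \<beta>) = a * form_dot r \<gamma> \<alpha> + b * form_dot r \<gamma> \<beta>"
  by (simp add: form_dot_def lin_def sum_distrib_left sum.distrib[symmetric] algebra_simps)

abbreviation cup4 :: "('n::finite) form \<Rightarrow> 'n form \<Rightarrow> real" where
  "cup4 \<alpha> \<beta> \<equiv> sum4 (cup 2 2 \<alpha> \<beta>)"

abbreviation cupd :: "('n::finite) form \<Rightarrow> 'n form \<Rightarrow> real" where
  "cupd \<alpha> \<beta> \<equiv> sum4 (cup1 2 3 \<alpha> (ext_d \<beta>))"

lemma cup4_lin_left: "cup4 (lin a \<alpha> b \<beta>) \<gamma> = a * cup4 \<alpha> \<gamma> + b * cup4 \<beta> \<gamma>"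
  by (simp add: sum4_def cup_def lin_def sum_distrib_left sum.distrib[symmetric] algebra_simps)

lemma cup4_lin_right: "cup4 \<gamma> (lin a \<alpha> b \<beta>) = a * cup4 \<gamma> \<alpha> + b * cup4 \<gamma> \<beta>"
  by (simp add: sum4_def cup_def lin_def sum_distrib_left sum.distrib[symmetric] algebra_simps)

lemma cupd_lin_left:
  assumes "\<alpha> \<in> forms 2" "\<beta> \<in> forms 2" "\<gamma> \<in> forms 2"
  shows "cupd (lin a \<alpha> b \<beta>) \<gamma> = a * cupd \<alpha> \<gamma> + b * cupd \<beta> \<gamma>"
proof -
  note f = ext_d_forms_3[OF assms(3)]
  have "cup1 2 3 (lin a \<alpha> b \<beta>) (ext_d \<gamma>) x [X1,X2,X3,X4] =
     a * cup1 2 3 \<alpha> (ext_d \<gamma>) x [X1,X2,X3,X4] + b * cup1 2 3 \<beta> (ext_d \<gamma>) x [X1,X2,X3,X4]" for x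
    unfolding cup1_2_3[OF lin_forms[OF assms(1,2)] f] cup1_2_3[OF assms(1) f] cup1_2_3[OF assms(2) f] lin_apply
    by (simp add: algebra_simps)
  then show ?thesis unfolding sum4_def by (simp add: sum_distrib_left sum.distrib[symmetric])
qed

lemma cupd_lin_right:
  assumes "\<alpha> \<in> forms 2" "\<beta> \<in> forms 2" "\<gamma> \<in> forms 2"
  shows "cupd \<gamma> (lin a \<alpha> b \<beta>) = a * cupd \<gamma> \<alpha> + b * cupd \<gamma> \<beta>"
proof -
  note f = ext_d_forms_3[OF assms(1)] ext_d_forms_3[OF assms(2)]
  have "cup1 2 3 \<gamma> (lin a (ext_d \<alpha>) b (ext_d \<beta>)) x [X1,X2,X3,X4] =
     a * cup1 2 3 \<gamma> (ext_d \<alpha>) x [X1,X2,X3,X4] + b * cup1 2 3 \<gamma> (ext_d \<beta>) x [X1,X2,X3,X4]" for x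
    unfolding cup1_2_3[OF assms(3) lin_forms[OF f]] cup1_2_3[OF assms(3) f(1)] cup1_2_3[OF assms(3) f(2)] lin_apply
    by (simp add: algebra_simps)
  then show ?thesis unfolding sum4_def ext_d_lin by (simp add: sum_distrib_left sum.distrib[symmetric])
qed

section \<open>Constant functions on the lattice\<close>

lemma of_int_mod_ring_Suc:
  "(of_int_mod_ring (int (Suc k)) :: 'n::finite mod_ring) = of_int_mod_ring (int k) + of_int_mod_ring 1"
  by transfer (simp add: mod_simps add.commute)

lemma site_decomp: "x = axis X1 (x $ X1) + axis X2 (x $ X2) + axis X3 (x $ X3) + axis X4 (x $ X4)"
  for x :: "'n::finite site"
proof (rule vec_eq_iff[THEN iffD2], rule allI)
  fix i show "x $ i = (axis X1 (x $ X1) + axis X2 (x $ X2) + axis X3 (x $ X3) + axis X4 (x $ X4)) $ i"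
    by (cases i) (simp_all add: axis_def)
qed

text \<open>Every element of Z/N is a natural multiple of the unit, so unit steps lead from the
  origin to every site.\<close>

lemma shift_invariant_const:
  fixes f :: "'n::finite site \<Rightarrow> 'a"
  assumes "\<And>x \<mu>. f (x + hat \<mu>) = f x"
  shows "f x = f 0"
proof -
  have nat: "f (x + axis \<mu> (of_int_mod_ring (int k))) = f x" for x \<mu> k
  proof (induction k)
    case 0
    have "(of_int_mod_ring (int 0) :: 'n mod_ring) = 0" by transfer simp
    then have "axis \<mu> (of_int_mod_ring (int 0)) = (0 :: 'n site)" by simp
    then show ?case by (simp only: add_0_right)
  next
    case (Suc k)
    have "axis \<mu> (of_int_mod_ring (int (Suc k)) :: 'n mod_ring) = axis \<mu> (of_int_mod_ring (int k)) + hat \<mu>"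
      unfolding of_int_mod_ring_Suc hat_def by (auto simp: vec_eq_iff axis_def)
    then show ?case using Suc assms by (simp add: add.assoc[symmetric])
  qed
  have ax: "f (x + axis \<mu> c) = f x" for x \<mu> c
  proof -
    have "0 \<le> to_int_mod_ring c" by transfer simp
    then have "c = of_int_mod_ring (int (nat (to_int_mod_ring c)))" by simp
    then show ?thesis using nat by metis
  qed
  have "f x = f (0 + axis X1 (x $ X1) + axis X2 (x $ X2) + axis X3 (x $ X3) + axis X4 (x $ X4))"
    using site_decomp[of x] by simp
  then show ?thesis by (simp only: ax)
qed

lemma card_site: "CARD('n::finite site) = CARD('n) ^ 4"
  by (simp add: UNIV_dir power4_eq_xxxx)

section \<open>Orthogonal decomposition\<close>

text \<open>Indexing by all ordered pairs of directions places 2-forms in a Euclidean space, where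
  orthogonal projection onto a subspace is available. Each component is then counted twice, hence
  the factor 2 in \<open>emb_inner\<close>, which does not affect orthogonality.\<close>

definition emb :: "('n::finite) form \<Rightarrow> real ^ ('n site \<times> dir \<times> dir)" where
  "emb \<alpha> = (\<chi> i. \<alpha> (fst i) [fst (snd i), snd (snd i)])"

lemma emb_inner:
  assumes "\<alpha> \<in> forms 2" "\<beta> \<in> forms 2"
  shows "emb \<alpha> \<bullet> emb \<beta> = 2 * form_dot 2 \<alpha> \<beta>"
proof -
  have "emb \<alpha> \<bullet> emb \<beta> = (\<Sum>i\<in>UNIV \<times> UNIV \<times> UNIV. \<alpha> (fst i) [fst (snd i), snd (snd i)] * \<beta> (fst i) [fst (snd i), snd (snd i)])"
    by (simp add: inner_vec_def emb_def)
  also have "\<dots> = (\<Sum>x\<in>UNIV. \<Sum>\<mu>\<in>UNIV. \<Sum>\<nu>\<in>UNIV. \<alpha> x [\<mu>,\<nu>] * \<beta> x [\<mu>,\<nu>])"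
    by (simp only: sum.cartesian_product case_prod_unfold)
  also have "\<dots> = 2 * form_dot 2 \<alpha> \<beta>"
    unfolding form_dot_2 sum_dir sum_distrib_left
    by (intro sum.cong refl) (simp add: forms_2_flip[OF assms(1)] forms_2_flip[OF assms(2)])
  finally show ?thesis .
qed

lemma emb_lin: "emb (lin a \<alpha> b \<beta>) = a *\<^sub>R emb \<alpha> + b *\<^sub>R emb \<beta>"
  by (simp add: emb_def vec_eq_iff lin_def)

lemma orthogonal_decomposition:
  assumes P: "P \<subseteq> forms 2" "P \<noteq> {}" "\<And>\<alpha> \<beta> a b. \<alpha> \<in> P \<Longrightarrow> \<beta> \<in> P \<Longrightarrow> lin a \<alpha> b \<beta> \<in> P"
    and \<alpha>: "\<alpha> \<in> forms 2"
  obtains w where "w \<in> P" "\<And>b. b \<in> P \<Longrightarrow> form_dot 2 (lin 1 \<alpha> (-1) w) b = 0"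
proof -
  have "subspace (emb ` P)"
  proof (rule subspaceI)
    obtain p where "p \<in> P" using P(2) by blast
    then have "lin 0 p 0 p \<in> P" by (rule P(3)) fact
    then show "0 \<in> emb ` P" by (force simp: emb_lin image_iff intro!: bexI[of _ "lin 0 p 0 p"])
  next
    fix x y assume "x \<in> emb ` P" "y \<in> emb ` P"
    then obtain p q where "p \<in> P" "q \<in> P" "x = emb p" "y = emb q" by auto
    then show "x + y \<in> emb ` P" using P(3)[of p q 1 1] by (auto simp: emb_lin image_iff intro!: bexI[of _ "lin 1 p 1 q"])
  next
    fix c x assume "x \<in> emb ` P"
    then obtain p where "p \<in> P" "x = emb p" by auto
    then show "c *\<^sub>R x \<in> emb ` P" using P(3)[of p p c 0] by (auto simp: emb_lin image_iff intro!: bexI[of _ "lin c p 0 p"])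
  qed
  then have span: "span (emb ` P) = emb ` P" by (simp add: span_eq_iff)
  obtain y z where yz: "y \<in> span (emb ` P)" "\<And>w. w \<in> span (emb ` P) \<Longrightarrow> orthogonal z w" "emb \<alpha> = y + z"
    using orthogonal_subspace_decomp_exists[of "emb ` P" "emb \<alpha>"] by blast
  then obtain w where w: "w \<in> P" "y = emb w" unfolding span by auto
  have "form_dot 2 (lin 1 \<alpha> (-1) w) b = 0" if "b \<in> P" for b
  proof -
    have "emb (lin 1 \<alpha> (-1) w) = z" using yz(3) w by (simp add: emb_lin)
    moreover have "orthogonal z (emb b)" using that yz(2) span by blast
    ultimately have "emb (lin 1 \<alpha> (-1) w) \<bullet> emb b = 0" by (simp add: orthogonal_def)
    then show ?thesis using emb_inner[of "lin 1 \<alpha> (-1) w" b] lin_forms[OF \<alpha>, of w] P(1) w that by auto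
  qed
  with w show thesis using that by blast
qed

lemma finite_increasing_indices: "finite (increasing_indices r)"
proof -
  have "increasing_indices r \<subseteq> {xs. set xs \<subseteq> UNIV \<and> length xs = r}" by (auto simp: increasing_indices_def)
  then show ?thesis using finite_lists_length_eq[of "UNIV :: dir set" r] finite_subset by auto
qed

lemma form_dot_nonneg: "0 \<le> form_dot r \<alpha> \<alpha>"
  unfolding form_dot_def by (intro sum_nonneg) simp

lemma form_dot_eq_0:
  assumes "form_dot r \<alpha> \<alpha> = 0" "L \<in> increasing_indices r"
  shows "\<alpha> x L = 0"
proof -
  have "(\<Sum>L\<in>increasing_indices r. \<alpha> x L * \<alpha> x L) = 0"
    using assms(1) unfolding form_dot_def
    by (subst (asm) sum_nonneg_eq_0_iff) (auto intro!: sum_nonneg)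
  then have "\<alpha> x L * \<alpha> x L = 0" using assms(2) finite_increasing_indices
    by (subst (asm) sum_nonneg_eq_0_iff) auto
  then show ?thesis by simp
qed

section \<open>Closed 2-forms and the Hodge decomposition\<close>

definition closed_form :: "('n::finite) form \<Rightarrow> bool" where
  "closed_form \<alpha> \<longleftrightarrow> (\<forall>x L. ext_d \<alpha> x L = 0)"

lemma closed_lin: "closed_form \<alpha> \<Longrightarrow> closed_form \<beta> \<Longrightarrow> closed_form (lin a \<alpha> b \<beta>)"
  unfolding closed_form_def ext_d_lin lin_apply by simp

lemma closed_ext_d:
  assumes "\<alpha> \<in> forms 1" shows "closed_form (ext_d \<alpha>)"
  unfolding closed_form_def
proof (intro allI)
  fix x L
  have "ext_d (ext_d \<alpha>) x [a,b,c] = 0" for x a b c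
    unfolding ext_d_3 ext_d_2 by (simp add: add.assoc add.commute[of "hat b" "hat a"] add.commute[of "hat c" "hat a"] add.commute[of "hat c" "hat b"])
  then have "ext_d (ext_d \<alpha>) x L = 0" if "L \<in> increasing_indices 3" for x L
    using that unfolding increasing_indices_3 by auto
  then show "ext_d (ext_d \<alpha>) x L = 0"
    using forms_3_vanish[OF ext_d_forms_3[OF ext_d_forms_2[OF assms]]] by blast
qed

lemma sum_ext_d_1: "(\<Sum>x\<in>UNIV. ext_d \<alpha> x [\<mu>,\<nu>]) = 0"
  unfolding ext_d_2 using sum_site_shift[of "\<lambda>x. \<alpha> x [\<nu>]" "hat \<mu>"] sum_site_shift[of "\<lambda>x. \<alpha> x [\<mu>]" "hat \<nu>"]
  by (simp add: sum_subtractf)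

lemma sum_codiff: "(\<Sum>x\<in>UNIV. codiff \<alpha> x L) = 0"
  unfolding codiff_eq using sum_site_shift[of "\<lambda>x. \<alpha> x (L @ [X1])" "- hat X1"] sum_site_shift[of "\<lambda>x. \<alpha> x (L @ [X2])" "- hat X2"]
    sum_site_shift[of "\<lambda>x. \<alpha> x (L @ [X3])" "- hat X3"] sum_site_shift[of "\<lambda>x. \<alpha> x (L @ [X4])" "- hat X4"]
  by (simp add: sum_subtractf sum.distrib del: add_uminus_conv_diff)

definition mean :: "('n::finite) form \<Rightarrow> 'n form" where
  "mean \<alpha> = (\<lambda>x L. (\<Sum>y\<in>UNIV. \<alpha> y L) / CARD('n site))"

lemma mean_forms_2: "\<alpha> \<in> forms 2 \<Longrightarrow> mean \<alpha> \<in> forms 2"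
proof -
  assume a: "\<alpha> \<in> forms 2"
  have "\<alpha> x [b,a] = - \<alpha> x [a,b]" for a b x using a unfolding forms_2_iff by blast
  then have s: "(\<Sum>y\<in>UNIV. \<alpha> y [b,a]) = (\<Sum>y\<in>UNIV. - \<alpha> y [a,b])" for a b by (intro sum.cong refl)
  have "mean \<alpha> x [b,a] = - mean \<alpha> x [a,b]" for a b x
    by (simp only: mean_def s[where a=a and b=b] sum_negf minus_divide_left)
  moreover have "mean \<alpha> x L = 0" if "length L \<noteq> 2" for x L
    using forms_length[OF a that] by (simp add: mean_def)
  ultimately show ?thesis unfolding forms_2_iff by blast
qed

lemma closed_mean: "closed_form (mean \<alpha>)"
  by (simp add: closed_form_def ext_d_def mean_def)

text \<open>The part of \<alpha> orthogonal to all exact forms is closed, and it is coclosed because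
  it is orthogonal to \<open>ext_d\<close> of its own codifferential. By \<open>weitzenboeck\<close>
  it is constant, and since exact forms sum to zero the constant is the mean of \<alpha>.\<close>

lemma closed_decomposition:
  fixes \<alpha> :: "('n::finite) form"
  assumes \<alpha>: "\<alpha> \<in> forms 2" "closed_form \<alpha>"
  obtains a where "a \<in> forms 1" "\<alpha> = lin 1 (mean \<alpha>) 1 (ext_d a)"
proof -
  let ?P = "ext_d ` forms 1 :: 'n form set"
  obtain w where w: "w \<in> ?P" "\<And>b. b \<in> ?P \<Longrightarrow> form_dot 2 (lin 1 \<alpha> (-1) w) b = 0"
  proof (rule orthogonal_decomposition[of ?P \<alpha>])
    show "?P \<subseteq> forms 2" using ext_d_forms_2 by blast
    show "?P \<noteq> {}" using zero_forms by blast
    show "lin a p b q \<in> ?P" if "p \<in> ?P" "q \<in> ?P" for p q a b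
      using that lin_forms by (force simp: ext_d_lin[symmetric])
  qed (use \<alpha> in auto)
  then obtain a where a: "a \<in> forms 1" "w = ext_d a" by auto
  define r where "r = lin 1 \<alpha> (-1) w"
  have r: "r \<in> forms 2" unfolding r_def using \<alpha> a ext_d_forms_2 lin_forms by blast
  have "closed_form r" unfolding r_def using \<alpha> a closed_ext_d closed_lin by blast
  then have "form_dot 3 (ext_d r) (ext_d r) = 0" by (simp add: closed_form_def form_dot_def)
  moreover have "form_dot 1 (codiff r) (codiff r) = 0"
    using w(2)[of "ext_d (codiff r)"] codiff_forms_1[OF r]
    by (simp add: form_dot_codiff_2[OF r] r_def[symmetric] del: One_nat_def)
  ultimately have 0: "(\<Sum>\<mu>\<in>UNIV. form_dot 2 (\<lambda>x L. r (x + hat \<mu>) L - r x L) (\<lambda>x L. r (x + hat \<mu>) L - r x L)) = 0"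
    using weitzenboeck[OF r r] by simp
  have "r (x + hat \<mu>) L = r x L" for x \<mu> L
  proof -
    let ?g = "\<lambda>x L. r (x + hat \<mu>) L - r x L"
    have "form_dot 2 ?g ?g = 0"
      using 0 by (subst (asm) sum_nonneg_eq_0_iff) (auto intro: form_dot_nonneg)
    moreover have "?g \<in> forms 2" using r by (auto simp: forms_def algebra_simps)
    ultimately have "?g x L = 0" using form_dot_eq_0 forms_2_vanish by blast
    then show ?thesis by simp
  qed
  then have c: "r x L = r 0 L" for x L by (rule shift_invariant_const[of "\<lambda>x. r x L"])
  have "mean \<alpha> x L = r x L" for x L
  proof -
    have "(\<Sum>y\<in>UNIV. ext_d a y L) = 0"
    proof (cases "length L = 2")
      case True
      then obtain p q where "L = [p,q]" by (auto simp: length_Suc_conv numeral_2_eq_2)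
      then show ?thesis by (simp add: sum_ext_d_1)
    next
      case False
      then show ?thesis using forms_length[OF ext_d_forms_2[OF a(1)]] by simp
    qed
    moreover have "\<alpha> y L = r x L + ext_d a y L" for y
      using c[of y L] c[of x L] by (simp add: r_def a lin_def)
    ultimately have "(\<Sum>y\<in>UNIV. \<alpha> y L) = CARD('n site) * r x L" by (simp add: sum.distrib)
    then show ?thesis by (simp add: mean_def)
  qed
  then have "\<alpha> = lin 1 (mean \<alpha>) 1 (ext_d a)" by (intro ext) (simp add: lin_def r_def a)
  with a that show thesis by blast
qed

text \<open>Two candidates for the projection differ by a coexact form orthogonal to itself, so the
  definite description denotes the one that exists. The complement is closed since its orthogonality
  to \<open>codiff (ext_d z)\<close> says that \<open>ext_d z\<close> has norm zero.\<close>

lemma codiff_proj: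
  fixes l :: "('n::finite) form"
  assumes l: "l \<in> forms 2"
  shows "codiff_proj l \<in> codiff ` forms 3" "closed_form (lin 1 l (-1) (codiff_proj l))"
proof -
  let ?P = "codiff ` forms 3 :: 'n form set"
  have P2: "?P \<subseteq> forms 2" using codiff_forms_2 by blast
  have Plin: "lin a p b q \<in> ?P" if "p \<in> ?P" "q \<in> ?P" for p q a b
    using that lin_forms by (force simp: codiff_lin[symmetric])
  obtain w where w: "w \<in> ?P" "\<And>b. b \<in> ?P \<Longrightarrow> form_dot 2 (lin 1 l (-1) w) b = 0"
  proof (rule orthogonal_decomposition[of ?P l])
    show "?P \<noteq> {}" using zero_forms by blast
  qed (use l P2 Plin in auto)
  have lin_eq: "(\<lambda>x \<mu>s. l x \<mu>s - w' x \<mu>s) = lin 1 l (-1) w'" for w' by (simp add: lin_def)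
  have "codiff_proj l = w"
    unfolding codiff_proj_def lin_eq
  proof (rule the_equality)
    show "w \<in> ?P \<and> (\<forall>b\<in>forms 3. form_dot 2 (lin 1 l (-1) w) (codiff b) = 0)" using w by blast
    fix w' assume w': "w' \<in> ?P \<and> (\<forall>b\<in>forms 3. form_dot 2 (lin 1 l (-1) w') (codiff b) = 0)"
    define e where "e = lin 1 w (-1) w'"
    have e: "e \<in> ?P" unfolding e_def using w w' Plin by blast
    then have "form_dot 2 (lin 1 l (-1) w) e = 0" "form_dot 2 (lin 1 l (-1) w') e = 0"
      using w w' by auto
    then have "form_dot 2 e e = 0"
      unfolding e_def by (simp add: form_dot_lin_left form_dot_lin_right)
    then have "e x L = 0" for x L using form_dot_eq_0 forms_2_vanish e P2 by blast
    then have 0: "w x L - w' x L = 0" for x L unfolding e_def lin_def by simp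
    have "w' x L = w x L" for x L using 0[of x L] by simp
    then show "w' = w" by (intro ext)
  qed
  then show "codiff_proj l \<in> ?P" using w by simp
  define z where "z = lin 1 l (-1) w"
  have z: "z \<in> forms 2" unfolding z_def using l w P2 lin_forms by blast
  have "form_dot 3 (ext_d z) (ext_d z) = 0"
    using form_dot_codiff_3[OF ext_d_forms_3[OF z] z] w(2)[of "codiff (ext_d z)"] ext_d_forms_3[OF z]
    by (simp add: z_def[symmetric] form_dot_commute)
  then have "closed_form z" unfolding closed_form_def
    using form_dot_eq_0 forms_3_vanish[OF ext_d_forms_3[OF z]] by blast
  then show "closed_form (lin 1 l (-1) (codiff_proj l))" by (simp add: z_def \<open>codiff_proj l = w\<close>)
qed

section \<open>The dual of a 2-form\<close>

lemma index_sign_Nil [simp]: "index_sign [] = 1"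
  by (simp add: index_sign_def)

text \<open>The inversions of \<open>a # L\<close> are those involving the head and those inside the
  tail. This recursion lets the simplifier evaluate signs of concrete and of symbolic index
  lists.\<close>

lemma index_sign_Cons:
  "index_sign (a # L) = (if a \<in> set L then 0 else (-1) ^ length (filter (\<lambda>b. b < a) L) * index_sign L)"
proof (cases "distinct (a # L)")
  case False
  then show ?thesis by (auto simp: index_sign_def)
next
  case True
  let ?I = "\<lambda>L. {(i, j). i < j \<and> j < length L \<and> L ! j < L ! i}"
  have fin: "finite (?I L)" for L :: "dir list"
    by (rule finite_subset[of _ "{..<length L} \<times> {..<length L}"]) auto
  have "?I (a # L) = (\<lambda>j. (0, Suc j)) ` {j. j < length L \<and> L ! j < a} \<union> (\<lambda>(i, j). (Suc i, Suc j)) ` ?I L"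
    (is "_ = ?A \<union> ?B")
  proof (intro equalityI subsetI)
    fix p assume "p \<in> ?I (a # L)"
    then obtain i j where p: "p = (i, j)" "i < j" "j < Suc (length L)" "(a # L) ! j < (a # L) ! i" by auto
    then obtain j' where j': "j = Suc j'" by (cases j) auto
    show "p \<in> ?A \<union> ?B"
    proof (cases i)
      case 0
      then show ?thesis using p j' by auto
    next
      case (Suc i')
      then have "p = (\<lambda>(i, j). (Suc i, Suc j)) (i', j')" "(i', j') \<in> ?I L" using p j' by auto
      then show ?thesis by blast
    qed
  qed auto
  moreover have "card ?A = length (filter (\<lambda>b. b < a) L)"
    by (subst card_image) (auto simp: inj_on_def length_filter_conv_card)
  moreover have "card ?B = card (?I L)"
    by (rule card_image) (auto simp: inj_on_def)
  moreover have "finite ?A" "finite ?B" "?A \<inter> ?B = {}" using fin by auto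
  ultimately have "card (?I (a # L)) = length (filter (\<lambda>b. b < a) L) + card (?I L)"
    by (simp add: card_Un_disjoint)
  then show ?thesis using True by (simp add: index_sign_def power_add)
qed

text \<open>The Hodge dual with the site shift of the cup product built in, so that
  \<open>cup4 a b\<close> becomes the inner product of \<open>a\<close> with \<open>star b\<close>.
  The sum over ordered pairs meets each complementary pair twice, hence the division by 2.\<close>

definition star :: "('n::finite) form \<Rightarrow> 'n form" where
  "star \<alpha> x L = (if length L = 2 then
     (\<Sum>c\<in>UNIV. \<Sum>d\<in>UNIV. index_sign (L @ [c,d]) * \<alpha> (x + (hat (hd L) + hat (L ! 1))) [c,d]) / 2 else 0)"

lemma star_eq:
  assumes "\<alpha> \<in> forms 2"
  shows "star \<alpha> x [X1,X2] = \<alpha> (x + (hat X1 + hat X2)) [X3,X4]"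
    "star \<alpha> x [X1,X3] = - \<alpha> (x + (hat X1 + hat X3)) [X2,X4]"
    "star \<alpha> x [X1,X4] = \<alpha> (x + (hat X1 + hat X4)) [X2,X3]"
    "star \<alpha> x [X2,X3] = \<alpha> (x + (hat X2 + hat X3)) [X1,X4]"
    "star \<alpha> x [X2,X4] = - \<alpha> (x + (hat X2 + hat X4)) [X1,X3]"
    "star \<alpha> x [X3,X4] = \<alpha> (x + (hat X3 + hat X4)) [X1,X2]"
  by (simp_all add: star_def sum_dir index_sign_Cons forms_2_flip[OF assms])

lemma star_forms: "star \<alpha> \<in> forms 2"
proof -
  have s: "index_sign [b,a,c,d] = - index_sign [a,b,c,d]" for a b c d
    by (cases "a < b"; cases "b < a") (auto simp: index_sign_Cons)
  have "star \<alpha> x [b,a] = - star \<alpha> x [a,b]" for x a b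
    by (simp add: star_def sum_negf add.commute[of "hat b" "hat a"] s[where a=a and b=b])
  moreover have "star \<alpha> x L = 0" if "length L \<noteq> 2" for x L using that by (simp add: star_def)
  ultimately show ?thesis unfolding forms_2_iff by blast
qed

lemma cup4_star:
  assumes "\<alpha> \<in> forms 2" "\<beta> \<in> forms 2"
  shows "cup4 \<alpha> \<beta> = form_dot 2 \<alpha> (star \<beta>)"
  unfolding sum4_cup_2_2[OF assms] form_dot_2 star_eq[OF assms(2)] by simp

lemma form_dot_star:
  assumes "\<alpha> \<in> forms 2"
  shows "form_dot 2 (star \<alpha>) (star \<alpha>) = form_dot 2 \<alpha> \<alpha>"
proof -
  have s: "(\<Sum>x\<in>UNIV. \<alpha> (x + s) L * \<alpha> (x + s) L) = (\<Sum>x\<in>UNIV. \<alpha> x L * \<alpha> x L)" for s L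
    using sum_site_shift[of "\<lambda>x. \<alpha> x L * \<alpha> x L" s] by simp
  show ?thesis unfolding form_dot_2 star_eq[OF assms] by (simp add: sum.distrib s)
qed

text \<open>By adjointness the norm of \<open>ext_d (star (codiff b))\<close> is, up to sign, a cup
  product of two coexact forms and hence zero. Being closed, the dual is exact up to a constant, and
  the constant vanishes because codifferentials sum to zero.\<close>

lemma star_codiff_exact:
  assumes b: "b \<in> forms 3"
  obtains a where "a \<in> forms 1" "star (codiff b) = ext_d a"
proof -
  let ?s = "star (codiff b)"
  note w = codiff_forms_2[OF b]
  note d = ext_d_forms_3[OF star_forms[of "codiff b"]]
  have "form_dot 3 (ext_d ?s) (ext_d ?s) = 0"
    using form_dot_codiff_3[OF d star_forms[of "codiff b"]] cup4_star[OF codiff_forms_2[OF d] w] cup_codiff_codiff[OF d b]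
    by simp
  then have "closed_form ?s" unfolding closed_form_def
    using form_dot_eq_0 forms_3_vanish[OF d] by blast
  then obtain a where a: "a \<in> forms 1" "?s = lin 1 (mean ?s) 1 (ext_d a)"
    using closed_decomposition[OF star_forms] by blast
  have sh: "(\<Sum>x\<in>UNIV. codiff b (x + s) L) = 0" for s L
    using sum_site_shift[of "\<lambda>x. codiff b x L" s] sum_codiff[of b L] by simp
  have "(\<Sum>x\<in>UNIV. ?s x L) = 0" if "L \<in> increasing_indices 2" for L
    using that unfolding increasing_indices_2 by (auto simp: star_eq[OF w] sh sum_negf)
  then have "mean ?s x L = 0" if "L \<in> increasing_indices 2" for x L
    using that by (simp add: mean_def)
  then have "mean ?s x L = 0" for x L using forms_2_vanish[OF mean_forms_2[OF star_forms]] by blast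
  then have "lin 1 (mean ?s) 1 (ext_d a) = ext_d a" by (intro ext) (simp add: lin_def)
  then show thesis using a that by metis
qed

section \<open>Fluxes\<close>

lemma axis_shift: "axis \<mu> c + hat \<mu> = axis \<mu> (c + of_int_mod_ring 1)"
  by (auto simp: vec_eq_iff axis_def hat_def)

text \<open>The total over the coordinate plane through the origin in the two given directions. For
  a closed 2-form every parallel plane carries the same total.\<close>

definition flux :: "('n::finite) form \<Rightarrow> dir \<Rightarrow> dir \<Rightarrow> real" where
  "flux \<alpha> \<mu> \<nu> = (\<Sum>s\<in>UNIV. \<Sum>t\<in>UNIV. \<alpha> (axis \<mu> s + axis \<nu> t) [\<mu>,\<nu>])"

text \<open>Summing the plane total \<open>g y\<close> over all base points \<open>y\<close> counts
  each site N^2 times; on the other hand all N^4 base points give the same total, the flux.\<close>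

lemma sum_flux:
  fixes \<alpha> :: "('n::finite) form"
  assumes "closed_form \<alpha>" and mn: "\<mu> \<noteq> \<nu>" and \<alpha>: "\<alpha> \<in> forms 2"
  shows "(\<Sum>x\<in>UNIV. \<alpha> x [\<mu>,\<nu>]) = CARD('n)\<^sup>2 * flux \<alpha> \<mu> \<nu>"
proof -
  define g where "g = (\<lambda>y. \<Sum>s\<in>UNIV. \<Sum>t\<in>UNIV. \<alpha> (y + (axis \<mu> s + axis \<nu> t)) [\<mu>,\<nu>])"
  have sh1: "(\<Sum>s\<in>UNIV. \<Sum>t\<in>UNIV. f (y + (axis \<mu> s + axis \<nu> t) + hat \<mu>)) = (\<Sum>s\<in>UNIV. \<Sum>t\<in>UNIV. f (y + (axis \<mu> s + axis \<nu> t)))"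
    for f :: "'n site \<Rightarrow> real" and y
  proof -
    have e: "y + (axis \<mu> s + axis \<nu> t) + hat \<mu> = y + (axis \<mu> (s + of_int_mod_ring 1) + axis \<nu> t)" for s t
      by (simp add: axis_shift[symmetric] add_ac)
    show ?thesis unfolding e
      by (rule sum.reindex_bij_witness[of _ "\<lambda>s. s - of_int_mod_ring 1" "\<lambda>s. s + of_int_mod_ring 1"]) auto
  qed
  have sh2: "(\<Sum>s\<in>UNIV. \<Sum>t\<in>UNIV. f (y + (axis \<mu> s + axis \<nu> t) + hat \<nu>)) = (\<Sum>s\<in>UNIV. \<Sum>t\<in>UNIV. f (y + (axis \<mu> s + axis \<nu> t)))"
    for f :: "'n site \<Rightarrow> real" and y
  proof (rule sum.cong[OF refl])
    fix s
    have e: "y + (axis \<mu> s + axis \<nu> t) + hat \<nu> = y + (axis \<mu> s + axis \<nu> (t + of_int_mod_ring 1))" for t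
      by (simp add: axis_shift[symmetric] add_ac)
    show "(\<Sum>t\<in>UNIV. f (y + (axis \<mu> s + axis \<nu> t) + hat \<nu>)) = (\<Sum>t\<in>UNIV. f (y + (axis \<mu> s + axis \<nu> t)))" unfolding e
      by (rule sum.reindex_bij_witness[of _ "\<lambda>s. s - of_int_mod_ring 1" "\<lambda>s. s + of_int_mod_ring 1"]) auto
  qed
  have "g (y + hat \<rho>) = g y" for y \<rho>
  proof -
    \<comment> \<open>Closedness trades a step in direction \<rho> for differences along the two
      directions of the plane, which cancel by periodicity when summed over the plane.\<close>
    have e: "\<alpha> (x + hat \<rho>) [\<mu>,\<nu>] = \<alpha> x [\<mu>,\<nu>] + (\<alpha> (x + hat \<mu>) [\<rho>,\<nu>] - \<alpha> x [\<rho>,\<nu>]) - (\<alpha> (x + hat \<nu>) [\<rho>,\<mu>] - \<alpha> x [\<rho>,\<mu>])" for x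
      using assms(1) ext_d_3[of \<alpha> x \<rho> \<mu> \<nu>] unfolding closed_form_def by simp
    have c: "y + hat \<rho> + z = y + z + hat \<rho>" for z by (simp add: add_ac)
    have "g (y + hat \<rho>) = g y 
       + ((\<Sum>s\<in>UNIV. \<Sum>t\<in>UNIV. \<alpha> (y + (axis \<mu> s + axis \<nu> t) + hat \<mu>) [\<rho>,\<nu>]) - (\<Sum>s\<in>UNIV. \<Sum>t\<in>UNIV. \<alpha> (y + (axis \<mu> s + axis \<nu> t)) [\<rho>,\<nu>]))
       - ((\<Sum>s\<in>UNIV. \<Sum>t\<in>UNIV. \<alpha> (y + (axis \<mu> s + axis \<nu> t) + hat \<nu>) [\<rho>,\<mu>]) - (\<Sum>s\<in>UNIV. \<Sum>t\<in>UNIV. \<alpha> (y + (axis \<mu> s + axis \<nu> t)) [\<rho>,\<mu>]))"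
      unfolding g_def c e sum.distrib sum_subtractf ..
    then show ?thesis
      using sh1[of "\<lambda>x. \<alpha> x [\<rho>,\<nu>]" y] sh2[of "\<lambda>x. \<alpha> x [\<rho>,\<mu>]" y] by simp
  qed
  then have "g y = g 0" for y by (rule shift_invariant_const)
  then have "(\<Sum>y\<in>UNIV. g y) = (\<Sum>y\<in>(UNIV :: 'n site set). g 0)" by (rule sum.cong[OF refl])
  also have "\<dots> = real (CARD('n site)) * g 0" by (rule sum_constant)
  finally have "(\<Sum>y\<in>UNIV. g y) = CARD('n)^4 * flux \<alpha> \<mu> \<nu>"
    unfolding card_site by (simp add: g_def flux_def)
  moreover have "(\<Sum>y\<in>UNIV. g y) = CARD('n)\<^sup>2 * (\<Sum>x\<in>UNIV. \<alpha> x [\<mu>,\<nu>])"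
  proof -
    have "(\<Sum>y\<in>UNIV. g y) = (\<Sum>s\<in>(UNIV::'n mod_ring set). \<Sum>t\<in>(UNIV::'n mod_ring set). \<Sum>y\<in>UNIV. \<alpha> (y + (axis \<mu> s + axis \<nu> t)) [\<mu>,\<nu>])"
      unfolding g_def by (subst sum.swap, intro sum.cong refl, rule sum.swap)
    also have "\<dots> = (\<Sum>s\<in>(UNIV::'n mod_ring set). \<Sum>t\<in>(UNIV::'n mod_ring set). \<Sum>x\<in>UNIV. \<alpha> x [\<mu>,\<nu>])"
      by (intro sum.cong refl sum_site_shift[of "\<lambda>x. \<alpha> x [\<mu>,\<nu>]"])
    finally show ?thesis by (simp add: power2_eq_square)
  qed
  ultimately have "real (CARD('n)\<^sup>2) * (\<Sum>x\<in>UNIV. \<alpha> x [\<mu>,\<nu>]) = CARD('n)\<^sup>2 * (CARD('n)\<^sup>2 * flux \<alpha> \<mu> \<nu>)"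
    by (simp add: power2_eq_square power4_eq_xxxx mult.assoc)
  then show ?thesis by (subst (asm) mult_left_cancel) simp_all
qed

lemma flux_int: "\<alpha> \<in> int_forms 2 \<Longrightarrow> flux \<alpha> \<mu> \<nu> \<in> \<int>"
  unfolding flux_def int_forms_def by (intro Ints_sum) simp

text \<open>A plaquette carries its value \<open>k\<close> exactly when both coordinates in its own
  plane are zero. The form is constant in the transverse directions, hence closed, and the plane
  through the origin contains a single charged plaquette.\<close>

definition flux_form :: "(dir \<Rightarrow> dir \<Rightarrow> real) \<Rightarrow> ('n::finite) form" where
  "flux_form k x L = (if length L = 2 \<and> x $ hd L = 0 \<and> x $ (L ! 1) = 0 then k (hd L) (L ! 1) else 0)"

lemma flux_form:
  assumes k: "\<And>a b. k b a = - k a b" and "\<And>a b. k a b \<in> \<int>"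
  shows "(flux_form k :: ('n::finite) form) \<in> int_forms 2" "closed_form (flux_form k :: 'n form)"
    "\<mu> \<noteq> \<nu> \<Longrightarrow> flux (flux_form k :: 'n form) \<mu> \<nu> = k \<mu> \<nu>"
proof -
  let ?f = "flux_form k :: 'n form"
  have anti: "?f x [b,a] = - ?f x [a,b]" for x a b
    using k[of a b] by (auto simp: flux_form_def)
  moreover have "?f x L = 0" if "length L \<noteq> 2" for x L using that by (simp add: flux_form_def)
  ultimately have f2: "?f \<in> forms 2" unfolding forms_2_iff by blast
  then show int: "?f \<in> int_forms 2" using assms(2) by (auto simp: int_forms_def flux_form_def)
  have k0: "k a a = 0" for a using k[of a a] by simp
  have "?f (x + hat a) [b,c] = ?f x [b,c]" if "a \<noteq> b" "a \<noteq> c" for x a b c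
    using that by (simp add: flux_form_def hat_def axis_def)
  then have "ext_d ?f x L = 0" if "L \<in> increasing_indices 3" for x L
    using that unfolding increasing_indices_3 by (auto simp: ext_d_3)
  then show "closed_form ?f" unfolding closed_form_def
    using forms_3_vanish[OF ext_d_forms_3[OF f2]] by blast
  assume "\<mu> \<noteq> \<nu>"
  then have "flux ?f \<mu> \<nu> = (\<Sum>s\<in>(UNIV::'n mod_ring set). \<Sum>t\<in>(UNIV::'n mod_ring set). if t = 0 then if s = 0 then k \<mu> \<nu> else 0 else 0)"
    unfolding flux_def by (intro sum.cong refl) (auto simp: flux_form_def axis_def)
  also have "\<dots> = k \<mu> \<nu>" by (simp add: sum.delta)
  finally show "flux ?f \<mu> \<nu> = k \<mu> \<nu>" .
qed

section \<open>Exchanging sums and integrals\<close>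

text \<open>Summability of complex families is absolute summability; for a non-summable family both
  sides take the default value 0.\<close>

lemma infsum_eq_integral:
  fixes g :: "'i \<Rightarrow> complex"
  shows "(\<Sum>\<^sub>\<infinity>n\<in>I. g n) = (\<integral>n. g n \<partial>count_space I)"
proof (cases "g summable_on I")
  case True
  then have "Infinite_Sum.abs_summable_on g I" by (simp add: summable_on_iff_abs_summable_on_complex)
  then have "Infinite_Set_Sum.abs_summable_on g I" by (simp add: abs_summable_equivalent)
  then show ?thesis by (simp add: infsetsum_infsum[symmetric] infsetsum_def)
next
  case False
  then have "\<not> Infinite_Set_Sum.abs_summable_on g I"
    by (simp add: summable_on_iff_abs_summable_on_complex abs_summable_equivalent[symmetric])
  then show ?thesis using False
    by (simp add: infsum_not_exists not_integrable_integral_eq Infinite_Set_Sum.abs_summable_on_def)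
qed

lemma summable_on_count_space:
  fixes g :: "'i \<Rightarrow> real"
  assumes "g summable_on I" "\<And>i. i \<in> I \<Longrightarrow> 0 \<le> g i"
  shows "integrable (count_space I) g"
proof -
  have "Infinite_Sum.abs_summable_on g I"
    using assms by (simp cong: summable_on_cong)
  then show ?thesis unfolding abs_summable_equivalent Infinite_Set_Sum.abs_summable_on_def .
qed

text \<open>Fubini on the product of a counting measure with \<open>M\<close>; since
  \<open>I\<close> is countable, joint measurability follows from that of each
  \<open>f n\<close>.\<close>

lemma integral_infsum:
  fixes f :: "'i \<Rightarrow> 'a \<Rightarrow> complex"
  assumes M: "sigma_finite_measure M" and I: "countable I"
    and f: "\<And>n. n \<in> I \<Longrightarrow> integrable M (f n)"
    and s: "(\<lambda>n. \<integral>x. norm (f n x) \<partial>M) summable_on I"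
  shows "integrable (count_space I \<Otimes>\<^sub>M M) (\<lambda>(n, x). f n x)"
    and "integrable M (\<lambda>x. \<Sum>\<^sub>\<infinity>n\<in>I. f n x)"
    and "(\<integral>x. (\<Sum>\<^sub>\<infinity>n\<in>I. f n x) \<partial>M) = (\<Sum>\<^sub>\<infinity>n\<in>I. \<integral>x. f n x \<partial>M)"
    and "(\<lambda>n. \<integral>x. f n x \<partial>M) summable_on I"
proof -
  interpret M: sigma_finite_measure M by fact
  interpret N: sigma_finite_measure "count_space I" using I by (rule sigma_finite_measure_count_space_countable)
  interpret P: pair_sigma_finite "count_space I" M ..
  have meas: "(\<lambda>(n, x). f n x) \<in> borel_measurable (count_space I \<Otimes>\<^sub>M M)"
    using I f by (intro measurable_pair_measure_countable1) auto
  show int: "integrable (count_space I \<Otimes>\<^sub>M M) (\<lambda>(n, x). f n x)"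
  proof (rule P.Fubini_integrable[OF meas])
    show "integrable (count_space I) (\<lambda>n. \<integral>x. norm (case (n, x) of (n, x) \<Rightarrow> f n x) \<partial>M)"
      using summable_on_count_space[OF s] by simp
    show "AE n in count_space I. integrable M (\<lambda>x. case (n, x) of (n, x) \<Rightarrow> f n x)"
      using f by (simp add: AE_count_space)
  qed
  show "integrable M (\<lambda>x. \<Sum>\<^sub>\<infinity>n\<in>I. f n x)"
    unfolding infsum_eq_integral using P.integrable_snd[OF int] by simp
  show "(\<integral>x. (\<Sum>\<^sub>\<infinity>n\<in>I. f n x) \<partial>M) = (\<Sum>\<^sub>\<infinity>n\<in>I. \<integral>x. f n x \<partial>M)"
    unfolding infsum_eq_integral using P.Fubini_integral[OF int] by simp
  have "(\<lambda>n. norm (\<integral>x. f n x \<partial>M)) summable_on I"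
    by (rule summable_on_comparison_test[OF s]) (auto intro: integral_norm_bound)
  then show "(\<lambda>n. \<integral>x. f n x \<partial>M) summable_on I" by (rule abs_summable_summable)
qed

section \<open>Analytic continuation of Gaussian moment generating functions\<close>

text \<open>The transform \<open>F\<close> is entire, and on the real axis it agrees with the entire
  function C exp(c z^2). The identity theorem carries the formula to z = i t.\<close>

lemma mgf_gaussian_imaginary:
  fixes s p :: "'a \<Rightarrow> real"
  assumes M: "sigma_finite_measure M"
    and p: "\<And>x. 0 \<le> p x" and [measurable]: "s \<in> borel_measurable M" "p \<in> borel_measurable M"
    and int: "\<And>t. integrable M (\<lambda>x. p x * exp (t * s x))"
    and eq: "\<And>t. (\<integral>x. p x * exp (t * s x) \<partial>M) = C * exp (c * t\<^sup>2)"
  shows "(\<integral>x. of_real (p x) * exp (\<i> * of_real (t * s x)) \<partial>M) = complex_of_real (C * exp (- c * t\<^sup>2))"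
proof -
  define F where "F = (\<lambda>z::complex. \<integral>x. of_real (p x) * exp (z * of_real (s x)) \<partial>M)"
  define a where "a = (\<lambda>k. (\<integral>x. p x * (s x ^ k / fact k) \<partial>M))"
  define g where "g = (\<lambda>z k x. of_real (p x) * ((z * of_real (s x)) ^ k / fact k) :: complex)"
  \<comment> \<open>Integrability for both signs of the exponent dominates exp(r |s|), hence every
    term of the exponential series.\<close>
  have expb: "exp (r * \<bar>y\<bar>) \<le> exp (r * y) + exp (- r * y)" for r y :: real
    by (cases "0 \<le> y") (auto simp: add_increasing add_increasing2)
  have inte: "integrable M (\<lambda>x. p x * exp (r * \<bar>s x\<bar>))" for r
    using Bochner_Integration.integrable_add[OF int[of r] int[of "- r"]]
    by (rule Bochner_Integration.integrable_bound)
       (use p expb[of r] in \<open>auto simp: ring_distribs[symmetric] abs_mult intro!: AE_I2 mult_left_mono\<close>)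
  \<comment> \<open>A single term of a series with nonnegative terms is at most the whole
    series.\<close>
  have bound: "norm (g z k x) \<le> p x * exp (norm z * \<bar>s x\<bar>)" for z k x
  proof -
    have "(norm z * \<bar>s x\<bar>) ^ k / fact k \<le> exp (norm z * \<bar>s x\<bar>)"
      using exp_lower_Taylor_quadratic exp_ge_add_one_self
      sum_le_suminf[OF summable_exp_generic[of "norm z * \<bar>s x\<bar>"], of "{k}"]
      by (simp add: exp_def field_simps)
    from mult_left_mono[OF this p[of x]] show ?thesis using p[of x]
      by (simp add: g_def norm_mult norm_power norm_divide power_mult_distrib)
  qed
  have gi: "integrable M (g z k)" for z k
    by (rule Bochner_Integration.integrable_bound[OF inte[of "norm z"]])
       (use bound p in \<open>auto simp: g_def intro!: AE_I2 order_trans[OF bound[unfolded g_def]]\<close>)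
  have sums: "(\<lambda>k. \<integral>x. g z k x \<partial>M) sums F z" for z
  proof -
    have "(\<lambda>k. \<integral>x. g z k x \<partial>M) sums (\<integral>x. (\<Sum>k. g z k x) \<partial>M)"
    proof (rule sums_integral)
      have sm: "(\<lambda>k. norm (g z k x)) sums (p x * exp (norm z * \<bar>s x\<bar>))" for x
        using sums_mult[OF exp_converges[of "norm z * \<bar>s x\<bar>"], of "p x"] p[of x]
        by (simp add: g_def norm_mult norm_power norm_divide power_mult_distrib field_simps)
      then show "AE x in M. summable (\<lambda>k. norm (g z k x))" by (auto simp: sums_iff)
      have "(\<Sum>k<n. \<integral>x. norm (g z k x) \<partial>M) \<le> (\<integral>x. p x * exp (norm z * \<bar>s x\<bar>) \<partial>M)" for n
      proof -
        have "(\<Sum>k<n. \<integral>x. norm (g z k x) \<partial>M) = (\<integral>x. (\<Sum>k<n. norm (g z k x)) \<partial>M)"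
          using gi by (subst Bochner_Integration.integral_sum) auto
        also have "\<dots> \<le> (\<integral>x. p x * exp (norm z * \<bar>s x\<bar>) \<partial>M)"
        proof (rule integral_mono)
          show "integrable M (\<lambda>x. \<Sum>k<n. norm (g z k x))" using gi by auto
          show "(\<Sum>k<n. norm (g z k x)) \<le> p x * exp (norm z * \<bar>s x\<bar>)" for x
            using sm[of x] sum_le_suminf[of "\<lambda>k. norm (g z k x)" "{..<n}"] by (auto simp: sums_iff)
        qed (rule inte)
        finally show ?thesis .
      qed
      then show "summable (\<lambda>k. \<integral>x. norm (g z k x) \<partial>M)"
        by (intro summableI_nonneg_bounded) auto
    qed (rule gi)
    also have "(\<integral>x. (\<Sum>k. g z k x) \<partial>M) = F z"
    proof -
      have "(\<lambda>k. g z k x) sums (of_real (p x) * exp (z * of_real (s x)))" for x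
        using sums_mult[OF exp_converges[of "z * of_real (s x)"], of "of_real (p x)"]
        by (simp add: g_def scaleR_conv_of_real field_simps)
      then show ?thesis by (simp add: F_def sums_iff)
    qed
    finally show ?thesis .
  qed
  have gint: "(\<integral>x. g z k x \<partial>M) = of_real (a k) * (z - 0) ^ k" for z k
  proof -
    have "g z k = (\<lambda>x. of_real (p x * (s x ^ k / fact k)) * z ^ k)"
      by (auto simp: g_def power_mult_distrib)
    then have "(\<integral>x. g z k x \<partial>M) = (\<integral>x. complex_of_real (p x * (s x ^ k / fact k)) \<partial>M) * z ^ k"
      by (simp only: integral_mult_left_zero)
    then show ?thesis unfolding integral_complex_of_real by (simp add: a_def)
  qed
  have "F holomorphic_on ball 0 r" for r
    by (rule power_series_holomorphic[where a = "\<lambda>k. of_real (a k)"]) (use sums gint in simp)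
  then have "F holomorphic_on (\<Union>r\<in>UNIV. ball 0 r)"
    by (intro holomorphic_on_UN_open) auto
  moreover have "(\<Union>r\<in>UNIV. ball (0::complex) r) = UNIV" by (auto intro: gt_ex)
  ultimately have hol: "F holomorphic_on UNIV" by simp
  define G where "G = (\<lambda>z. F z - of_real C * exp (of_real c * z\<^sup>2))"
  have "G z = 0" for z
  proof (rule analytic_continuation[of G UNIV "\<real>" 0])
    show "G holomorphic_on UNIV" unfolding G_def using hol by (intro holomorphic_intros) auto
    have "0 islimpt (\<real> :: complex set)"
    proof (rule islimptI)
      fix T :: "complex set" assume "0 \<in> T" "open T"
      then obtain e where e: "e > 0" "ball 0 e \<subseteq> T" using open_contains_ball by blast
      then have "of_real (e/2) \<in> T" by (intro subsetD[OF e(2)]) auto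
      then show "\<exists>y\<in>\<real>. y \<in> T \<and> y \<noteq> 0" using e(1) by (intro bexI[of _ "of_real (e/2)"]) auto
    qed
    then show "0 islimpt (\<real> :: complex set)" .
    fix z :: complex assume "z \<in> \<real>"
    then obtain t where t: "z = of_real t" by (auto elim: Reals_cases)
    have "F z = (\<integral>x. complex_of_real (p x * exp (t * s x)) \<partial>M)"
      unfolding F_def t by (intro Bochner_Integration.integral_cong refl) (simp add: exp_of_real[symmetric])
    also have "\<dots> = of_real (C * exp (c * t\<^sup>2))" unfolding integral_complex_of_real eq ..
    finally show "G z = 0" by (simp add: G_def t exp_of_real[symmetric])
  qed auto
  from this[of "\<i> * of_real t"] show ?thesis
    by (simp add: G_def F_def exp_of_real[symmetric] power_mult_distrib mult_ac)
qed

section \<open>Uniqueness of Fourier coefficients\<close>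

text \<open>If \<open>h y0\<close> were nonzero, one could integrate \<open>h\<close> against powers
  of a trigonometric polynomial peaked at \<open>y0\<close>. All these integrals vanish by
  hypothesis, yet near \<open>y0\<close> the powers are exponentially larger than away from
  it.\<close>

lemma fourier_uniqueness:
  fixes h :: "real \<Rightarrow> complex"
  assumes cont: "continuous_on UNIV h" and per: "\<And>y. h (y + 1) = h y"
    and coef: "\<And>m::int. integral {0..1} (\<lambda>y. h y * exp (2 * pi * \<i> * of_int m * of_real y)) = 0"
  shows "h y = 0"
proof -
  have inner: "h y0 = 0" if y0: "0 < y0" "y0 < 1" for y0
  proof (rule ccontr)
    assume nz: "h y0 \<noteq> 0"
    \<comment> \<open>A raised cosine: nonnegative, largest at \<open>y0\<close>, and a combination
      of the characters of frequency -1, 0 and 1.\<close>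
    define K where "K = (\<lambda>y. (1 + cos (2 * pi * (y - y0))) / 2)"
    define r where "r = (\<lambda>y. Re (h y * cnj (h y0)))"
    have hc: "continuous_on S h" for S using cont continuous_on_subset by blast
    have Kc: "continuous_on S K" for S unfolding K_def by (intro continuous_intros) auto
    have rc: "continuous_on S r" for S unfolding r_def by (intro continuous_intros hc)
    define w where "w = exp (- 2 * pi * \<i> * of_real y0)"
    have Kexp: "of_real (K y) = 1/2 + w / 4 * exp (2 * pi * \<i> * of_int 1 * of_real y) + inverse w / 4 * exp (2 * pi * \<i> * of_int (-1) * of_real y)" for y
    proof -
      define \<theta> where "\<theta> = 2 * pi * (y - y0)"
      have 1: "exp (\<i> * of_real \<theta>) = w * exp (2 * pi * \<i> * of_int 1 * of_real y)"
        unfolding w_def \<theta>_def exp_add[symmetric] by (simp add: algebra_simps)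
      have 2: "exp (- (\<i> * of_real \<theta>)) = inverse w * exp (2 * pi * \<i> * of_int (-1) * of_real y)"
        unfolding w_def \<theta>_def exp_minus[symmetric] exp_add[symmetric] by (simp add: algebra_simps)
      have "complex_of_real (cos \<theta>) = (exp (\<i> * of_real \<theta>) + exp (- (\<i> * of_real \<theta>))) / 2"
        unfolding cos_of_real[symmetric] cos_exp_eq ..
      then have "of_real (K y) = 1/2 + exp (\<i> * of_real \<theta>) / 4 + exp (- (\<i> * of_real \<theta>)) / 4"
        by (simp add: K_def \<theta>_def[symmetric] add_divide_distrib)
      then show ?thesis unfolding 1 2 by simp
    qed
    \<comment> \<open>A factor \<open>K\<close> shifts frequencies by at most one, so the induction
      must treat all \<open>m\<close> simultaneously.\<close>
    have zero: "integral {0..1} (\<lambda>y. h y * of_real (K y) ^ n * exp (2 * pi * \<i> * of_int m * of_real y)) = 0" for n and m :: int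
    proof (induction n arbitrary: m)
      case 0
      then show ?case using coef by simp
    next
      case (Suc n)
      define E where "E = (\<lambda>m::int. \<lambda>y::real. exp (2 * pi * \<i> * of_int m * of_real y))"
      have Emul: "E a y * E b y = E (a + b) y" for a b y
        unfolding E_def exp_add[symmetric] by (simp add: algebra_simps)
      define H where "H = (\<lambda>m y. h y * of_real (K y) ^ n * E m y)"
      have Hi: "H m integrable_on {0..1}" for m
        unfolding H_def E_def by (intro integrable_continuous_real continuous_intros hc Kc)
      have KE: "of_real (K y) = 1/2 + w/4 * E 1 y + inverse w/4 * E (-1) y" for y
        using Kexp by (simp only: E_def)
      have "h y * of_real (K y) ^ Suc n * E m y = 1/2 * H m y + w/4 * H (1 + m) y + inverse w / 4 * H (-1 + m) y" for y
      proof -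
        have "h y * of_real (K y) ^ Suc n * E m y = of_real (K y) * (h y * of_real (K y) ^ n * E m y)"
          by (simp add: mult_ac)
        also have "\<dots> = (1/2 + w/4 * E 1 y + inverse w/4 * E (-1) y) * (h y * of_real (K y) ^ n * E m y)"
          unfolding KE[of y, symmetric] ..
        also have "\<dots> = 1/2 * H m y + w/4 * H (1 + m) y + inverse w / 4 * H (-1 + m) y"
          unfolding H_def Emul[symmetric] by (simp add: algebra_simps)
        finally show ?thesis .
      qed
      then have "integral {0..1} (\<lambda>y. h y * of_real (K y) ^ Suc n * E m y) = 
          integral {0..1} (\<lambda>y. 1/2 * H m y + w/4 * H (1 + m) y + inverse w / 4 * H (-1 + m) y)" by simp
      also have "\<dots> = 1/2 * integral {0..1} (H m) + w/4 * integral {0..1} (H (1 + m)) + inverse w / 4 * integral {0..1} (H (-1 + m))"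
        using Hi by (simp add: integral_add integrable_add integrable_on_mult_right)
      also have "\<dots> = 0"
      proof -
        have "integral {0..1} (H k) = 0" for k using Suc.IH[of k] by (simp only: H_def E_def)
        then show ?thesis by simp
      qed
      finally show ?case by (simp add: E_def)
    qed
    have rint: "integral {0..1} (\<lambda>y. r y * K y ^ n) = 0" for n
    proof -
      have i: "(\<lambda>y. h y * of_real (K y) ^ n) integrable_on {0..1}"
        by (intro integrable_continuous_real continuous_intros hc Kc)
      have "integral {0..1} (\<lambda>y. h y * of_real (K y) ^ n) = 0" using zero[of n 0] by simp
      then have "Re (integral {0..1} (\<lambda>y. h y * of_real (K y) ^ n) * cnj (h y0)) = 0" by simp
      moreover have "((\<lambda>y. Re (h y * of_real (K y) ^ n * cnj (h y0))) has_integral 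
          Re (integral {0..1} (\<lambda>y. h y * of_real (K y) ^ n) * cnj (h y0))) {0..1}"
        using has_integral_linear[OF has_integral_mult_left[OF integrable_integral[OF i], of "cnj (h y0)"] bounded_linear_Re]
        by (simp add: o_def)
      moreover have "Re (h y * of_real (K y) ^ n * cnj (h y0)) = r y * K y ^ n" for y
        unfolding r_def of_real_power[symmetric] by (simp add: algebra_simps)
      ultimately show ?thesis by (simp add: integral_unique)
    qed
    define c where "c = (norm (h y0))\<^sup>2"
    have "c > 0" using nz by (simp add: c_def)
    moreover have "r y0 = c" unfolding c_def r_def cmod_power2 by (simp add: power2_eq_square)
    ultimately have c: "c > 0" "r y0 = c" .
    obtain d0 where d0: "d0 > 0" "\<And>y. dist y y0 < d0 \<Longrightarrow> dist (r y) (r y0) < c / 2"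
      using rc[of UNIV] c(1) unfolding continuous_on_iff by (metis UNIV_I half_gt_zero)
    \<comment> \<open>Small enough for the interval of radius \<open>d\<close> around
      \<open>y0\<close> to stay inside (0,1) and for \<open>r\<close> to exceed c/2 on it; the bound
      1/4 keeps cos(2 pi d), and with it \<open>q\<close>, nonnegative.\<close>
    define d where "d = Min {d0 / 2, y0 / 2, (1 - y0) / 2, 1/4}"
    have d: "d > 0" "d < d0" "d < y0" "d < 1 - y0" "d \<le> 1/4" using y0 d0(1) by (auto simp: d_def min_def field_simps)
    \<comment> \<open>\<open>q\<close> bounds \<open>K\<close> from above outside distance
      \<open>d\<close> of \<open>y0\<close>, and \<open>q2\<close> bounds it from below within
      distance d/2. The contradiction comes from \<open>q < q2\<close>.\<close>
    define q where "q = (1 + cos (2 * pi * d)) / 2"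
    define q2 where "q2 = (1 + cos (pi * d)) / 2"
    have "cos (2 * pi * d) < cos (pi * d)" using d by (intro cos_monotone_0_pi) (auto simp: field_simps)
    then have q: "q < q2" by (simp add: q_def q2_def)
    have "2 * pi * d \<le> pi / 2" using mult_left_mono[of "4 * d" 1 "pi / 2"] d by simp
    moreover have "0 \<le> 2 * pi * d" using d by simp
    then have "- (pi / 2) \<le> 2 * pi * d" using pi_gt_zero by linarith
    ultimately have "0 \<le> cos (2 * pi * d)" by (intro cos_ge_zero) auto
    then have q0: "q > 0" by (simp add: q_def)
    have "0 \<le> (1 + cos x) / 2" for x :: real using cos_double_cos[of "x / 2"] by simp
    then have K0: "K y \<ge> 0" for y unfolding K_def .
    have cos_mono: "cos (2 * pi * b) \<le> cos (2 * pi * a)" if "0 \<le> a" "a \<le> b" "b \<le> 1/2" for a b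
      using that mult_left_mono[of a b "2 * pi"] mult_left_mono[of b "1/2" "2 * pi"]
      by (intro cos_monotone_0_pi_le) auto
    have cos_abs: "cos (2 * pi * (y - y0)) = cos (2 * pi * \<bar>y - y0\<bar>)" for y
    proof (cases "y \<ge> y0")
      case False
      then have "2 * pi * \<bar>y - y0\<bar> = - (2 * pi * (y - y0))" by (simp add: abs_if right_diff_distrib)
      then show ?thesis by (simp only: cos_minus)
    qed simp
    have far: "K y \<le> q" if "y \<in> {0..1}" "\<bar>y - y0\<bar> \<ge> d" for y
    proof -
      define t where "t = \<bar>y - y0\<bar>"
      have t: "d \<le> t" "t \<le> 1 - d" using that d y0 by (auto simp: t_def)
      have "cos (2 * pi * (y - y0)) = cos (2 * pi * t)" unfolding t_def by (rule cos_abs)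
      moreover have "cos (2 * pi * t) \<le> cos (2 * pi * d)"
      proof (cases "t \<le> 1/2")
        case True
        then show ?thesis using t d True by (intro cos_mono) auto
      next
        case False
        have "cos (2 * pi * t) = cos (2 * pi * (1 - t))"
          using cos_2pi_minus[of "2 * pi * t"] by (simp add: algebra_simps)
        also have "\<dots> \<le> cos (2 * pi * d)"
          using t d False by (intro cos_mono) auto
        finally show ?thesis .
      qed
      ultimately show ?thesis by (simp add: K_def q_def)
    qed
    have near: "q2 \<le> K y" if "\<bar>y - y0\<bar> \<le> d / 2" for y
    proof -
      have "cos (2 * pi * (y - y0)) = cos (2 * pi * \<bar>y - y0\<bar>)" by (rule cos_abs)
      also have "\<dots> \<ge> cos (2 * pi * (d / 2))"
        using that d by (intro cos_mono) auto
      finally show ?thesis by (simp add: K_def q2_def)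
    qed
    obtain B where "\<forall>x\<in>r ` {0..1}. norm x \<le> B"
      using compact_imp_bounded[OF compact_continuous_image[OF rc[of "{0..1}"] compact_Icc]]
      unfolding bounded_iff by blast
    then have B: "\<bar>r y\<bar> \<le> B" if "y \<in> {0..1}" for y using that by auto
    have main: "c / 2 * d * q2 ^ n \<le> B * q ^ n" for n
    proof -
      have low: "(if y \<in> {y0 - d/2..y0 + d/2} then c / 2 * q2 ^ n else 0) - B * q ^ n \<le> r y * K y ^ n" if y: "y \<in> {0..1}" for y
      proof (cases "\<bar>y - y0\<bar> < d")
        case True
        have "0 \<le> B" using B[OF y] by linarith
        then have bq: "0 \<le> B * q ^ n" using q0 by simp
        have "dist (r y) (r y0) < c / 2" using d0(2)[of y] True d by (simp add: dist_real_def)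
        then have r2: "r y \<ge> c / 2" using c by (simp add: dist_real_def abs_if split: if_splits)
        show ?thesis
        proof (cases "y \<in> {y0 - d/2..y0 + d/2}")
          case True
          then have "q2 \<le> K y" by (intro near) (auto simp: abs_if)
          then have "c / 2 * q2 ^ n \<le> r y * K y ^ n"
            using r2 c q q0 by (intro mult_mono power_mono) auto
          then show ?thesis using True bq by auto
        next
          case False
          have "0 \<le> r y * K y ^ n" using r2 c K0[of y] by simp
          then show ?thesis using False bq by auto
        qed
      next
        case False
        then have "y \<notin> {y0 - d/2..y0 + d/2}" using d(1) by (auto simp: abs_if split: if_splits)
        moreover have "\<bar>r y * K y ^ n\<bar> \<le> B * q ^ n"
          unfolding abs_mult using B[OF y] far[OF y] False K0[of y]
          by (intro mult_mono) (auto intro: power_mono)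
        ultimately show ?thesis by auto
      qed
      have "((\<lambda>y. if y \<in> {y0 - d/2..y0 + d/2} then c / 2 * q2 ^ n else 0) has_integral (c / 2 * q2 ^ n * d)) {0..1}"
        using has_integral_restrict_closed_subinterval[of "\<lambda>_. c / 2 * q2 ^ n" "c / 2 * q2 ^ n * d" "y0 - d/2" "y0 + d/2" 0 1]
          has_integral_const_real[of "c / 2 * q2 ^ n" "y0 - d/2" "y0 + d/2"] d y0
        by (simp add: mult_ac)
      from has_integral_diff[OF this has_integral_const_real[of "B * q ^ n" 0 1]]
      have i1: "((\<lambda>y. (if y \<in> {y0 - d/2..y0 + d/2} then c / 2 * q2 ^ n else 0) - B * q ^ n) has_integral (c / 2 * q2 ^ n * d - B * q ^ n)) {0..1}"
        by simp
      have i2: "((\<lambda>y. r y * K y ^ n) has_integral 0) {0..1}"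
      proof -
        have "continuous_on {0..1} (\<lambda>y. r y * K y ^ n)" by (intro continuous_intros rc Kc)
        from integrable_integral[OF integrable_continuous_real[OF this]] show ?thesis by (simp add: rint)
      qed
      show ?thesis using has_integral_le[OF i1 i2 low] by (simp add: mult_ac)
    qed
    have "(\<lambda>n. B * (q / q2) ^ n) \<longlonglongrightarrow> B * 0"
      using q q0 by (intro tendsto_mult tendsto_const LIMSEQ_realpow_zero) auto
    moreover have "c / 2 * d \<le> B * (q / q2) ^ n" for n
      using main[of n] q q0 by (simp add: power_divide field_simps)
    ultimately have "c / 2 * d \<le> 0"
      by (intro LIMSEQ_le_const[of "\<lambda>n. B * (q / q2) ^ n"]) auto
    then show False using c d by (simp add: mult_le_0_iff)
  qed
  \<comment> \<open>The argument above covers interior points; the endpoints follow by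
    continuity.\<close>
  have unit: "h y = 0" if "y \<in> {0..1}" for y
  proof -
    have "{0..1} = closure {0<..<1::real}" by simp
    moreover have "\<forall>x\<in>closure {0<..<1}. h x = 0"
    proof
      fix x :: real assume "x \<in> closure {0<..<1}"
      then show "h x = 0"
        using continuous_constant_on_closure[of "{0<..<1}" h 0 x] inner continuous_on_subset[OF cont] by auto
    qed
    ultimately show ?thesis using that by blast
  qed
  have nat: "h (x + real n) = h x" for x n
    by (induction n) (use per[of "x + real _"] in \<open>auto simp: add_ac\<close>)
  have "h (x + of_int k) = h x" for x k
  proof (cases "k \<ge> 0")
    case True
    then show ?thesis using nat[of x "nat k"] by simp
  next
    case False
    then show ?thesis using nat[of "x + of_int k" "nat (- k)"] by simp
  qed
  from this[of "frac y" "\<lfloor>y\<rfloor>"] show ?thesis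
    using unit[of "frac y"] by (simp add: frac_def frac_lt_1 less_imp_le frac_ge_0) (metis frac_def frac_ge_0 frac_lt_1 less_imp_le)
qed

section \<open>Gaussian sums over the integers\<close>

lemma summable_on_prod:
  fixes f :: "'a \<Rightarrow> real" and g :: "'b \<Rightarrow> real"
  assumes "f summable_on A" "g summable_on B" "\<And>x. x \<in> A \<Longrightarrow> 0 \<le> f x" "\<And>y. y \<in> B \<Longrightarrow> 0 \<le> g y"
  shows "(\<lambda>(x, y). f x * g y) summable_on A \<times> B"
proof -
  have "((\<lambda>y. f x * g y) has_sum f x * infsum g B) B" for x
    using assms(2) by (intro has_sum_cmult_right) simp
  moreover have "(\<lambda>x. f x * infsum g B) summable_on A" using assms(1) by (rule summable_on_cmult_left)
  ultimately show ?thesis using assms(3,4) by (intro summable_on_SigmaI[where g = "\<lambda>x. f x * infsum g B"]) auto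
qed

text \<open>Comparison with a geometric series in |b|, as |b| is at most b^2 for integers; the
  nonnegative and the negative integers are summed separately.\<close>

lemma summable_gauss_int:
  fixes c :: real assumes "c > 0"
  shows "(\<lambda>b::int. exp (- c * (of_int b)\<^sup>2)) summable_on UNIV"
proof -
  define h where "h = (\<lambda>b::int. exp (- c) ^ nat \<bar>b\<bar>)"
  have s: "(\<lambda>n. exp (- c) ^ n) summable_on UNIV"
    using assms by (intro norm_summable_imp_summable_on) simp
  have 1: "h summable_on range int"
    using s by (subst summable_on_reindex) (auto simp: h_def o_def)
  have "(\<lambda>n. exp (- c) * exp (- c) ^ n) summable_on UNIV"
    using s by (rule summable_on_cmult_right)
  moreover have "(\<lambda>n. exp (- c) * exp (- c) ^ n) = h \<circ> (\<lambda>n. - int (Suc n))"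
    by (auto simp: h_def nat_add_distrib)
  ultimately have 2: "h summable_on range (\<lambda>n. - int (Suc n))"
    by (subst summable_on_reindex) (auto simp: inj_on_def)
  have "range int \<inter> range (\<lambda>n. - int (Suc n)) = {}" by auto
  from summable_on_Un_disjoint[OF 1 2 this]
  have "h summable_on (range int \<union> range (\<lambda>n. - int (Suc n)))" .
  moreover have "range int \<union> range (\<lambda>n. - int (Suc n)) = UNIV"
  proof -
    have "b \<in> range int \<union> range (\<lambda>n. - int (Suc n))" for b
    proof (cases "b \<ge> 0")
      case True
      then have "b = int (nat b)" by simp
      then show ?thesis by blast
    next
      case False
      then have "b = - int (Suc (nat (- b - 1)))" by simp
      then show ?thesis by blast
    qed
    then show ?thesis by blast
  qed
  ultimately have "h summable_on UNIV" by simp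
  then show ?thesis
  proof (rule summable_on_comparison_test)
    fix b :: int
    have "real (nat \<bar>b\<bar>) \<le> (of_int b)\<^sup>2"
    proof -
      have "\<bar>b\<bar> \<le> \<bar>b\<bar> * \<bar>b\<bar>"
      proof (cases "b = 0")
        case False
        then have "1 \<le> \<bar>b\<bar>" by linarith
        then show ?thesis using mult_left_mono[of 1 "\<bar>b\<bar>" "\<bar>b\<bar>"] by simp
      qed simp
      then have "\<bar>b\<bar> \<le> b\<^sup>2" by (simp add: power2_eq_square abs_mult_self_eq)
      then show ?thesis by (metis of_int_abs of_int_le_iff of_int_power of_nat_nat abs_ge_zero of_int_of_nat_eq)
    qed
    then show "exp (- c * (of_int b)\<^sup>2) \<le> h b"
      using assms by (simp add: h_def exp_of_nat_mult[symmetric] mult.commute)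
  qed simp
qed

text \<open>The two exponents differ by c/2 times (b + 2y)^2. Half of the decay rate pays for the
  shift, which makes the bound uniform for bounded \<open>y\<close>.\<close>

lemma gauss_shift_le:
  fixes c b y :: real assumes "c \<ge> 0"
  shows "exp (- c * (b + y)\<^sup>2) \<le> exp (c * y\<^sup>2) * exp (- (c / 2) * b\<^sup>2)"
proof -
  have "b\<^sup>2 / 2 - y\<^sup>2 \<le> (b + y)\<^sup>2"
    using zero_le_power2[of "b + 2 * y"] by (simp add: power2_eq_square algebra_simps)
  from mult_left_mono[OF this assms] show ?thesis
    unfolding exp_add[symmetric] exp_le_cancel_iff by (simp add: algebra_simps)
qed

lemma summable_gauss_shift:
  fixes c y :: real assumes "c > 0"
  shows "(\<lambda>b::int. exp (- c * (of_int b + y)\<^sup>2)) summable_on UNIV"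
proof (rule summable_on_comparison_test)
  show "(\<lambda>b::int. exp (c * y\<^sup>2) * exp (- (c / 2) * (of_int b)\<^sup>2)) summable_on UNIV"
    using assms by (intro summable_on_cmult_right summable_gauss_int) auto
qed (use gauss_shift_le assms in auto)

definition shifted_gauss :: "real \<Rightarrow> real \<Rightarrow> real \<Rightarrow> complex" where
  "shifted_gauss T x y = of_real (exp (- pi * T * y\<^sup>2)) * exp (2 * pi * \<i> * of_real (x * y))"

lemma norm_shifted_gauss: "norm (shifted_gauss T x y) = exp (- pi * T * y\<^sup>2)"
proof -
  have "norm (exp (2 * pi * \<i> * of_real (x * y))) = 1" by (simp add: norm_exp_eq_Re)
  then show ?thesis by (simp add: shifted_gauss_def norm_mult)
qed

lemma continuous_shifted_gauss [continuous_intros]: "continuous_on A f \<Longrightarrow> continuous_on A (\<lambda>y. shifted_gauss T x (f y))"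
  unfolding shifted_gauss_def by (intro continuous_intros) auto

lemma measurable_shifted_gauss [measurable]: "shifted_gauss T x \<in> borel_measurable borel"
  by (intro borel_measurable_continuous_onI continuous_intros)

lemma integrable_shifted_gauss:
  assumes T: "T > 0" shows "integrable lborel (shifted_gauss T x)"
proof -
  have "integrable lborel (\<lambda>y. normal_density 0 (1 / sqrt (2 * pi * T)) y)"
    using T by (intro integrable_normal_density) auto
  moreover have "normal_density 0 (1 / sqrt (2 * pi * T)) y = sqrt T * exp (- pi * T * y\<^sup>2)" for y
    using T by (simp add: normal_density_def power_divide real_sqrt_divide field_simps)
  ultimately have "integrable lborel (\<lambda>y. sqrt T * exp (- pi * T * y\<^sup>2))" by simp
  then have "integrable lborel (\<lambda>y. exp (- pi * T * y\<^sup>2))" using T by simp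
  then show ?thesis
    by (rule Bochner_Integration.integrable_bound) (auto simp: norm_shifted_gauss)
qed

text \<open>Rescaling the variable by sqrt(2 pi T) turns the integral into the characteristic
  function of the standard normal distribution at 2 pi x / sqrt(2 pi T).\<close>

lemma integral_shifted_gauss:
  assumes T: "T > 0"
  shows "(\<integral>y. shifted_gauss T x y \<partial>lborel) = of_real (exp (- pi * x\<^sup>2 / T) / sqrt T)"
proof -
  define c where "c = sqrt (2 * pi * T)"
  have c: "c > 0" "c\<^sup>2 = 2 * pi * T" using T by (auto simp: c_def)
  define t where "t = 2 * pi * x / c"
  have "complex_of_real (exp (- (t\<^sup>2) / 2)) = char std_normal_distribution t"
    by (simp add: char_std_normal_distribution)
  also have "\<dots> = (\<integral>z. std_normal_density z *\<^sub>R iexp (t * z) \<partial>lborel)"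
    unfolding char_def by (subst integral_density) auto
  also have "\<dots> = c *\<^sub>R (\<integral>y. std_normal_density (0 + c * y) *\<^sub>R iexp (t * (0 + c * y)) \<partial>lborel)"
    using lborel_integral_real_affine[of c "\<lambda>z. std_normal_density z *\<^sub>R iexp (t * z)" 0] c by simp
  also have "(\<lambda>y. std_normal_density (0 + c * y) *\<^sub>R iexp (t * (0 + c * y))) = (\<lambda>y. of_real (1 / sqrt (2 * pi)) * shifted_gauss T x y)"
  proof
    fix y
    have "std_normal_density (0 + c * y) = 1 / sqrt (2 * pi) * exp (- pi * T * y\<^sup>2)"
      unfolding std_normal_density_def by (simp add: power_mult_distrib c(2))
    moreover have "iexp (t * (0 + c * y)) = exp (2 * pi * \<i> * of_real (x * y))"
      using c(1) by (simp add: t_def mult_ac)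
    ultimately show "std_normal_density (0 + c * y) *\<^sub>R iexp (t * (0 + c * y)) = of_real (1 / sqrt (2 * pi)) * shifted_gauss T x y"
      by (simp only: shifted_gauss_def scaleR_conv_of_real of_real_mult mult.assoc)
  qed
  also have "(\<integral>y. of_real (1 / sqrt (2 * pi)) * shifted_gauss T x y \<partial>lborel) = of_real (1 / sqrt (2 * pi)) * (\<integral>y. shifted_gauss T x y \<partial>lborel)"
    by (rule integral_mult_right_zero)
  finally have "complex_of_real (exp (- (t\<^sup>2) / 2)) = of_real (c * (1 / sqrt (2 * pi))) * (\<integral>y. shifted_gauss T x y \<partial>lborel)"
    by (simp only: scaleR_conv_of_real of_real_mult mult.assoc)
  moreover have "c * (1 / sqrt (2 * pi)) = sqrt T" by (simp add: c_def real_sqrt_mult)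
  moreover have "t\<^sup>2 / 2 = pi * x\<^sup>2 / T"
  proof -
    have "t\<^sup>2 = (2 * pi * x)\<^sup>2 / (2 * pi * T)" by (simp add: t_def power_divide c(2))
    then show ?thesis using T by (simp add: power2_eq_square)
  qed
  ultimately show ?thesis using T by (simp add: field_simps)
qed

lemma continuous_on_infsum:
  fixes f :: "'i \<Rightarrow> 'a::topological_space \<Rightarrow> complex"
  assumes "\<And>n. n \<in> I \<Longrightarrow> continuous_on A (f n)" "\<And>n y. n \<in> I \<Longrightarrow> y \<in> A \<Longrightarrow> norm (f n y) \<le> b n" "b summable_on I"
  shows "continuous_on A (\<lambda>y. \<Sum>\<^sub>\<infinity>n\<in>I. f n y)"
proof (rule uniform_limit_theorem)
  show "uniform_limit A (\<lambda>X y. \<Sum>n\<in>X. f n y) (\<lambda>y. \<Sum>\<^sub>\<infinity>n\<in>I. f n y) (finite_subsets_at_top I)"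
    using assms(2,3) by (rule Weierstrass_m_test_general)
  show "\<forall>\<^sub>F X in finite_subsets_at_top I. continuous_on A (\<lambda>y. \<Sum>n\<in>X. f n y)"
    by (intro eventually_finite_subsets_at_top_weakI continuous_on_sum) (use assms(1) in blast)
qed simp

definition fourier_char :: "int \<Rightarrow> real \<Rightarrow> complex" where
  "fourier_char m y = exp (2 * pi * \<i> * of_int m * of_real y)"

lemma norm_fourier_char [simp]: "norm (fourier_char m y) = 1"
  by (simp add: fourier_char_def norm_exp_eq_Re)

lemma continuous_fourier_char [continuous_intros]: "continuous_on A f \<Longrightarrow> continuous_on A (\<lambda>y. fourier_char m (f y))"
  unfolding fourier_char_def by (intro continuous_intros) auto

lemma measurable_fourier_char [measurable]: "fourier_char m \<in> borel_measurable borel"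
  by (intro borel_measurable_continuous_onI continuous_intros)

lemma fourier_char_add: "fourier_char m y * fourier_char k y = fourier_char (m + k) y"
  unfolding fourier_char_def exp_add[symmetric] by (simp add: algebra_simps)

lemma fourier_char_periodic: "fourier_char m (of_int b + y) = fourier_char m y"
proof -
  have "exp ((2 * of_int (m * b) * of_real pi) * \<i>) = 1"
    using exp_integer_2pi[of "of_int (m * b)"] by simp
  moreover have "fourier_char m (of_int b + y) = exp ((2 * of_int (m * b) * of_real pi) * \<i>) * fourier_char m y"
    unfolding fourier_char_def exp_add[symmetric] by (simp add: algebra_simps)
  ultimately show ?thesis by simp
qed

lemma integral_fourier_char: "integral {0..1} (fourier_char k) = (if k = 0 then 1 else 0)"
proof (cases "k = 0")
  case True
  have "fourier_char 0 = (\<lambda>_. 1)" by (rule ext) (simp add: fourier_char_def)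
  with True show ?thesis by simp
next
  case False
  let ?c = "2 * pi * \<i> * of_int k :: complex"
  have "((\<lambda>y. fourier_char k y) has_integral (fourier_char k 1 / ?c - fourier_char k 0 / ?c)) {0..1}"
  proof (rule fundamental_theorem_of_calculus)
    fix x :: real
    have "((\<lambda>z. exp (?c * z) / ?c) has_field_derivative exp (?c * of_real x)) (at (of_real x))"
      using False by (auto intro!: derivative_eq_intros)
    from has_vector_derivative_real_field[OF this]
    show "((\<lambda>y. fourier_char k y / ?c) has_vector_derivative fourier_char k x) (at x within {0..1})"
      by (simp add: fourier_char_def mult.assoc)
  qed simp
  moreover have "fourier_char k 1 = fourier_char k 0" using fourier_char_periodic[of k 1 0] by simp
  ultimately show ?thesis using False by (simp add: integral_unique)
qed

text \<open>The half-open interval is chosen because its integer translates tile the line without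
  overlap.\<close>

lemma lborel_unit_integral:
  fixes f :: "real \<Rightarrow> complex"
  assumes "continuous_on {0..1} f"
  shows "integral {0..1} f = (\<integral>y. indicator {0..<1} y *\<^sub>R f y \<partial>lborel)"
    and "integrable lborel (\<lambda>y. indicator {0..<1} y *\<^sub>R f y)"
proof -
  have i: "set_integrable lborel {0..1} f" using assms by (rule borel_integrable_atLeastAtMost')
  then show "integrable lborel (\<lambda>y. indicator {0..<1} y *\<^sub>R f y)"
    unfolding set_integrable_def[symmetric] by (rule set_integrable_subset) auto
  have "AE y in lborel. y \<noteq> (1::real)" by (rule AE_lborel_singleton)
  then have "(\<integral>y. indicator {0..1} y *\<^sub>R f y \<partial>lborel) = (\<integral>y. indicator {0..<1} y *\<^sub>R f y \<partial>lborel)"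
    using i \<open>integrable lborel (\<lambda>y. indicator {0..<1} y *\<^sub>R f y)\<close>
    by (intro integral_cong_AE) (auto simp: set_integrable_def indicator_def elim!: eventually_mono)
  then show "integral {0..1} f = (\<integral>y. indicator {0..<1} y *\<^sub>R f y \<partial>lborel)"
    using set_borel_integral_eq_integral(2)[OF i] by (simp add: set_lebesgue_integral_def)
qed

lemma shifted_gauss_mult: "shifted_gauss T x y * exp (2 * pi * \<i> * of_real (k * y)) = shifted_gauss T (x + k) y"
proof -
  have "exp (2 * pi * \<i> * of_real (x * y)) * exp (2 * pi * \<i> * of_real (k * y)) = exp (2 * pi * \<i> * of_real ((x + k) * y))"
    unfolding exp_add[symmetric] by (simp add: ring_distribs)
  then show ?thesis by (simp only: shifted_gauss_def mult.assoc)
qed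

text \<open>Both sides are continuous and 1-periodic in \<open>Y\<close>, so comparing Fourier
  coefficients suffices. On the left, the sum over \<open>b\<close> and the integral over the unit
  interval unfold to one Gaussian integral over the line; on the right, orthogonality of characters
  selects a single term.\<close>

lemma poisson_gauss:
  fixes T Y \<xi> :: real
  assumes T: "T > 0"
  shows "(\<Sum>\<^sub>\<infinity>b::int. shifted_gauss T (- \<xi>) (of_int b + Y)) =
    (\<Sum>\<^sub>\<infinity>m::int. of_real (exp (- pi * (of_int m + \<xi>)\<^sup>2 / T) / sqrt T) * fourier_char m Y)"
proof -
  define c where "c = (\<lambda>m::int. exp (- pi * (of_int m + \<xi>)\<^sup>2 / T) / sqrt T)"
  define f1 where "f1 = (\<lambda>Y. \<Sum>\<^sub>\<infinity>b::int. shifted_gauss T (- \<xi>) (of_int b + Y))"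
  define f2 where "f2 = (\<lambda>Y. \<Sum>\<^sub>\<infinity>m::int. of_real (c m) * fourier_char m Y)"
  have c0: "c m \<ge> 0" for m using T by (simp add: c_def)
  have csum: "c summable_on UNIV"
  proof -
    have "(\<lambda>m::int. exp (- (pi / T) * (of_int m + \<xi>)\<^sup>2) * (1 / sqrt T)) summable_on UNIV"
      using T by (intro summable_on_cmult_left summable_gauss_shift) auto
    then show ?thesis by (simp add: c_def)
  qed
  \<comment> \<open>A summable majorant of the left-hand summands, uniform for |y| at most
    \<open>R\<close>; it yields continuity on every bounded interval.\<close>
  define B where "B = (\<lambda>R. \<lambda>b::int. exp (pi * T * R\<^sup>2) * exp (- (pi * T / 2) * (of_int b)\<^sup>2))"
  have Bsum: "B R summable_on UNIV" for R
    unfolding B_def using T by (intro summable_on_cmult_right summable_gauss_int) auto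
  have Bbound: "norm (shifted_gauss T x (of_int b + y)) \<le> B R b" if "\<bar>y\<bar> \<le> R" for x b y R
  proof -
    have "norm (shifted_gauss T x (of_int b + y)) \<le> exp (pi * T * y\<^sup>2) * exp (- (pi * T / 2) * (of_int b)\<^sup>2)"
      using gauss_shift_le[of "pi * T" "of_int b" y] T by (simp add: norm_shifted_gauss)
    also have "y\<^sup>2 \<le> R\<^sup>2" using that by (metis abs_ge_zero power2_abs power_mono)
    then have "exp (pi * T * y\<^sup>2) * exp (- (pi * T / 2) * (of_int b)\<^sup>2) \<le> B R b"
      unfolding B_def using T by (intro mult_right_mono) auto
    finally show ?thesis .
  qed
  have cont1: "continuous_on UNIV f1"
  proof -
    have "continuous_on (\<Union>R\<in>(UNIV::real set). {- R<..<R}) f1"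
    proof (rule continuous_on_open_UN)
      fix R :: real
      show "continuous_on {- R<..<R} f1"
        unfolding f1_def
        by (rule continuous_on_infsum[where b = "B R"]) (auto intro!: continuous_intros Bbound Bsum)
    qed auto
    moreover have "(\<Union>R\<in>(UNIV::real set). {- R<..<R}) = UNIV"
    proof -
      have "x \<in> {- (\<bar>x\<bar> + 1)<..<\<bar>x\<bar> + 1}" for x :: real by auto
      then show ?thesis by blast
    qed
    ultimately show ?thesis by simp
  qed
  have cont2: "continuous_on UNIV f2"
    unfolding f2_def
    by (rule continuous_on_infsum[where b = c]) (auto intro!: continuous_intros csum simp: norm_mult c0)
  have per: "f1 (Y + 1) - f2 (Y + 1) = f1 Y - f2 Y" for Y
  proof -
    have "f1 (Y + 1) = (\<Sum>\<^sub>\<infinity>b::int. shifted_gauss T (- \<xi>) (of_int (b + 1) + Y))" by (simp add: f1_def algebra_simps)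
    also have "\<dots> = f1 Y" unfolding f1_def
      by (rule infsum_reindex_bij_witness[of _ "\<lambda>b. b - 1" "\<lambda>b. b + 1"]) auto
    finally show ?thesis using fourier_char_periodic[of _ 1 Y] by (simp add: f2_def add.commute)
  qed
  \<comment> \<open>Integrating against the character of frequency \<open>m\<close> extracts the
    coefficient of frequency -m.\<close>
  have coef1: "integral {0..1} (\<lambda>y. f1 y * fourier_char m y) = c (- m)" for m
  proof -
    define G where "G = shifted_gauss T (of_int m - \<xi>)"
    define g where "g = (\<lambda>b::int. \<lambda>y. indicator {0..<1} y *\<^sub>R G (of_int b + y))"
    have Gm [measurable]: "G \<in> borel_measurable borel" by (simp add: G_def)
    have Gi: "integrable lborel G" unfolding G_def using T by (rule integrable_shifted_gauss)
    have gG: "shifted_gauss T (- \<xi>) (of_int b + y) * fourier_char m y = G (of_int b + y)" for b y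
    proof -
      have "fourier_char m y = exp (2 * pi * \<i> * of_real (of_int m * (of_int b + y)))"
        using fourier_char_periodic[of m b y] by (simp add: fourier_char_def mult_ac)
      then show ?thesis by (simp only: shifted_gauss_mult G_def) simp
    qed
    have gsub: "g b y = (\<lambda>z. indicator {of_int b..<of_int b + 1} z *\<^sub>R G z) (of_int b + 1 * y)" for b y
      by (auto simp: g_def indicator_def)
    have gi: "integrable lborel (g b)" for b
      unfolding g_def G_def by (intro lborel_unit_integral(2) continuous_intros)
    have ii: "integrable lborel (\<lambda>z. indicator {of_int b..<of_int b + 1::real} z *\<^sub>R G z)" for b :: int
      using integrable_mult_indicator[of "{of_int b..<of_int b + 1::real}" lborel G] Gi by simp
    have gint: "(\<integral>y. g b y \<partial>lborel) = (\<integral>z. indicator {of_int b..<of_int b + 1} z *\<^sub>R G z \<partial>lborel)" for b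
      unfolding gsub using lborel_integral_real_affine[of 1 "\<lambda>z. indicator {of_int b..<of_int b + 1} z *\<^sub>R G z" "of_int b"] by simp
    have gnint: "(\<integral>y. norm (g b y) \<partial>lborel) = (\<integral>z. norm (indicator {of_int b..<of_int b + 1::real} z *\<^sub>R G z) \<partial>lborel)" for b
      unfolding gsub using lborel_integral_real_affine[of 1 "\<lambda>z. norm (indicator {of_int b..<of_int b + 1} z *\<^sub>R G z)" "of_int b"] by simp
    have ns: "(\<lambda>b. \<integral>y. norm (g b y) \<partial>lborel) summable_on UNIV"
    proof (rule summable_on_comparison_test[OF Bsum[of 1]])
      fix b :: int
      have "(\<integral>y. norm (g b y) \<partial>lborel) \<le> (\<integral>y. indicator {0..<1::real} y *\<^sub>R B 1 b \<partial>lborel)"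
      proof (rule integral_mono)
        show "integrable lborel (\<lambda>y. norm (g b y))" using gi by simp
        show "integrable lborel (\<lambda>y. indicator {0..<1::real} y *\<^sub>R B 1 b)"
          by (intro integrable_scaleR_left integrable_real_indicator) auto
        show "norm (g b y) \<le> indicator {0..<1::real} y *\<^sub>R B 1 b" for y
          using Bbound[of y 1 "of_int m - \<xi>" b] by (auto simp: g_def G_def indicator_def)
      qed
      also have "\<dots> = B 1 b" by (simp add: measure_def)
      finally show "(\<integral>y. norm (g b y) \<partial>lborel) \<le> B 1 b" .
    qed (auto intro!: integral_nonneg_AE)
    have "integral {0..1} (\<lambda>y. f1 y * fourier_char m y) = (\<integral>y. indicator {0..<1} y *\<^sub>R (f1 y * fourier_char m y) \<partial>lborel)"
      by (intro lborel_unit_integral continuous_intros continuous_on_subset[OF cont1]) auto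
    also have "\<dots> = (\<integral>y. (\<Sum>\<^sub>\<infinity>b. g b y) \<partial>lborel)"
    proof (intro Bochner_Integration.integral_cong refl)
      fix y
      have "indicator {0..<1} y *\<^sub>R (f1 y * fourier_char m y) = (\<Sum>\<^sub>\<infinity>b. of_real (indicator {0..<1} y) * (shifted_gauss T (- \<xi>) (of_int b + y) * fourier_char m y))"
        unfolding f1_def infsum_cmult_right' infsum_cmult_left' by (simp add: scaleR_conv_of_real)
      then show "indicator {0..<1} y *\<^sub>R (f1 y * fourier_char m y) = (\<Sum>\<^sub>\<infinity>b. g b y)"
        unfolding gG by (simp add: g_def scaleR_conv_of_real)
    qed
    also have "\<dots> = (\<Sum>\<^sub>\<infinity>b. \<integral>y. g b y \<partial>lborel)"
      by (rule integral_infsum(3)[OF sigma_finite_lborel _ gi ns]) simp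
    also have "\<dots> = (\<integral>z. (\<Sum>\<^sub>\<infinity>b::int. indicator {of_int b..<of_int b + 1} z *\<^sub>R G z) \<partial>lborel)"
      unfolding gint
      by (rule integral_infsum(3)[OF sigma_finite_lborel _ ii ns[unfolded gnint], symmetric]) simp
    also have "\<dots> = (\<integral>z. G z \<partial>lborel)"
    proof (intro Bochner_Integration.integral_cong refl)
      fix z :: real
      have "(\<Sum>\<^sub>\<infinity>b::int. indicator {of_int b..<of_int b + 1} z *\<^sub>R G z) = (\<Sum>\<^sub>\<infinity>b\<in>{\<lfloor>z\<rfloor>}. indicator {of_int b..<of_int b + 1} z *\<^sub>R G z)"
      proof (rule infsum_cong_neutral)
        fix b assume "b \<in> UNIV - {\<lfloor>z\<rfloor>}"
        then have "\<not> (of_int b \<le> z \<and> z < of_int b + 1)" by (auto simp: floor_unique)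
        then show "indicator {of_int b..<of_int b + 1} z *\<^sub>R G z = 0" by (auto simp: indicator_def)
      qed auto
      also have "\<dots> = G z" by (auto simp: indicator_def)
      finally show "(\<Sum>\<^sub>\<infinity>b::int. indicator {of_int b..<of_int b + 1} z *\<^sub>R G z) = G z" .
    qed
    also have "\<dots> = c (- m)"
      unfolding G_def integral_shifted_gauss[OF T] by (simp add: c_def power2_commute)
    finally show ?thesis .
  qed
  have coef2: "integral {0..1} (\<lambda>y. f2 y * fourier_char m y) = c (- m)" for m
  proof -
    define g where "g = (\<lambda>k y. indicator {0..<1::real} y *\<^sub>R (of_real (c k) * fourier_char (k + m) y))"
    have gi: "integrable lborel (g k)" for k
      unfolding g_def by (intro lborel_unit_integral(2) continuous_intros)
    have gint: "(\<integral>y. g k y \<partial>lborel) = of_real (c k) * (if k + m = 0 then 1 else 0)" for k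
      unfolding g_def
      by (subst lborel_unit_integral(1)[symmetric]) (auto intro!: continuous_intros simp: integral_fourier_char)
    have ns: "(\<lambda>k. \<integral>y. norm (g k y) \<partial>lborel) summable_on UNIV"
    proof (rule summable_on_comparison_test[OF csum])
      fix k
      have "norm (g k y) = indicator {0..<1::real} y *\<^sub>R c k" for y
        using c0[of k] by (auto simp: g_def norm_mult indicator_def)
      then show "(\<integral>y. norm (g k y) \<partial>lborel) \<le> c k" by (simp add: measure_def)
    qed (auto intro!: integral_nonneg_AE)
    have "integral {0..1} (\<lambda>y. f2 y * fourier_char m y) = (\<integral>y. indicator {0..<1} y *\<^sub>R (f2 y * fourier_char m y) \<partial>lborel)"
      by (intro lborel_unit_integral continuous_intros continuous_on_subset[OF cont2]) auto
    also have "\<dots> = (\<integral>y. (\<Sum>\<^sub>\<infinity>k. g k y) \<partial>lborel)"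
    proof (intro Bochner_Integration.integral_cong refl)
      fix y
      have "indicator {0..<1} y *\<^sub>R (f2 y * fourier_char m y) = (\<Sum>\<^sub>\<infinity>k. of_real (indicator {0..<1} y) * ((of_real (c k) * fourier_char k y) * fourier_char m y))"
        unfolding f2_def infsum_cmult_right' infsum_cmult_left' by (simp add: scaleR_conv_of_real)
      then show "indicator {0..<1} y *\<^sub>R (f2 y * fourier_char m y) = (\<Sum>\<^sub>\<infinity>k. g k y)"
        unfolding mult.assoc fourier_char_add by (simp add: g_def scaleR_conv_of_real)
    qed
    also have "\<dots> = (\<Sum>\<^sub>\<infinity>k. \<integral>y. g k y \<partial>lborel)"
      by (rule integral_infsum(3)[OF sigma_finite_lborel _ gi ns]) simp
    also have "\<dots> = (\<Sum>\<^sub>\<infinity>k\<in>{- m}. of_real (c k))"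
      unfolding gint by (rule infsum_cong_neutral) auto
    finally show ?thesis by simp
  qed
  have "f1 Y - f2 Y = 0"
  proof (rule fourier_uniqueness[where h = "\<lambda>y. f1 y - f2 y"])
    show "continuous_on UNIV (\<lambda>y. f1 y - f2 y)" by (intro continuous_intros cont1 cont2)
    show "f1 (y + 1) - f2 (y + 1) = f1 y - f2 y" for y by (rule per)
    fix m :: int
    have i: "(\<lambda>y. f1 y * fourier_char m y) integrable_on {0..1}" "(\<lambda>y. f2 y * fourier_char m y) integrable_on {0..1}"
      by (intro integrable_continuous_real continuous_intros continuous_on_subset[OF cont1] continuous_on_subset[OF cont2]; simp)+
    have "integral {0..1} (\<lambda>y. (f1 y - f2 y) * fourier_char m y) = integral {0..1} (\<lambda>y. f1 y * fourier_char m y) - integral {0..1} (\<lambda>y. f2 y * fourier_char m y)"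
      unfolding left_diff_distrib using i by (rule integral_diff)
    then show "integral {0..1} (\<lambda>y. (f1 y - f2 y) * exp (2 * pi * \<i> * of_int m * of_real y)) = 0"
      unfolding fourier_char_def[symmetric] coef1 coef2 by simp
  qed
  then show ?thesis by (simp add: f1_def f2_def c_def)
qed

section \<open>The theta function\<close>

lemma summable_on_prod_complex:
  fixes f :: "'a \<Rightarrow> complex" and g :: "'b \<Rightarrow> complex"
  assumes "f summable_on A" "g summable_on B"
  shows "(\<lambda>(x, y). f x * g y) summable_on A \<times> B"
    and "(\<Sum>\<^sub>\<infinity>(x, y)\<in>A \<times> B. f x * g y) = infsum f A * infsum g B"
proof -
  have "(\<lambda>x. norm (f x)) summable_on A" "(\<lambda>x. norm (g x)) summable_on B"
    using assms by (simp_all add: summable_on_iff_abs_summable_on_complex)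
  from summable_on_prod[OF this]
  have "(\<lambda>z. norm (case z of (x, y) \<Rightarrow> f x * g y)) summable_on A \<times> B"
    by (simp add: case_prod_unfold norm_mult)
  then show s: "(\<lambda>(x, y). f x * g y) summable_on A \<times> B" by (rule abs_summable_summable)
  show "(\<Sum>\<^sub>\<infinity>(x, y)\<in>A \<times> B. f x * g y) = infsum f A * infsum g B"
    using infsum_Sigma_banach[OF s] by (simp add: infsum_cmult_right' infsum_cmult_left')
qed

text \<open>One hyperbolic plane of the flux lattice. \<open>R\<close> and \<open>T\<close> are the
  real and imaginary part of tau, \<open>p\<close> and \<open>q\<close> the electric and magnetic
  charge; the two integers are fluxes through complementary planes, shifted by \<open>q\<close>
  times the data \<open>x\<close>, \<open>y\<close> of the surface. The modulus involves the
  definite form a^2 + b^2, the phase the indefinite product a b.\<close>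

definition theta2_term :: "real \<Rightarrow> real \<Rightarrow> real \<Rightarrow> real \<Rightarrow> real \<Rightarrow> real \<Rightarrow> int \<times> int \<Rightarrow> complex" where
  "theta2_term R T p q x y k = (let a = of_int (fst k) + q * x; b = of_int (snd k) + q * y in
     of_real (exp (- pi * T * (a\<^sup>2 + b\<^sup>2))) *
     exp (\<i> * of_real (- 2 * pi * (R * a * b + p * (a * y + b * x)))))"

definition theta2 :: "real \<Rightarrow> real \<Rightarrow> real \<Rightarrow> real \<Rightarrow> real \<Rightarrow> real \<Rightarrow> complex" where
  "theta2 R T p q x y = (\<Sum>\<^sub>\<infinity>k. theta2_term R T p q x y k)"

text \<open>The summand after Poisson summation in the second flux only, stripped of a factor
  independent of the summation variables. Its real exponent is -pi |m + p x + tau (a + q x)|^2 / T,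
  a shape in which inversion of tau merely permutes \<open>a\<close> and \<open>m\<close>.\<close>

definition theta2_dual :: "real \<Rightarrow> real \<Rightarrow> real \<Rightarrow> real \<Rightarrow> real \<Rightarrow> real \<Rightarrow> int \<Rightarrow> int \<Rightarrow> complex" where
  "theta2_dual R T p q x y a m =
     of_real (exp (- (pi / T) * ((of_int m + p * x + R * (of_int a + q * x))\<^sup>2 + T\<^sup>2 * (of_int a + q * x)\<^sup>2))) *
     exp (\<i> * of_real (2 * pi * y * (of_int m * q - p * of_int a)))"

lemma norm_exp_i [simp]: "norm (exp (\<i> * of_real t)) = 1"
  by (simp add: norm_exp_eq_Re)

lemma theta2_term_summable:
  assumes T: "T > 0"
  shows "theta2_term R T p q x y summable_on UNIV"
proof (rule abs_summable_summable)
  have "(\<lambda>k. norm (theta2_term R T p q x y k)) = (\<lambda>(a, b). exp (- (pi * T) * (of_int a + q * x)\<^sup>2) * exp (- (pi * T) * (of_int b + q * y)\<^sup>2))"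
    by (auto simp: theta2_term_def Let_def norm_mult exp_add[symmetric] ring_distribs simp del: norm_exp_i)
  moreover have "(\<lambda>(a, b). exp (- (pi * T) * (of_int a + q * x)\<^sup>2) * exp (- (pi * T) * (of_int b + q * y)\<^sup>2)) summable_on (UNIV \<times> UNIV :: (int \<times> int) set)"
    using T by (intro summable_on_prod summable_gauss_shift) auto
  ultimately show "(\<lambda>k. norm (theta2_term R T p q x y k)) summable_on UNIV" by simp
qed

text \<open>Absolute convergence in both variables together is what allows the two sums to be
  exchanged in \<open>theta2_S\<close>.\<close>

lemma theta2_dual_summable:
  assumes T: "T > 0"
  shows "(\<lambda>(a, m). theta2_dual R T p q x y a m) summable_on UNIV \<times> UNIV"
proof (rule abs_summable_summable)
  \<comment> \<open>Determinant over trace of the quadratic form (M + R A)^2 + T^2 A^2, a lower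
    bound for its smallest eigenvalue.\<close>
  define c where "c = T\<^sup>2 / (1 + R\<^sup>2 + T\<^sup>2)"
  have pos: "1 + R\<^sup>2 + T\<^sup>2 > 0" by (simp add: add_pos_nonneg)
  have c: "c > 0" "c < 1" using T pos by (auto simp: c_def field_simps add_pos_nonneg)
  have ceq: "c * (1 + R\<^sup>2 + T\<^sup>2) = T\<^sup>2" using pos by (simp add: c_def)
  have form: "c * (M\<^sup>2 + A\<^sup>2) \<le> (M + R * A)\<^sup>2 + T\<^sup>2 * A\<^sup>2" for M A :: real
  proof -
    have "(1 - c) * ((M + R * A)\<^sup>2 + T\<^sup>2 * A\<^sup>2 - c * (M\<^sup>2 + A\<^sup>2)) = ((1 - c) * M + R * A)\<^sup>2 + (c\<^sup>2 + (T\<^sup>2 - c * (1 + R\<^sup>2 + T\<^sup>2))) * A\<^sup>2"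
      by (simp add: power2_eq_square algebra_simps)
    also have "\<dots> \<ge> 0" unfolding ceq by simp
    finally have "0 \<le> (M + R * A)\<^sup>2 + T\<^sup>2 * A\<^sup>2 - c * (M\<^sup>2 + A\<^sup>2)"
      using c by (simp add: zero_le_mult_iff)
    then show ?thesis by simp
  qed
  show "(\<lambda>k. norm (case k of (a, m) \<Rightarrow> theta2_dual R T p q x y a m)) summable_on UNIV \<times> UNIV"
  proof (rule summable_on_comparison_test)
    show "(\<lambda>(a, m). exp (- (pi / T * c) * (of_int a + q * x)\<^sup>2) * exp (- (pi / T * c) * (of_int m + p * x)\<^sup>2)) summable_on (UNIV \<times> UNIV :: (int \<times> int) set)"
      using T c by (intro summable_on_prod summable_gauss_shift) auto
    fix k :: "int \<times> int"
    obtain a m where k: "k = (a, m)" by (cases k)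
    have "pi / T * (c * ((of_int m + p * x)\<^sup>2 + (of_int a + q * x)\<^sup>2)) \<le> 
       pi / T * ((of_int m + p * x + R * (of_int a + q * x))\<^sup>2 + T\<^sup>2 * (of_int a + q * x)\<^sup>2)"
      using form T by (intro mult_left_mono) auto
    then show "norm (case k of (a, m) \<Rightarrow> theta2_dual R T p q x y a m) \<le> (case k of (a, m) \<Rightarrow> exp (- (pi / T * c) * (of_int a + q * x)\<^sup>2) * exp (- (pi / T * c) * (of_int m + p * x)\<^sup>2))"
      unfolding k prod.case theta2_dual_def norm_mult norm_exp_i norm_of_real mult_1_right abs_exp_cancel exp_add[symmetric] exp_le_cancel_iff
      by (simp only: ring_distribs mult_minus_left mult.assoc)
  qed auto
qed

lemma theta2_poisson:
  assumes T: "T > 0"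
  shows "of_real (sqrt T) * theta2 R T p q x y =
    exp (\<i> * of_real (- 2 * pi * p * q * x * y)) * (\<Sum>\<^sub>\<infinity>a. \<Sum>\<^sub>\<infinity>m. theta2_dual R T p q x y a m)"
proof -
  have inner: "(\<Sum>\<^sub>\<infinity>b. theta2_term R T p q x y (a, b)) =
     of_real (1 / sqrt T) * (exp (\<i> * of_real (- 2 * pi * p * q * x * y)) * (\<Sum>\<^sub>\<infinity>m. theta2_dual R T p q x y a m))" for a
  proof -
    define A where "A = of_int a + q * x"
    define \<xi> where "\<xi> = R * A + p * x"
    define w where "w = of_real (exp (- pi * T * A\<^sup>2)) * exp (\<i> * of_real (- 2 * pi * p * A * y))"
    have t: "theta2_term R T p q x y (a, b) = w * shifted_gauss T (- \<xi>) (of_int b + q * y)" for b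
    proof -
      define B where "B = of_int b + q * y"
      have "exp (\<i> * of_real (- 2 * pi * (R * A * B + p * (A * y + B * x)))) = 
          exp (\<i> * of_real (- 2 * pi * p * A * y)) * exp (2 * pi * \<i> * of_real (- \<xi> * B))"
        unfolding exp_add[symmetric] \<xi>_def by (simp add: algebra_simps)
      moreover have "exp (- pi * T * (A\<^sup>2 + B\<^sup>2)) = exp (- pi * T * A\<^sup>2) * exp (- pi * T * B\<^sup>2)"
        unfolding exp_add[symmetric] by (simp add: algebra_simps)
      ultimately show ?thesis
        unfolding theta2_term_def Let_def fst_conv snd_conv A_def[symmetric] B_def[symmetric] w_def shifted_gauss_def
        by (simp only: of_real_mult mult_ac)
    qed
    have d: "w * (of_real (exp (- pi * (of_int m + \<xi>)\<^sup>2 / T) / sqrt T) * fourier_char m (q * y)) = 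
       of_real (1 / sqrt T) * (exp (\<i> * of_real (- 2 * pi * p * q * x * y)) * theta2_dual R T p q x y a m)" for m
    proof -
      have "exp (\<i> * of_real (- 2 * pi * p * A * y)) * fourier_char m (q * y) =
         exp (\<i> * of_real (- 2 * pi * p * q * x * y)) * exp (\<i> * of_real (2 * pi * y * (of_int m * q - p * of_int a)))"
        unfolding exp_add[symmetric] fourier_char_def A_def by (simp add: algebra_simps)
      moreover have "exp (- pi * T * A\<^sup>2) * (exp (- pi * (of_int m + \<xi>)\<^sup>2 / T) / sqrt T) =
         1 / sqrt T * exp (- (pi / T) * ((of_int m + p * x + R * A)\<^sup>2 + T\<^sup>2 * A\<^sup>2))"
      proof -
        have "- pi * T * A\<^sup>2 + - pi * (of_int m + \<xi>)\<^sup>2 / T = - (pi / T) * ((of_int m + p * x + R * A)\<^sup>2 + T\<^sup>2 * A\<^sup>2)"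
          using T by (simp add: \<xi>_def field_simps power2_eq_square)
        then show ?thesis by (simp add: exp_add[symmetric])
      qed
      ultimately have "complex_of_real (exp (- pi * T * A\<^sup>2) * (exp (- pi * (of_int m + \<xi>)\<^sup>2 / T) / sqrt T)) * (exp (\<i> * of_real (- 2 * pi * p * A * y)) * fourier_char m (q * y)) =
         of_real (1 / sqrt T * exp (- (pi / T) * ((of_int m + p * x + R * A)\<^sup>2 + T\<^sup>2 * A\<^sup>2))) * 
         (exp (\<i> * of_real (- 2 * pi * p * q * x * y)) * exp (\<i> * of_real (2 * pi * y * (of_int m * q - p * of_int a))))"
        by (simp only:)
      then show ?thesis unfolding w_def theta2_dual_def A_def[symmetric] by (simp only: of_real_mult mult_ac)
    qed
    have "(\<Sum>\<^sub>\<infinity>b. theta2_term R T p q x y (a, b)) = w * (\<Sum>\<^sub>\<infinity>b. shifted_gauss T (- \<xi>) (of_int b + q * y))"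
      unfolding t by (rule infsum_cmult_right')
    also have "\<dots> = (\<Sum>\<^sub>\<infinity>m. w * (of_real (exp (- pi * (of_int m + \<xi>)\<^sup>2 / T) / sqrt T) * fourier_char m (q * y)))"
      unfolding poisson_gauss[OF T] by (rule infsum_cmult_right'[symmetric])
    also have "\<dots> = of_real (1 / sqrt T) * (exp (\<i> * of_real (- 2 * pi * p * q * x * y)) * (\<Sum>\<^sub>\<infinity>m. theta2_dual R T p q x y a m))"
      unfolding d by (simp only: infsum_cmult_right')
    finally show ?thesis .
  qed
  have "theta2 R T p q x y = (\<Sum>\<^sub>\<infinity>a. \<Sum>\<^sub>\<infinity>b. theta2_term R T p q x y (a, b))"
    unfolding theta2_def
    using infsum_Sigma_banach[of "theta2_term R T p q x y" UNIV "\<lambda>_. UNIV"] theta2_term_summable[OF T] by simp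
  also have "\<dots> = of_real (1 / sqrt T) * (exp (\<i> * of_real (- 2 * pi * p * q * x * y)) * (\<Sum>\<^sub>\<infinity>a. \<Sum>\<^sub>\<infinity>m. theta2_dual R T p q x y a m))"
    unfolding inner by (simp only: infsum_cmult_right')
  finally have "of_real (sqrt T) * theta2 R T p q x y = of_real (sqrt T * (1 / sqrt T)) * (exp (\<i> * of_real (- 2 * pi * p * q * x * y)) * (\<Sum>\<^sub>\<infinity>a. \<Sum>\<^sub>\<infinity>m. theta2_dual R T p q x y a m))"
    by (simp only: of_real_mult mult.assoc)
  moreover have "sqrt T * (1 / sqrt T) = 1" using T by simp
  ultimately show ?thesis by (simp only: of_real_1 mult_1_left)
qed

text \<open>With n = |tau|^2 the new parameters are those of -1/tau, and the charges (p, q) turn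
  into (q, -p). Since |M + tau A|^2 / T is invariant under the matching rotation of (A, M), the dual
  summands agree after replacing (a, m) by (m, -a). The phase comes from the prefactor exp(-2 pi i p
  q x y), whose exponent changes sign.\<close>

lemma theta2_S:
  fixes R T p q x y :: real
  assumes T: "T > 0"
  defines "n \<equiv> R\<^sup>2 + T\<^sup>2"
  shows "of_real (sqrt (T / n)) * theta2 (- R / n) (T / n) q (- p) x y =
    exp (\<i> * of_real (4 * pi * p * q * x * y)) * (of_real (sqrt T) * theta2 R T p q x y)"
proof -
  have n: "n > 0" using T by (simp add: n_def add_nonneg_pos)
  have dual: "theta2_dual (- R / n) (T / n) q (- p) x y a m = theta2_dual R T p q x y m (- a)" for a m
  proof -
    define A where "A = of_int m + q * x"
    define M where "M = - of_int a + p * x"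
    have "pi / (T / n) * ((A + (- R / n) * (- M))\<^sup>2 + (T / n)\<^sup>2 * (- M)\<^sup>2) = pi / T * ((M + R * A)\<^sup>2 + T\<^sup>2 * A\<^sup>2)"
    proof -
      have "n * ((A + (- R / n) * (- M))\<^sup>2 + (T / n)\<^sup>2 * (- M)\<^sup>2) = n * A\<^sup>2 + 2 * R * A * M + (R\<^sup>2 + T\<^sup>2) * M\<^sup>2 / n"
        using n by (simp add: power2_eq_square field_simps)
      also have "\<dots> = n * A\<^sup>2 + 2 * R * A * M + M\<^sup>2"
        using n unfolding n_def[symmetric] by simp
      also have "\<dots> = (M + R * A)\<^sup>2 + T\<^sup>2 * A\<^sup>2"
        by (simp add: n_def power2_eq_square algebra_simps)
      finally have "(A + (- R / n) * (- M))\<^sup>2 + (T / n)\<^sup>2 * (- M)\<^sup>2 = ((M + R * A)\<^sup>2 + T\<^sup>2 * A\<^sup>2) / n"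
        using n by (simp add: field_simps)
      then show ?thesis using n T by (simp add: field_simps)
    qed
    moreover have "of_int a + - p * x = - M" by (simp add: M_def)
    moreover have "of_int (- a) + p * x = M" by (simp add: M_def)
    moreover have "2 * pi * y * (of_int m * - p - q * of_int a) = 2 * pi * y * (of_int (- a) * q - p * of_int m)"
      by (simp add: algebra_simps)
    ultimately show ?thesis
      unfolding theta2_dual_def A_def[symmetric] mult_minus_left by (simp only:)
  qed
  have "(\<Sum>\<^sub>\<infinity>a. \<Sum>\<^sub>\<infinity>m. theta2_dual (- R / n) (T / n) q (- p) x y a m) = (\<Sum>\<^sub>\<infinity>a. \<Sum>\<^sub>\<infinity>m. theta2_dual R T p q x y m (- a))"
    unfolding dual ..
  also have "\<dots> = (\<Sum>\<^sub>\<infinity>a. \<Sum>\<^sub>\<infinity>m. theta2_dual R T p q x y m a)"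
    by (rule infsum_reindex_bij_witness[of _ uminus uminus]) auto
  also have "\<dots> = (\<Sum>\<^sub>\<infinity>m. \<Sum>\<^sub>\<infinity>a. theta2_dual R T p q x y m a)"
    by (rule infsum_swap_banach[OF theta2_dual_summable[OF T], symmetric])
  finally have D: "(\<Sum>\<^sub>\<infinity>a. \<Sum>\<^sub>\<infinity>m. theta2_dual (- R / n) (T / n) q (- p) x y a m) = (\<Sum>\<^sub>\<infinity>m. \<Sum>\<^sub>\<infinity>a. theta2_dual R T p q x y m a)" .
  have "T / n > 0" using T n by simp
  note P = theta2_poisson[OF this, of "- R / n" q "- p" x y] 
  have "exp (\<i> * of_real (- 2 * pi * q * (- p) * x * y)) = exp (\<i> * of_real (4 * pi * p * q * x * y)) * exp (\<i> * of_real (- 2 * pi * p * q * x * y))"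
    unfolding exp_add[symmetric] by (simp add: algebra_simps)
  then show ?thesis unfolding P theta2_poisson[OF T] D by (simp only: mult.assoc)
qed

section \<open>The theta function of signature (3,3)\<close>

definition theta6_term :: "real \<Rightarrow> real \<Rightarrow> real \<Rightarrow> real \<Rightarrow> (real \<times> real) \<times> (real \<times> real) \<times> (real \<times> real) \<Rightarrow>
    (int \<times> int) \<times> (int \<times> int) \<times> (int \<times> int) \<Rightarrow> complex" where
  "theta6_term R T p q = (\<lambda>((x1, y1), (x2, y2), (x3, y3)) (k1, k2, k3).
     theta2_term R T p q x1 y1 k1 * (theta2_term R T p q x2 y2 k2 * theta2_term R T p q x3 y3 k3))"

definition theta6 where
  "theta6 R T p q z = (\<Sum>\<^sub>\<infinity>k. theta6_term R T p q z k)"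

lemma theta6_product:
  assumes T: "T > 0"
  shows "theta6_term R T p q ((x1, y1), (x2, y2), (x3, y3)) summable_on UNIV"
   and "theta6 R T p q ((x1, y1), (x2, y2), (x3, y3)) = theta2 R T p q x1 y1 * (theta2 R T p q x2 y2 * theta2 R T p q x3 y3)"
proof -
  note s = theta2_term_summable[OF T]
  note 2 = summable_on_prod_complex[OF s[of R p q x2 y2] s[of R p q x3 y3]]
  note 3 = summable_on_prod_complex[OF s[of R p q x1 y1] 2(1)]
  have e: "(\<lambda>(k1, y). theta2_term R T p q x1 y1 k1 * (case y of (k2, k3) \<Rightarrow> theta2_term R T p q x2 y2 k2 * theta2_term R T p q x3 y3 k3)) = theta6_term R T p q ((x1, y1), (x2, y2), (x3, y3))"
    by (auto simp: theta6_term_def)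
  show "theta6_term R T p q ((x1, y1), (x2, y2), (x3, y3)) summable_on UNIV"
    using 3(1) unfolding e UNIV_Times_UNIV .
  show "theta6 R T p q ((x1, y1), (x2, y2), (x3, y3)) = theta2 R T p q x1 y1 * (theta2 R T p q x2 y2 * theta2 R T p q x3 y3)"
    using 3(2) unfolding e UNIV_Times_UNIV 2(2)[unfolded UNIV_Times_UNIV] by (simp add: theta6_def theta2_def)
qed

text \<open>The powers of square roots are kept on both sides because they are the same for all
  charges and cancel against the instance with charges zero.\<close>

lemma theta6_S:
  fixes R T p q :: real
  assumes T: "T > 0"
  defines "n \<equiv> R\<^sup>2 + T\<^sup>2"
  shows "of_real (sqrt (T / n) ^ 3) * theta6 (- R / n) (T / n) q (- p) ((x1, y1), (x2, y2), (x3, y3)) =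
    exp (\<i> * of_real (4 * pi * p * q * (x1 * y1 + x2 * y2 + x3 * y3))) * (of_real (sqrt T ^ 3) * theta6 R T p q ((x1, y1), (x2, y2), (x3, y3)))"
proof -
  have n: "T / n > 0" using T by (simp add: n_def add_nonneg_pos)
  have e: "exp (\<i> * of_real (4 * pi * p * q * (x1 * y1 + x2 * y2 + x3 * y3))) =
    exp (\<i> * of_real (4 * pi * p * q * x1 * y1)) * (exp (\<i> * of_real (4 * pi * p * q * x2 * y2)) * exp (\<i> * of_real (4 * pi * p * q * x3 * y3)))"
    unfolding exp_add[symmetric] by (simp add: algebra_simps)
  have prod3: "of_real (c ^ 3) * (a1 * (a2 * a3)) = (of_real c * a1) * ((of_real c * a2) * (of_real c * a3))" for c and a1 a2 a3 :: complex
    by (simp add: power3_eq_cube mult_ac)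
  show ?thesis
    unfolding theta6_product(2)[OF T] theta6_product(2)[OF n] prod3 e theta2_S[OF T, of R, folded n_def]
    by (simp only: mult_ac)
qed

section \<open>The field measures\<close>

definition uniform_angle :: "real measure" where
  "uniform_angle = uniform_measure lborel {- pi..<pi}"

lemma sets_uniform_angle [simp, measurable_cong]: "sets uniform_angle = sets borel"
  by (simp add: uniform_angle_def)

lemma space_uniform_angle [simp]: "space uniform_angle = UNIV"
  by (simp add: uniform_angle_def)

lemma prob_space_uniform_angle: "prob_space uniform_angle"
  unfolding uniform_angle_def by (rule prob_space_uniform_measure) simp_all

lemma field_measure_uniform_angle: "field_measure r = (\<Pi>\<^sub>M c\<in>cells r. uniform_angle)"
  by (simp add: field_measure_def uniform_angle_def)

lemma finite_cells: "finite (cells r :: (('n::finite) site \<times> dir list) set)"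
  by (simp add: cells_def finite_increasing_indices)

lemma prob_space_field_measure: "prob_space (field_measure r)"
  unfolding field_measure_uniform_angle by (intro prob_space_PiM prob_space_uniform_angle)

definition wrap :: "real \<Rightarrow> real" where
  "wrap t = t - 2 * pi * of_int \<lfloor>(t + pi) / (2 * pi)\<rfloor>"

lemma measurable_wrap [measurable]: "wrap \<in> borel_measurable borel"
  unfolding wrap_def by measurable

lemma wrap_eqI:
  assumes "- pi \<le> t - 2 * pi * of_int k" "t - 2 * pi * of_int k < pi"
  shows "wrap t = t - 2 * pi * of_int k"
proof -
  have "\<lfloor>(t + pi) / (2 * pi)\<rfloor> = k"
    by (rule floor_unique) (use assms in \<open>auto simp: field_simps\<close>)
  then show ?thesis by (simp add: wrap_def)
qed

text \<open>Rotation invariance on the circle. With the shift reduced to 0 <= d < 2 pi, the interval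
  splits into the points that stay inside and those that wrap around once; on each piece the map is
  a translation.\<close>

lemma wrap_uniform_angle:
  assumes A: "A \<in> sets borel"
  shows "emeasure uniform_angle ((\<lambda>t. wrap (t + c)) -` A) = emeasure uniform_angle A"
proof -
  define d where "d = c - 2 * pi * of_int \<lfloor>c / (2 * pi)\<rfloor>"
  have d: "0 \<le> d" "d < 2 * pi"
  proof -
    have "d = 2 * pi * frac (c / (2 * pi))" by (simp add: d_def frac_def right_diff_distrib)
    then show "0 \<le> d" "d < 2 * pi" by (simp_all add: frac_lt_1)
  qed
  have w: "wrap (t + c) = (if t + d < pi then t + d else t + d - 2 * pi)" if "t \<in> {- pi..<pi}" for t
  proof (cases "t + d < pi")
    case True
    then show ?thesis using that d wrap_eqI[of "t + c" "\<lfloor>c / (2 * pi)\<rfloor>"] by (simp add: d_def)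
  next
    case False
    then show ?thesis using that d wrap_eqI[of "t + c" "\<lfloor>c / (2 * pi)\<rfloor> + 1"] by (simp add: d_def algebra_simps)
  qed
  let ?I = "{- pi..<pi}"
  let ?B = "(\<lambda>t. wrap (t + c)) -` A"
  have B: "?B \<in> sets borel" using measurable_sets_borel[of "\<lambda>t. wrap (t + c)" borel A] A by simp
  have tr: "emeasure lborel ((\<lambda>t. e + t) -` S) = emeasure lborel S" if "S \<in> sets borel" for S and e :: real
  proof -
    have "emeasure lborel S = emeasure (distr lborel borel (\<lambda>t. e + t)) S"
      using lborel_distr_plus[of e] by simp
    also have "\<dots> = emeasure lborel ((\<lambda>t. e + t) -` S \<inter> space lborel)"
      using that by (intro emeasure_distr) auto
    finally show ?thesis by simp
  qed
  define S1 where "S1 = A \<inter> {- pi + d..<pi}"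
  define S2 where "S2 = A \<inter> {- pi..<- pi + d}"
  have S: "S1 \<in> sets borel" "S2 \<in> sets borel" "S1 \<inter> S2 = {}" "S1 \<union> S2 = ?I \<inter> A"
    using A d by (auto simp: S1_def S2_def)
  have "?I \<inter> ?B = ((\<lambda>t. d + t) -` S1) \<union> ((\<lambda>t. (d - 2 * pi) + t) -` S2)"
  proof -
    have wq: "wrap (t + c) = (if t + d < pi then d + t else (d - 2 * pi) + t)" if "t \<in> ?I" for t
      using w[OF that] by (simp add: algebra_simps)
    have "t \<in> ?I \<inter> ?B \<longleftrightarrow> t \<in> ?I \<and> (if t + d < pi then d + t \<in> A else (d - 2 * pi) + t \<in> A)" for t
      using wq[of t] by auto
    moreover have "t \<in> ((\<lambda>t. d + t) -` S1) \<union> ((\<lambda>t. (d - 2 * pi) + t) -` S2) \<longleftrightarrow> 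
        t \<in> ?I \<and> (if t + d < pi then d + t \<in> A else (d - 2 * pi) + t \<in> A)" for t
      using d by (auto simp: S1_def S2_def)
    ultimately show ?thesis by blast
  qed
  moreover have "((\<lambda>t. d + t) -` S1) \<inter> ((\<lambda>t. (d - 2 * pi) + t) -` S2) = {}"
    using d by (auto simp: S1_def S2_def)
  moreover have "(\<lambda>t. d + t) -` S1 \<in> sets lborel" "(\<lambda>t. (d - 2 * pi) + t) -` S2 \<in> sets lborel"
    using measurable_sets_borel[of "\<lambda>t. d + t" borel S1] measurable_sets_borel[of "\<lambda>t. (d - 2 * pi) + t" borel S2] S by simp_all
  ultimately have "emeasure lborel (?I \<inter> ?B) = emeasure lborel S1 + emeasure lborel S2"
    using tr S by (simp add: plus_emeasure[symmetric])
  also have "\<dots> = emeasure lborel (?I \<inter> A)"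
    using S by (simp add: plus_emeasure)
  finally show ?thesis
    using A B by (simp add: uniform_angle_def)
qed

text \<open>An integrand that is 2 pi-periodic in each component does not notice wrapping, and
  shifting followed by wrapping preserves the product measure. Periodicity is stated for functions
  restricted to the cells, since these are the points of the product space.\<close>

lemma integral_field_measure_shift:
  fixes \<Phi> :: "('n::finite site \<times> dir list \<Rightarrow> real) \<Rightarrow> complex"
  assumes meas: "\<Phi> \<in> borel_measurable (field_measure r)"
    and per: "\<And>a m. (\<And>c. m c \<in> \<int>) \<Longrightarrow> \<Phi> (\<lambda>c\<in>cells r. a c + 2 * pi * m c) = \<Phi> (restrict a (cells r))"
  shows "(\<integral>a. \<Phi> (\<lambda>c\<in>cells r. a c + s c) \<partial>field_measure r) = (\<integral>a. \<Phi> a \<partial>field_measure r)"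
proof -
  let ?M = "field_measure r :: ('n site \<times> dir list \<Rightarrow> real) measure"
  define \<tau> where "\<tau> = (\<lambda>a. \<lambda>c\<in>(cells r :: ('n site \<times> dir list) set). wrap (a c + s c))"
  interpret product_prob_space "\<lambda>_. uniform_angle" "cells r :: ('n site \<times> dir list) set"
    by (intro product_prob_spaceI prob_space_uniform_angle)
  have \<tau>[measurable]: "\<tau> \<in> measurable ?M ?M"
    unfolding \<tau>_def field_measure_uniform_angle by measurable
  have "distr ?M ?M \<tau> = ?M"
    unfolding field_measure_uniform_angle
  proof (rule PiM_eqI[OF finite_cells])
    show "sets (distr (Pi\<^sub>M (cells r) (\<lambda>c. uniform_angle)) (Pi\<^sub>M (cells r) (\<lambda>c. uniform_angle)) \<tau>) = sets (Pi\<^sub>M (cells r) (\<lambda>c. uniform_angle))" by simp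
    fix A :: "'n site \<times> dir list \<Rightarrow> real set" assume A: "\<And>c. c \<in> cells r \<Longrightarrow> A c \<in> sets uniform_angle"
    have "emeasure (distr (Pi\<^sub>M (cells r) (\<lambda>c. uniform_angle)) (Pi\<^sub>M (cells r) (\<lambda>c. uniform_angle)) \<tau>) (Pi\<^sub>E (cells r) A) = 
      emeasure (Pi\<^sub>M (cells r) (\<lambda>c. uniform_angle)) (\<tau> -` Pi\<^sub>E (cells r) A \<inter> space (Pi\<^sub>M (cells r) (\<lambda>c. uniform_angle)))"
      using \<tau>[unfolded field_measure_uniform_angle] A finite_cells by (intro emeasure_distr sets_PiM_I_finite) auto
    also have "\<tau> -` Pi\<^sub>E (cells r) A \<inter> space (Pi\<^sub>M (cells r) (\<lambda>c. uniform_angle)) = Pi\<^sub>E (cells r) (\<lambda>c. (\<lambda>t. wrap (t + s c)) -` A c)"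
      by (auto simp: \<tau>_def space_PiM PiE_iff extensional_def)
    also have "emeasure (Pi\<^sub>M (cells r) (\<lambda>c. uniform_angle)) \<dots> = (\<Prod>c\<in>cells r. emeasure uniform_angle ((\<lambda>t. wrap (t + s c)) -` A c))"
    proof (rule emeasure_PiM[OF finite_cells])
      fix c :: "'n site \<times> dir list" assume "c \<in> cells r"
      then show "(\<lambda>t. wrap (t + s c)) -` A c \<in> sets uniform_angle"
        using measurable_sets_borel[of "\<lambda>t. wrap (t + s c)" borel "A c"] A by simp
    qed
    also have "\<dots> = (\<Prod>c\<in>cells r. emeasure uniform_angle (A c))"
      using A by (intro prod.cong refl wrap_uniform_angle) simp
    finally show "emeasure (distr (Pi\<^sub>M (cells r) (\<lambda>c. uniform_angle)) (Pi\<^sub>M (cells r) (\<lambda>c. uniform_angle)) \<tau>) (Pi\<^sub>E (cells r) A) = (\<Prod>c\<in>cells r. emeasure uniform_angle (A c))" .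
  qed
  then have "(\<integral>a. \<Phi> a \<partial>?M) = (\<integral>a. \<Phi> a \<partial>distr ?M ?M \<tau>)" by simp
  also have "\<dots> = (\<integral>a. \<Phi> (\<tau> a) \<partial>?M)"
    by (rule integral_distr[OF \<tau> meas])
  also have "\<dots> = (\<integral>a. \<Phi> (\<lambda>c\<in>cells r. a c + s c) \<partial>?M)"
  proof (intro Bochner_Integration.integral_cong refl)
    fix a
    have "\<tau> a = (\<lambda>c\<in>cells r. (a c + s c) + 2 * pi * (- of_int \<lfloor>(a c + s c + pi) / (2 * pi)\<rfloor>))"
      by (auto simp: \<tau>_def wrap_def)
    then show "\<Phi> (\<tau> a) = \<Phi> (\<lambda>c\<in>cells r. a c + s c)"
      using per[of "\<lambda>c. - of_int \<lfloor>(a c + s c + pi) / (2 * pi)\<rfloor>" "\<lambda>c. a c + s c"] by simp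
  qed
  finally show ?thesis by simp
qed

text \<open>Rotating by pi/k multiplies the character by -1 when the integer \<open>k\<close> is
  nonzero, so the integral equals its own negative.\<close>

lemma integral_uniform_angle_character:
  assumes "k \<in> \<int>"
  shows "(\<integral>t. exp (\<i> * of_real (t * k)) \<partial>uniform_angle) = (if k = 0 then 1 else 0)"
    and "integrable uniform_angle (\<lambda>t. exp (\<i> * of_real (t * k)))"
proof -
  interpret prob_space uniform_angle by (rule prob_space_uniform_angle)
  show int: "integrable uniform_angle (\<lambda>t. exp (\<i> * of_real (t * k)))"
    by (rule integrable_const_bound[where B = 1]) (auto simp del: of_real_mult)
  show "(\<integral>t. exp (\<i> * of_real (t * k)) \<partial>uniform_angle) = (if k = 0 then 1 else 0)"
  proof (cases "k = 0")
    case True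
    then show ?thesis using prob_space by simp
  next
    case False
    obtain m where m: "k = of_int m" using assms by (auto elim: Ints_cases)
    have "(\<integral>t. exp (\<i> * of_real (t * k)) \<partial>uniform_angle) = (\<integral>t. exp (\<i> * of_real (wrap (t + pi / k) * k)) \<partial>uniform_angle)"
    proof -
      have "distr uniform_angle uniform_angle (\<lambda>t. wrap (t + pi / k)) = uniform_angle"
      proof (rule measure_eqI)
        fix A assume "A \<in> sets (distr uniform_angle uniform_angle (\<lambda>t. wrap (t + pi / k)))"
        then show "emeasure (distr uniform_angle uniform_angle (\<lambda>t. wrap (t + pi / k))) A = emeasure uniform_angle A"
          using wrap_uniform_angle[of A "pi / k"] by (subst emeasure_distr) auto
      qed simp
      then have "(\<integral>t. exp (\<i> * of_real (t * k)) \<partial>uniform_angle) = (\<integral>t. exp (\<i> * of_real (t * k)) \<partial>distr uniform_angle uniform_angle (\<lambda>t. wrap (t + pi / k)))" by simp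
      also have "\<dots> = (\<integral>t. exp (\<i> * of_real (wrap (t + pi / k) * k)) \<partial>uniform_angle)"
        by (rule integral_distr) auto
      finally show ?thesis .
    qed
    also have "\<dots> = (\<integral>t. - exp (\<i> * of_real (t * k)) \<partial>uniform_angle)"
    proof (intro Bochner_Integration.integral_cong refl)
      fix t
      define j where "j = \<lfloor>(t + pi / k + pi) / (2 * pi)\<rfloor>"
      have w: "wrap (t + pi / k) = t + pi / k - 2 * pi * of_int j" by (simp add: wrap_def j_def)
      \<comment> \<open>Wrapping removes a multiple \<open>j\<close> of 2 pi from the angle; as
        \<open>k\<close> is the integer \<open>m\<close>, the phase changes by a multiple of 2
        pi.\<close>
      have wk: "wrap (t + pi / k) * k = t * k + pi - 2 * of_int (j * m) * pi"
        unfolding w using False by (simp add: left_diff_distrib distrib_right) (simp add: m)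
      have "\<i> * of_real (wrap (t + pi / k) * k) = \<i> * of_real (t * k) + \<i> * of_real pi - complex_of_real (2 * of_int (j * m) * pi) * \<i>"
        unfolding wk by (simp add: algebra_simps)
      then have "exp (\<i> * of_real (wrap (t + pi / k) * k)) = exp (\<i> * of_real (t * k)) * exp (\<i> * of_real pi) / exp (complex_of_real (2 * of_int (j * m) * pi) * \<i>)"
        by (simp only: exp_add exp_diff)
      moreover have "exp (complex_of_real (2 * of_int (j * m) * pi) * \<i>) = 1"
        by (rule exp_integer_2pi) simp
      moreover have "exp (\<i> * of_real pi) = (-1 :: complex)" by (simp add: mult.commute)
      ultimately show "exp (\<i> * of_real (wrap (t + pi / k) * k)) = - exp (\<i> * of_real (t * k))" by simp
    qed
    finally have "(\<integral>t. exp (\<i> * of_real (t * k)) \<partial>uniform_angle) = - (\<integral>t. exp (\<i> * of_real (t * k)) \<partial>uniform_angle)" by simp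
    then show ?thesis using False by (simp add: eq_neg_iff_add_eq_0 flip: mult_2)
  qed
qed

lemma integral_field_character:
  fixes k :: "'n::finite site \<times> dir list \<Rightarrow> real"
  assumes k: "\<And>c. k c \<in> \<int>"
  shows "(\<integral>a. exp (\<i> * of_real (\<Sum>c\<in>cells r. a c * k c)) \<partial>field_measure r) = (if \<forall>c\<in>cells r. k c = 0 then 1 else 0)"
proof -
  interpret product_prob_space "\<lambda>_. uniform_angle" "cells r :: ('n site \<times> dir list) set"
    by (intro product_prob_spaceI prob_space_uniform_angle)
  have "(\<integral>a. exp (\<i> * of_real (\<Sum>c\<in>cells r. a c * k c)) \<partial>field_measure r) =
    (\<integral>a. (\<Prod>c\<in>cells r. exp (\<i> * of_real (a c * k c))) \<partial>(\<Pi>\<^sub>M c\<in>cells r. uniform_angle))"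
    unfolding field_measure_uniform_angle exp_sum[OF finite_cells, symmetric] of_real_sum sum_distrib_left ..
  also have "\<dots> = (\<Prod>c\<in>cells r. \<integral>t. exp (\<i> * of_real (t * k c)) \<partial>uniform_angle)"
    using integral_uniform_angle_character(2)[OF k] by (intro product_integral_prod finite_cells) auto
  also have "\<dots> = (\<Prod>c\<in>cells r. if k c = 0 then 1 else 0)"
    unfolding integral_uniform_angle_character(1)[OF k] ..
  also have "\<dots> = (if \<forall>c\<in>cells r. k c = 0 then 1 else 0)"
    using finite_cells[of r, where 'n='n] by (auto intro!: prod.neutral)
  finally show ?thesis .
qed

lemma AE_field_measure: "AE a in field_measure r. \<forall>c\<in>cells r. \<bar>a c\<bar> \<le> pi"
proof -
  have u: "AE t in uniform_angle. \<bar>t\<bar> \<le> pi"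
    unfolding uniform_angle_def by (rule AE_uniform_measureI) (auto simp: abs_le_iff)
  show ?thesis
    unfolding field_measure_uniform_angle
    by (intro AE_finite_allI[OF finite_cells] AE_PiM_component[where P = "\<lambda>t. \<bar>t\<bar> \<le> pi"] prob_space_uniform_angle u)
qed

section \<open>Field configurations\<close>

lemma index_sign_increasing: "sorted_wrt (<) L \<Longrightarrow> index_sign L = 1"
proof (induction L)
  case (Cons a L)
  then have "filter (\<lambda>b. b < a) L = []" by (auto simp: filter_empty_conv)
  with Cons show ?case by (auto simp: index_sign_Cons)
qed simp

lemma form_of_increasing:
  assumes "L \<in> increasing_indices r"
  shows "form_of r a x L = a (x, L)"
proof -
  have "sorted_wrt (<) L" "length L = r" using assms by (auto simp: increasing_indices_def)
  moreover then have "sort L = L" by (intro sorted_sort_id) (simp add: strict_sorted_iff)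
  ultimately show ?thesis by (simp add: form_of_def index_sign_increasing)
qed

lemma form_of_1 [simp]: "form_of 1 a x [\<mu>] = a (x, [\<mu>])"
  by (rule form_of_increasing) (simp add: increasing_indices_def)

lemma form_of_1_forms: "form_of 1 a \<in> forms 1"
  unfolding forms_1_iff by (simp add: form_of_def)

lemma form_of_3_forms: "form_of 3 a \<in> forms 3"
proof -
  have 1: "index_sign [q,p,r] = - index_sign [p,q,r]" for p q r
    by (cases "p < q"; cases "q < p") (auto simp: index_sign_Cons)
  have 2: "index_sign [p,r,q] = - index_sign [p,q,r]" for p q r
    by (cases "q < r"; cases "r < q") (auto simp: index_sign_Cons)
  have st: "sort xs = sort ys" if "mset xs = mset ys" for xs ys :: "dir list"
    by (rule properties_for_sort) (simp_all add: that)
  have 3: "sort [q,p,r] = sort [p,q,r]" "sort [p,r,q] = sort [p,q,r]" for p q r :: dir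
    by (rule st, simp add: add_mset_commute)+
  have "form_of 3 a x [q,p,r] = - form_of 3 a x [p,q,r]" "form_of 3 a x [p,r,q] = - form_of 3 a x [p,q,r]" for x p q r
    unfolding form_of_def 3(1)[of q p r] 3(2)[of p r q] 1[of q p r] 2[of p r q] by simp_all
  moreover have "form_of 3 a x L = 0" if "length L \<noteq> 3" for x L using that by (simp add: form_of_def)
  ultimately show ?thesis unfolding forms_3_iff by blast
qed

lemma form_dot_form_of:
  "form_dot r (form_of r a) \<beta> = (\<Sum>c\<in>cells r. a c * \<beta> (fst c) (snd c))"
proof -
  have "form_dot r (form_of r a) \<beta> = (\<Sum>x\<in>UNIV. \<Sum>L\<in>increasing_indices r. a (x, L) * \<beta> x L)"
    unfolding form_dot_def by (intro sum.cong refl) (simp add: form_of_increasing)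
  then show ?thesis unfolding cells_def sum.cartesian_product by (simp add: case_prod_unfold)
qed

lemma measurable_form_of [measurable]:
  "(\<lambda>a. form_of r a x L) \<in> borel_measurable (field_measure r)"
proof (cases "length L = r \<and> distinct L")
  case True
  then have "(x, sort L) \<in> cells r" by (simp add: cells_def increasing_indices_def strict_sorted_iff)
  then have "(\<lambda>a. a (x, sort L)) \<in> measurable (field_measure r) uniform_angle"
    unfolding field_measure_uniform_angle by (rule measurable_component_singleton)
  then have [measurable]: "(\<lambda>a. a (x, sort L)) \<in> borel_measurable (field_measure r)"
    by (simp cong: measurable_cong_sets)
  show ?thesis unfolding form_of_def by measurable
next
  case False
  then have "(\<lambda>a. form_of r a x L) = (\<lambda>_. 0)" by (auto simp: form_of_def index_sign_def)
  then show ?thesis by simp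
qed

lemma measurable_ext_d:
  assumes [measurable]: "\<And>x L. (\<lambda>a. f a x L) \<in> borel_measurable M"
  shows "(\<lambda>a. ext_d (f a) x L) \<in> borel_measurable M"
  unfolding ext_d_def by measurable

lemma measurable_field_strength [measurable]:
  "(\<lambda>a. field_strength (form_of 1 a) n x L) \<in> borel_measurable (field_measure 1)"
proof -
  have [measurable]: "(\<lambda>a. ext_d (form_of 1 a) x L) \<in> borel_measurable (field_measure 1)"
    by (rule measurable_ext_d) measurable
  show ?thesis unfolding field_strength_def by measurable
qed

lemma measurable_form_dot:
  assumes [measurable]: "\<And>x L. (\<lambda>a. f a x L) \<in> borel_measurable M" "\<And>x L. (\<lambda>a. g a x L) \<in> borel_measurable M"
  shows "(\<lambda>a. form_dot r (f a) (g a)) \<in> borel_measurable M"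
  unfolding form_dot_def by measurable

lemma measurable_cup:
  assumes [measurable]: "\<And>x L. (\<lambda>a. f a x L) \<in> borel_measurable M" "\<And>x L. (\<lambda>a. g a x L) \<in> borel_measurable M"
  shows "(\<lambda>a. cup r t (f a) (g a) x L) \<in> borel_measurable M"
  unfolding cup_def by measurable

lemma measurable_cup1:
  assumes [measurable]: "\<And>x L. (\<lambda>a. f a x L) \<in> borel_measurable M" "\<And>x L. (\<lambda>a. g a x L) \<in> borel_measurable M"
  shows "(\<lambda>a. cup1 r t (f a) (g a) x L) \<in> borel_measurable M"
proof -
  have [measurable]: "(\<lambda>a. cup (r - 1) (t - 1) (reflect \<mu> (contract \<mu> (f a))) (reflect \<mu> (contract \<mu> (g a))) x L) \<in> borel_measurable M" for \<mu> x L
    by (rule measurable_cup; unfold reflect_def contract_def Let_def; measurable)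
  show ?thesis unfolding cup1_def reflect_def[of _ "cup _ _ _ _"] Let_def by measurable
qed

lemma measurable_top_charge:
  "(\<lambda>a. top_charge (field_strength (form_of 1 a) n) n) \<in> borel_measurable (field_measure 1)"
proof -
  have [measurable]: "(\<lambda>a. cup 2 2 (field_strength (form_of 1 a) n) (field_strength (form_of 1 a) n) x L) \<in> borel_measurable (field_measure 1)" for x L
    by (rule measurable_cup) measurable
  have [measurable]: "(\<lambda>a. cup1 2 3 (field_strength (form_of 1 a) n) (ext_d n) x L) \<in> borel_measurable (field_measure 1)" for x L
    by (rule measurable_cup1) measurable
  show ?thesis unfolding top_charge_def sum4_def by measurable
qed

lemma field_strength_lin: "field_strength A n = lin 1 (ext_d A) (2 * pi) n"
  by (simp add: field_strength_def lin_def)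

lemma field_strength_forms: "A \<in> forms 1 \<Longrightarrow> n \<in> forms 2 \<Longrightarrow> field_strength A n \<in> forms 2"
  unfolding field_strength_lin by (intro lin_forms ext_d_forms_2)

section \<open>Gaussian bounds\<close>

text \<open>Coordinates of an integer 2-form as an integer-valued function on finitely many cells.
  They give countability of \<open>int_forms 2\<close> and factorise Gaussian sums over it into sums
  over the integers.\<close>

definition cell_ints :: "('n::finite) form \<Rightarrow> 'n site \<times> dir list \<Rightarrow> int" where
  "cell_ints n = (\<lambda>c\<in>cells 2. \<lfloor>n (fst c) (snd c)\<rfloor>)"

lemma form_dot_cells: "form_dot 2 \<alpha> \<alpha> = (\<Sum>c\<in>cells 2. (\<alpha> (fst c) (snd c))\<^sup>2)"
  unfolding form_dot_def cells_def sum.cartesian_product by (simp add: case_prod_unfold power2_eq_square)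

lemma cell_ints:
  assumes "n \<in> int_forms 2" "c \<in> cells 2"
  shows "of_int (cell_ints n c) = n (fst c) (snd c)"
proof -
  have "n (fst c) (snd c) \<in> \<int>" using assms(1) by (simp add: int_forms_def)
  then show ?thesis using assms(2) by (auto simp: cell_ints_def elim: Ints_cases)
qed

lemma inj_cell_ints: "inj_on cell_ints (int_forms 2 :: ('n::finite) form set)"
proof (rule inj_onI)
  fix n m :: "'n form" assume nm: "n \<in> int_forms 2" "m \<in> int_forms 2" "cell_ints n = cell_ints m"
  have "n x L = m x L" if "L \<in> increasing_indices 2" for x L
    using cell_ints[OF nm(1), of "(x, L)"] cell_ints[OF nm(2), of "(x, L)"] nm(3) that by (simp add: cells_def)
  then have "lin 1 n (-1) m x L = 0" if "L \<in> increasing_indices 2" for x L using that by (simp add: lin_def)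
  then have "lin 1 n (-1) m x L = 0" for x L
    using forms_2_vanish[OF lin_forms[OF int_forms_forms[OF nm(1)] int_forms_forms[OF nm(2)]]] by blast
  then have "n x L - m x L = 0" for x L by (simp add: lin_def)
  then have "n x L = m x L" for x L by (metis eq_iff_diff_eq_0)
  then show "n = m" by (intro ext)
qed

lemma cell_ints_PiE: "cell_ints n \<in> PiE (cells 2) (\<lambda>_. UNIV)"
  by (simp add: cell_ints_def)

lemma countable_int_forms: "countable (int_forms 2 :: ('n::finite) form set)"
proof -
  have "cell_ints ` (int_forms 2 :: 'n form set) \<subseteq> PiE (cells 2) (\<lambda>_. UNIV)" using cell_ints_PiE by blast
  moreover have "countable (PiE (cells 2 :: ('n site \<times> dir list) set) (\<lambda>_. UNIV :: int set))"
    by (intro countable_PiE finite_cells) auto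
  ultimately have "countable (cell_ints ` (int_forms 2 :: 'n form set))" by (rule countable_subset)
  then show ?thesis using inj_cell_ints by (rule countable_image_inj_on)
qed

lemma summable_gauss_forms:
  assumes c: "c > 0"
  shows "(\<lambda>n. exp (- c * form_dot 2 n n)) summable_on (int_forms 2 :: ('n::finite) form set)"
proof -
  have 1: "Infinite_Set_Sum.abs_summable_on (\<lambda>k::int. exp (- c * (of_int k)\<^sup>2)) UNIV"
    unfolding abs_summable_equivalent[symmetric] using summable_gauss_int[OF c] by simp
  have "Infinite_Set_Sum.abs_summable_on (\<lambda>g. \<Prod>d\<in>cells 2. exp (- c * (of_int (g d))\<^sup>2)) (PiE (cells 2 :: ('n site \<times> dir list) set) (\<lambda>_. UNIV :: int set))"
    by (rule abs_summable_on_prod_PiE[OF finite_cells]) (use 1 in auto)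
  then have "(\<lambda>g. \<Prod>d\<in>cells 2. exp (- c * (of_int (g d))\<^sup>2)) summable_on (PiE (cells 2 :: ('n site \<times> dir list) set) (\<lambda>_. UNIV :: int set))"
    unfolding abs_summable_equivalent[symmetric] by (rule abs_summable_summable)
  then have "(\<lambda>g. \<Prod>d\<in>cells 2. exp (- c * (of_int (g d))\<^sup>2)) summable_on cell_ints ` (int_forms 2 :: 'n form set)"
    by (rule summable_on_subset_banach) (use cell_ints_PiE in blast)
  then have "(\<lambda>n. \<Prod>d\<in>cells 2. exp (- c * (of_int (cell_ints n d))\<^sup>2)) summable_on (int_forms 2 :: 'n form set)"
    by (subst (asm) summable_on_reindex[OF inj_cell_ints]) (simp add: o_def)
  moreover have "(\<Prod>d\<in>cells 2. exp (- c * (of_int (cell_ints n d))\<^sup>2)) = exp (- c * form_dot 2 n n)"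
    if "n \<in> int_forms 2" for n :: "'n form"
    using cell_ints[OF that] by (simp add: exp_sum[OF finite_cells, symmetric] form_dot_cells sum_distrib_left sum_negf[symmetric] del: sum_negf)
  ultimately show ?thesis by (simp cong: summable_on_cong)
qed

text \<open>Crude bound for the squared norm of dA when all links lie in [-pi, pi]: each plaquette
  involves four links.\<close>

definition box_const :: "('n::finite) itself \<Rightarrow> real" where
  "box_const _ = real (card (cells 2 :: ('n site \<times> dir list) set)) * (4 * pi)\<^sup>2"

text \<open>Expanding 0 <= 2 |dA + pi n|^2 gives 2 pi^2 |n|^2 - |dA|^2 <= |dA + 2 pi n|^2, and
  |dA|^2 is bounded on the box. This is the decay in \<open>n\<close> behind all convergence
  statements below.\<close>

lemma gauss_box_bound:
  fixes n :: "('n::finite) form"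
  assumes a: "\<forall>c\<in>cells 1. \<bar>a c\<bar> \<le> pi" and c: "c \<ge> 0"
  shows "form_dot 2 (ext_d (form_of 1 a :: 'n form)) (ext_d (form_of 1 a)) \<le> box_const TYPE('n)"
    and "exp (- c * form_dot 2 (field_strength (form_of 1 a) n) (field_strength (form_of 1 a) n))
      \<le> exp (c * box_const TYPE('n)) * exp (- (2 * pi\<^sup>2 * c) * form_dot 2 n n)"
proof -
  let ?d = "ext_d (form_of 1 a) :: 'n form"
  have ab: "\<bar>a (x, [\<mu>])\<bar> \<le> pi" for x \<mu> using a by (simp add: cells_def increasing_indices_def)
  have "\<bar>?d x [\<mu>,\<nu>]\<bar> \<le> 4 * pi" for x \<mu> \<nu>
    unfolding ext_d_2 form_of_1 using ab[of "x + hat \<mu>" \<nu>] ab[of x \<nu>] ab[of "x + hat \<nu>" \<mu>] ab[of x \<mu>] by linarith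
  then have "\<bar>?d (fst c) (snd c)\<bar> \<le> 4 * pi" if "c \<in> cells 2" for c :: "'n site \<times> dir list"
    using that by (auto simp: cells_def increasing_indices_2)
  then have "(?d (fst c) (snd c))\<^sup>2 \<le> (4 * pi)\<^sup>2" if "c \<in> cells 2" for c :: "'n site \<times> dir list"
    using that power_mono[of "\<bar>?d (fst c) (snd c)\<bar>" "4 * pi" 2] by simp
  then show d: "form_dot 2 ?d ?d \<le> box_const TYPE('n)"
    unfolding form_dot_cells box_const_def by (rule sum_bounded_above)
  have "2 * pi\<^sup>2 * form_dot 2 n n - form_dot 2 ?d ?d \<le> form_dot 2 (field_strength (form_of 1 a) n) (field_strength (form_of 1 a) n)"
  proof -
    have "0 \<le> 2 * form_dot 2 (lin 1 ?d pi n) (lin 1 ?d pi n)" using form_dot_nonneg by simp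
    then show ?thesis
      unfolding field_strength_lin form_dot_lin_left form_dot_lin_right form_dot_commute[of 2 n ?d]
      by (simp add: power2_eq_square algebra_simps)
  qed
  then have "2 * pi\<^sup>2 * form_dot 2 n n - box_const TYPE('n) \<le> form_dot 2 (field_strength (form_of 1 a) n) (field_strength (form_of 1 a) n)"
    using d by linarith
  from mult_left_mono[OF this c]
  show "exp (- c * form_dot 2 (field_strength (form_of 1 a) n) (field_strength (form_of 1 a) n))
      \<le> exp (c * box_const TYPE('n)) * exp (- (2 * pi\<^sup>2 * c) * form_dot 2 n n)"
    unfolding exp_add[symmetric] exp_le_cancel_iff by (simp add: algebra_simps)
qed

text \<open>The first two conditions are those under which all sums and integrals below converge.\<close>

definition gaussian :: "(('n::finite) form \<Rightarrow> complex) \<Rightarrow> bool" where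
  "gaussian g \<longleftrightarrow> (\<exists>c>0. \<exists>C\<ge>0. \<forall>F\<in>forms 2. norm (g F) \<le> C * exp (- c * form_dot 2 F F)) \<and>
     (\<forall>n\<in>forms 2. (\<lambda>a. g (field_strength (form_of 1 a) n)) \<in> borel_measurable (field_measure 1))"

text \<open>Average of a functional over the compact angles and over the integer 2-forms in
  \<open>S\<close>. The functional sees only the field strength, so a shift of the angles by
  multiples of 2 pi can be traded for a shift inside \<open>S\<close>.\<close>

definition villain :: "('n::finite) form set \<Rightarrow> ('n form \<Rightarrow> complex) \<Rightarrow> complex" where
  "villain S g = (\<Sum>\<^sub>\<infinity>n\<in>S. \<integral>a. g (field_strength (form_of 1 a) n) \<partial>field_measure 1)"

lemma field_integral_bound:
  fixes g :: "('n::finite site \<times> dir list \<Rightarrow> real) \<Rightarrow> 'n form \<Rightarrow> complex"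
  assumes c: "c > 0" "C \<ge> 0" and n: "n \<in> int_forms 2"
    and bound: "\<And>a. norm (g a n) \<le> C * exp (- c * form_dot 2 (field_strength (form_of 1 a) n) (field_strength (form_of 1 a) n))"
    and meas: "(\<lambda>a. g a n) \<in> borel_measurable (field_measure 1)"
  shows "integrable (field_measure 1) (\<lambda>a. g a n)"
    "(\<integral>a. norm (g a n) \<partial>field_measure 1) \<le> C * exp (c * box_const TYPE('n)) * exp (- (2 * pi\<^sup>2 * c) * form_dot 2 n n)"
proof -
  interpret prob_space "field_measure 1 :: ('n site \<times> dir list \<Rightarrow> real) measure" by (rule prob_space_field_measure)
  let ?B = "C * exp (c * box_const TYPE('n)) * exp (- (2 * pi\<^sup>2 * c) * form_dot 2 n n)"
  have AE: "AE a in field_measure 1. norm (g a n) \<le> ?B"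
    using AE_field_measure
  proof eventually_elim
    case (elim a)
    have "norm (g a n) \<le> C * (exp (c * box_const TYPE('n)) * exp (- (2 * pi\<^sup>2 * c) * form_dot 2 n n))"
      using gauss_box_bound(2)[OF elim, of c n] c by (intro order_trans[OF bound] mult_left_mono) auto
    then show ?case by simp
  qed
  show int: "integrable (field_measure 1) (\<lambda>a. g a n)"
    using AE meas by (rule integrable_const_bound)
  have "(\<integral>a. norm (g a n) \<partial>field_measure 1) \<le> (\<integral>a. ?B \<partial>(field_measure 1 :: ('n site \<times> dir list \<Rightarrow> real) measure))"
    by (rule integral_mono_AE) (use int AE in \<open>simp_all del: One_nat_def\<close>)
  then show "(\<integral>a. norm (g a n) \<partial>field_measure 1) \<le> ?B" by (simp add: prob_space del: One_nat_def)
qed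

lemma villain_sums:
  fixes S :: "('n::finite) form set"
  assumes S: "S \<subseteq> int_forms 2" and g: "gaussian g"
  defines "f \<equiv> \<lambda>n a. g (field_strength (form_of 1 a) n)"
  shows "\<And>n. n \<in> S \<Longrightarrow> integrable (field_measure 1) (f n)"
    "(\<lambda>n. \<integral>a. norm (f n a) \<partial>field_measure 1) summable_on S"
    "(\<lambda>n. \<integral>a. f n a \<partial>field_measure 1) summable_on S"
    "integrable (field_measure 1) (\<lambda>a. \<Sum>\<^sub>\<infinity>n\<in>S. f n a)"
    "villain S g = (\<integral>a. (\<Sum>\<^sub>\<infinity>n\<in>S. f n a) \<partial>field_measure 1)"
    "integrable (count_space S \<Otimes>\<^sub>M field_measure 1) (\<lambda>(n, a). f n a)"
proof -
  obtain c C where c: "c > 0" "C \<ge> 0" and bound: "\<And>F. F \<in> forms 2 \<Longrightarrow> norm (g F) \<le> C * exp (- c * form_dot 2 F F)"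
    and meas: "\<And>n. n \<in> forms 2 \<Longrightarrow> (\<lambda>a. g (field_strength (form_of 1 a) n)) \<in> borel_measurable (field_measure 1)"
    using g unfolding gaussian_def by blast
  have n2: "n \<in> forms 2" if "n \<in> S" for n using that S int_forms_forms by blast
  note fb = field_integral_bound[OF c, of _ "\<lambda>a n. g (field_strength (form_of 1 a) n)"]
  have 1: "integrable (field_measure 1) (f n)"
    and 2: "(\<integral>a. norm (f n a) \<partial>field_measure 1) \<le> C * exp (c * box_const TYPE('n)) * exp (- (2 * pi\<^sup>2 * c) * form_dot 2 n n)"
    if "n \<in> S" for n
    unfolding f_def using that S n2[OF that] field_strength_forms[OF form_of_1_forms n2[OF that]]
    by (intro fb bound meas; blast)+
  show "integrable (field_measure 1) (f n)" if "n \<in> S" for n using 1[OF that] .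
  show s: "(\<lambda>n. \<integral>a. norm (f n a) \<partial>field_measure 1) summable_on S"
  proof (rule summable_on_comparison_test)
    have "(\<lambda>n. C * exp (c * box_const TYPE('n)) * exp (- (2 * pi\<^sup>2 * c) * form_dot 2 n n)) summable_on (int_forms 2 :: 'n form set)"
      using c by (intro summable_on_cmult_right summable_gauss_forms) auto
    then show "(\<lambda>n. C * exp (c * box_const TYPE('n)) * exp (- (2 * pi\<^sup>2 * c) * form_dot 2 n n)) summable_on S"
      using S by (rule summable_on_subset_banach)
  qed (use 2 in \<open>auto intro!: integral_nonneg_AE\<close>)
  interpret prob_space "field_measure 1 :: ('n site \<times> dir list \<Rightarrow> real) measure" by (rule prob_space_field_measure)
  have "sigma_finite_measure (field_measure 1 :: ('n site \<times> dir list \<Rightarrow> real) measure)" ..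
  moreover have "countable S" using S countable_int_forms countable_subset by blast
  ultimately show "(\<lambda>n. \<integral>a. f n a \<partial>field_measure 1) summable_on S"
    "integrable (field_measure 1) (\<lambda>a. \<Sum>\<^sub>\<infinity>n\<in>S. f n a)"
    "villain S g = (\<integral>a. (\<Sum>\<^sub>\<infinity>n\<in>S. f n a) \<partial>field_measure 1)"
    "integrable (count_space S \<Otimes>\<^sub>M field_measure 1) (\<lambda>(n, a). f n a)"
    using integral_infsum[of "field_measure 1" S f, OF _ _ 1 s] by (simp_all add: villain_def f_def)
qed

section \<open>Translation invariance\<close>

lemma gaussian_shift:
  assumes g: "gaussian g" and e: "e \<in> forms 2"
  shows "gaussian (\<lambda>F. g (lin 1 F 1 e))"
proof -
  obtain c C where c: "c > 0" "C \<ge> 0" and bound: "\<And>F. F \<in> forms 2 \<Longrightarrow> norm (g F) \<le> C * exp (- c * form_dot 2 F F)"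
    and meas: "\<And>n. n \<in> forms 2 \<Longrightarrow> (\<lambda>a. g (field_strength (form_of 1 a) n)) \<in> borel_measurable (field_measure 1)"
    using g unfolding gaussian_def by blast
  have "norm (g (lin 1 F 1 e)) \<le> (C * exp (c * form_dot 2 e e)) * exp (- (c / 2) * form_dot 2 F F)" if F: "F \<in> forms 2" for F
  proof -
    \<comment> \<open>Half of |F + 2e|^2 is the slack in |F + e|^2 >= |F|^2 / 2 - |e|^2, so half of
      the decay rate survives the shift.\<close>
    have "0 \<le> form_dot 2 (lin 1 F 2 e) (lin 1 F 2 e)" by (rule form_dot_nonneg)
    then have "form_dot 2 F F / 2 - form_dot 2 e e \<le> form_dot 2 (lin 1 F 1 e) (lin 1 F 1 e)"
      unfolding form_dot_lin_left form_dot_lin_right form_dot_commute[of 2 e F] by simp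
    from mult_left_mono[OF this, of c] c(1)
    have "exp (- c * form_dot 2 (lin 1 F 1 e) (lin 1 F 1 e)) \<le> exp (c * form_dot 2 e e) * exp (- (c / 2) * form_dot 2 F F)"
      unfolding exp_add[symmetric] exp_le_cancel_iff by (simp add: algebra_simps)
    from mult_left_mono[OF this c(2)] bound[OF lin_forms[OF F e, of 1 1]]
    show ?thesis by simp
  qed
  moreover have "(\<lambda>a. g (lin 1 (field_strength (form_of 1 a) n) 1 e)) \<in> borel_measurable (field_measure 1)" if n: "n \<in> forms 2" for n
  proof -
    \<comment> \<open>A real shift of the field strength is a shift of \<open>n\<close> by e/(2 pi),
      which leaves the integer forms; this is why \<open>gaussian\<close> demands measurability for
      all real 2-forms \<open>n\<close>.\<close>
    have "lin 1 (field_strength A n) 1 e = field_strength A (lin 1 n (1 / (2 * pi)) e)" for A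
      by (intro ext) (simp add: field_strength_lin lin_def algebra_simps)
    then show ?thesis using meas[OF lin_forms[OF n e]] by simp
  qed
  moreover have "c / 2 > 0" "C * exp (c * form_dot 2 e e) \<ge> 0" using c by auto
  ultimately show ?thesis unfolding gaussian_def by blast
qed

lemma form_of_1_restrict: "form_of 1 (restrict a (cells 1)) = form_of 1 a"
proof (intro ext)
  fix x L
  show "form_of 1 (restrict a (cells 1)) x L = form_of 1 a x L"
  proof (cases "length L = 1")
    case True
    then obtain \<mu> where "L = [\<mu>]" by (auto simp: length_Suc_conv)
    then show ?thesis unfolding form_of_1 by (simp add: form_of_1 cells_def increasing_indices_def del: One_nat_def)
  qed (simp add: form_of_def)
qed

lemma form_of_1_add:
  assumes b: "b \<in> forms 1"
  shows "form_of 1 (\<lambda>c\<in>cells 1. a c + t * b (fst c) (snd c)) = lin 1 (form_of 1 a) t b"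
proof (intro ext)
  fix x L
  show "form_of 1 (\<lambda>c\<in>cells 1. a c + t * b (fst c) (snd c)) x L = lin 1 (form_of 1 a) t b x L"
  proof (cases "length L = 1")
    case True
    then obtain \<mu> where "L = [\<mu>]" by (auto simp: length_Suc_conv)
    then show ?thesis unfolding form_of_1_restrict by (simp add: lin_def del: One_nat_def)
  next
    case False
    then show ?thesis using forms_length[OF b False] by (simp add: form_of_def lin_def)
  qed
qed

definition ext_d_invariant :: "('n::finite) form set \<Rightarrow> bool" where
  "ext_d_invariant S \<longleftrightarrow> (\<forall>n\<in>S. \<forall>m\<in>int_forms 1. lin 1 n 1 (ext_d m) \<in> S)"

text \<open>The unwrapping. Summation over \<open>S\<close> makes the integrand 2 pi-periodic in
  every link, because shifting the angles by 2 pi m amounts to replacing \<open>n\<close> by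
  \<open>n + dm\<close>, which permutes \<open>S\<close>. Rotation invariance then moves the gauge
  field by an arbitrary real \<open>b\<close>, as if it were a variable on the whole line.\<close>

lemma villain_shift:
  fixes S :: "('n::finite) form set"
  assumes S: "S \<subseteq> int_forms 2" "ext_d_invariant S" and g: "gaussian g" and b: "b \<in> forms 1"
  shows "villain S (\<lambda>F. g (lin 1 F 1 (ext_d b))) = villain S g"
proof -
  define \<Phi> where "\<Phi> = (\<lambda>a. \<Sum>\<^sub>\<infinity>n\<in>S. g (field_strength (form_of 1 a) n))"
  have "villain S (\<lambda>F. g (lin 1 F 1 (ext_d b))) = 
      (\<integral>a. (\<Sum>\<^sub>\<infinity>n\<in>S. g (lin 1 (field_strength (form_of 1 a) n) 1 (ext_d b))) \<partial>field_measure 1)"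
    by (rule villain_sums(5)[OF S(1) gaussian_shift[OF g ext_d_forms_2[OF b]]])
  also have "\<dots> = (\<integral>a. \<Phi> (\<lambda>c\<in>cells 1. a c + 1 * b (fst c) (snd c)) \<partial>field_measure 1)"
  proof (intro Bochner_Integration.integral_cong refl)
    fix a
    have "lin 1 (field_strength (form_of 1 a) n) 1 (ext_d b) = field_strength (lin 1 (form_of 1 a) 1 b) n" for n
      unfolding field_strength_lin ext_d_lin by (intro ext) (simp add: lin_def)
    then show "(\<Sum>\<^sub>\<infinity>n\<in>S. g (lin 1 (field_strength (form_of 1 a) n) 1 (ext_d b))) = \<Phi> (\<lambda>c\<in>cells 1. a c + 1 * b (fst c) (snd c))"
      unfolding \<Phi>_def form_of_1_add[OF b] by simp
  qed
  also have "\<dots> = (\<integral>a. \<Phi> a \<partial>field_measure 1)"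
    unfolding mult_1_left
  proof (rule integral_field_measure_shift)
    show "\<Phi> \<in> borel_measurable (field_measure 1)"
      unfolding \<Phi>_def using villain_sums(4)[OF S(1) g] by (rule borel_measurable_integrable)
    fix a m :: "'n site \<times> dir list \<Rightarrow> real" assume m: "\<And>c. m c \<in> \<int>"
    define M where "M = (form_of 1 m :: 'n form)"
    have M: "M \<in> forms 1" unfolding M_def by (rule form_of_1_forms)
    have Mi: "lin t M 0 M \<in> int_forms 1" if "t \<in> \<int>" for t
    proof -
      have "index_sign L \<in> \<int>" for L by (simp add: index_sign_def)
      then have "M x L \<in> \<int>" for x L using m by (auto simp: M_def form_of_def)
      then show ?thesis using lin_forms[OF M M, of t 0] that by (simp add: int_forms_def lin_def)
    qed
    have eq: "(\<lambda>c\<in>cells 1. a c + 2 * pi * m c) = (\<lambda>c\<in>cells 1. a c + 2 * pi * M (fst c) (snd c))"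
      by (auto simp: M_def cells_def form_of_increasing)
    have fs: "field_strength (lin 1 (form_of 1 a) (2 * pi) M) n = field_strength (form_of 1 a) (lin 1 n 1 (ext_d (lin 1 M 0 M)))" for n
      unfolding field_strength_lin ext_d_lin by (intro ext) (simp add: lin_def algebra_simps)
    have inv: "lin 1 (lin 1 n 1 (ext_d (lin s M 0 M))) 1 (ext_d (lin (- s) M 0 M)) = n" for n s
      unfolding ext_d_lin by (intro ext) (simp add: lin_def)
    have "(\<Sum>\<^sub>\<infinity>n\<in>S. g (field_strength (form_of 1 a) (lin 1 n 1 (ext_d (lin 1 M 0 M))))) = (\<Sum>\<^sub>\<infinity>n\<in>S. g (field_strength (form_of 1 a) n))"
      by (rule infsum_reindex_bij_witness[of _ "\<lambda>n. lin 1 n 1 (ext_d (lin (-1) M 0 M))" "\<lambda>n. lin 1 n 1 (ext_d (lin 1 M 0 M))"])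
         (use S(2) Mi[of 1] Mi[of "-1"] inv[of _ 1] inv[of _ "-1"] in \<open>auto simp: ext_d_invariant_def\<close>)
    then show "\<Phi> (\<lambda>c\<in>cells 1. a c + 2 * pi * m c) = \<Phi> (restrict a (cells 1))"
      unfolding eq \<Phi>_def form_of_1_add[OF M] form_of_1_restrict fs .
  qed
  also have "\<dots> = villain S g"
    unfolding \<Phi>_def by (rule villain_sums(5)[OF S(1) g, symmetric])
  finally show ?thesis .
qed

section \<open>Gaussian characteristic function\<close>

definition gauss :: "real \<Rightarrow> ('n::finite) form \<Rightarrow> complex" where
  "gauss \<beta> F = of_real (exp (- (\<beta> / 2) * form_dot 2 F F))"

lemma measurable_form_dot_field_strength [measurable]:
  "(\<lambda>a. form_dot 2 (field_strength (form_of 1 a) n) h) \<in> borel_measurable (field_measure 1)"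
  "(\<lambda>a. form_dot 2 (field_strength (form_of 1 a) n) (field_strength (form_of 1 a) n)) \<in> borel_measurable (field_measure 1)"
  by (intro measurable_form_dot; measurable)+

lemma gaussian_gauss: "\<beta> > 0 \<Longrightarrow> gaussian (gauss \<beta>)"
  unfolding gaussian_def
proof
  assume b: "\<beta> > 0"
  show "\<exists>c>0. \<exists>C\<ge>0. \<forall>F\<in>forms 2. norm (gauss \<beta> F) \<le> C * exp (- c * form_dot 2 F F)"
    by (rule exI[of _ "\<beta> / 2"], rule conjI, use b in simp, rule exI[of _ 1]) (simp add: gauss_def)
  show "\<forall>n\<in>forms 2. (\<lambda>a. gauss \<beta> (field_strength (form_of 1 a) n)) \<in> borel_measurable (field_measure 1)"
    unfolding gauss_def by (intro ballI) measurable
qed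

lemma gaussian_norm_eq:
  assumes "gaussian g" "\<And>F. norm (h F) = norm (g F)"
    and "\<And>n. (\<lambda>a. h (field_strength (form_of 1 a) n)) \<in> borel_measurable (field_measure 1)"
  shows "gaussian h"
  using assms(1,3) unfolding gaussian_def assms(2) by blast

text \<open>Combines the sum and the integral into one measure, so that the lemma on moment
  generating functions applies to it.\<close>

lemma villain_eq_pair:
  fixes S :: "('n::finite) form set"
  assumes S: "S \<subseteq> int_forms 2" and g: "gaussian g"
  shows "villain S g = (\<integral>z. g (field_strength (form_of 1 (snd z)) (fst z)) \<partial>(count_space S \<Otimes>\<^sub>M field_measure 1))"
proof -
  interpret M: prob_space "field_measure 1 :: ('n site \<times> dir list \<Rightarrow> real) measure" by (rule prob_space_field_measure)
  have "countable S" using S countable_int_forms countable_subset by blast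
  then interpret N: sigma_finite_measure "count_space S" by (rule sigma_finite_measure_count_space_countable)
  interpret P: pair_sigma_finite "count_space S" "field_measure 1 :: ('n site \<times> dir list \<Rightarrow> real) measure" ..
  show ?thesis
    using P.integral_fst'[OF villain_sums(6)[OF S g]]
    by (simp add: villain_def infsum_eq_integral case_prod_unfold)
qed

lemma villain_gauss_real:
  assumes S: "S \<subseteq> int_forms 2" "ext_d_invariant S" and \<beta>: "\<beta> > 0" and b: "b \<in> forms 1"
  defines "h \<equiv> \<lambda>t F. of_real (exp (- (\<beta> / 2) * form_dot 2 F F) * exp (t * form_dot 2 F (ext_d b))) :: complex"
  shows "gaussian (h t)"
    and "villain S (h t) = of_real (exp (form_dot 2 (ext_d b) (ext_d b) / (2 * \<beta>) * t\<^sup>2)) * villain S (gauss \<beta>)"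
proof -
  \<comment> \<open>Completing the square: shifting the field strength by -(t/\<beta>) db removes
    the linear term and leaves the constant \<open>w\<close>.\<close>
  define e where "e = lin (- t / \<beta>) b 0 b"
  have e: "e \<in> forms 1" unfolding e_def by (intro lin_forms b)
  define w where "w = exp (form_dot 2 (ext_d b) (ext_d b) / (2 * \<beta>) * t\<^sup>2)"
  have h: "h t = (\<lambda>F. of_real w * gauss \<beta> (lin 1 F 1 (ext_d e)))"
  proof
    fix F
    have "- (\<beta> / 2) * form_dot 2 F F + t * form_dot 2 F (ext_d b) = 
      form_dot 2 (ext_d b) (ext_d b) / (2 * \<beta>) * t\<^sup>2 + - (\<beta> / 2) * form_dot 2 (lin 1 F 1 (ext_d e)) (lin 1 F 1 (ext_d e))"
      unfolding e_def ext_d_lin form_dot_lin_left form_dot_lin_right form_dot_commute[of 2 "ext_d b" F]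
      using \<beta> by (simp add: field_simps power2_eq_square)
    then show "h t F = of_real w * gauss \<beta> (lin 1 F 1 (ext_d e))"
      unfolding h_def gauss_def w_def of_real_mult[symmetric] exp_add[symmetric] by simp
  qed
  note shifted_gauss = gaussian_shift[OF gaussian_gauss[OF \<beta>] ext_d_forms_2[OF e]]
  show "gaussian (h t)" 
  proof -
    obtain c C where c: "c > 0" "C \<ge> 0" and bound: "\<And>F. F \<in> forms 2 \<Longrightarrow> norm (gauss \<beta> (lin 1 F 1 (ext_d e))) \<le> C * exp (- c * form_dot 2 F F)"
      and meas: "\<And>n. n \<in> forms 2 \<Longrightarrow> (\<lambda>a. gauss \<beta> (lin 1 (field_strength (form_of 1 a) n) 1 (ext_d e))) \<in> borel_measurable (field_measure 1)"
      using shifted_gauss unfolding gaussian_def by blast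
    have "norm (h t F) \<le> (w * C) * exp (- c * form_dot 2 F F)" if "F \<in> forms 2" for F
      using mult_left_mono[OF bound[OF that], of w] unfolding h norm_mult by (simp add: w_def)
    moreover have "w * C \<ge> 0" using c by (simp add: w_def)
    moreover have "(\<lambda>a. h t (field_strength (form_of 1 a) n)) \<in> borel_measurable (field_measure 1)" if "n \<in> forms 2" for n
      unfolding h using meas[OF that] by measurable
    ultimately show ?thesis using c(1) unfolding gaussian_def by blast
  qed
  have "villain S (h t) = of_real w * villain S (\<lambda>F. gauss \<beta> (lin 1 F 1 (ext_d e)))"
    unfolding h villain_def by (simp add: infsum_cmult_right')
  also have "villain S (\<lambda>F. gauss \<beta> (lin 1 F 1 (ext_d e))) = villain S (gauss \<beta>)"
    by (rule villain_shift[OF S gaussian_gauss[OF \<beta>] e])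
  finally show "villain S (h t) = of_real (exp (form_dot 2 (ext_d b) (ext_d b) / (2 * \<beta>) * t\<^sup>2)) * villain S (gauss \<beta>)"
    by (simp add: w_def)
qed

text \<open>Translations yield the formula with a real exponential;
  \<open>mgf_gaussian_imaginary\<close> continues it to the oscillating one, which flips the sign of
  the exponent on the right.\<close>

lemma villain_gauss_character:
  fixes S :: "('n::finite) form set"
  assumes S: "S \<subseteq> int_forms 2" "ext_d_invariant S" and \<beta>: "\<beta> > 0" and b: "b \<in> forms 1"
  shows "villain S (\<lambda>F. gauss \<beta> F * exp (\<i> * of_real (t * form_dot 2 F (ext_d b)))) =
    of_real (exp (- (form_dot 2 (ext_d b) (ext_d b) / (2 * \<beta>)) * t\<^sup>2)) * villain S (gauss \<beta>)"
proof -
  interpret M: prob_space "field_measure 1 :: ('n site \<times> dir list \<Rightarrow> real) measure" by (rule prob_space_field_measure)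
  have cS: "countable S" using S countable_int_forms countable_subset by blast
  then interpret N: sigma_finite_measure "count_space S" by (rule sigma_finite_measure_count_space_countable)
  interpret P: pair_sigma_finite "count_space S" "field_measure 1 :: ('n site \<times> dir list \<Rightarrow> real) measure" ..
  let ?P = "count_space S \<Otimes>\<^sub>M (field_measure 1 :: ('n site \<times> dir list \<Rightarrow> real) measure)"
  define F where "F = (\<lambda>z. field_strength (form_of 1 (snd z)) (fst z) :: 'n form)"
  define p where "p = (\<lambda>z. exp (- (\<beta> / 2) * form_dot 2 (F z) (F z)))"
  define s where "s = (\<lambda>z. form_dot 2 (F z) (ext_d b))"
  define c where "c = form_dot 2 (ext_d b) (ext_d b) / (2 * \<beta>)"
  have sm: "s \<in> borel_measurable ?P"
  proof -
    have "(\<lambda>(n, a). form_dot 2 (field_strength (form_of 1 a) n) (ext_d b)) \<in> borel_measurable ?P"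
      using cS measurable_form_dot_field_strength(1)
      by (intro measurable_pair_measure_countable1) (simp_all del: One_nat_def)
    then show ?thesis by (simp add: s_def F_def case_prod_unfold)
  qed
  have pm: "p \<in> borel_measurable ?P"
  proof -
    have m: "(\<lambda>a. exp (- (\<beta> / 2) * form_dot 2 (field_strength (form_of 1 a) n) (field_strength (form_of 1 a) n))) \<in> borel_measurable (field_measure 1)" for n :: "'n form"
      by measurable
    have "(\<lambda>(n, a). exp (- (\<beta> / 2) * form_dot 2 (field_strength (form_of 1 a) n) (field_strength (form_of 1 a) n))) \<in> borel_measurable ?P"
      using cS m by (intro measurable_pair_measure_countable1) (simp_all del: One_nat_def)
    then show ?thesis by (simp add: p_def F_def case_prod_unfold)
  qed
  note r = villain_gauss_real[OF S \<beta> b]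
  have int: "integrable ?P (\<lambda>z. complex_of_real (p z * exp (t * s z)))" for t
    using villain_sums(6)[OF S(1) r(1)[of t]] by (simp add: p_def s_def F_def case_prod_unfold)
  have eqc: "(\<integral>z. complex_of_real (p z * exp (t * s z)) \<partial>?P) = of_real (exp (c * t\<^sup>2)) * villain S (gauss \<beta>)" for t
    using villain_eq_pair[OF S(1) r(1)[of t]] r(2)[of t] by (simp add: p_def s_def F_def c_def)
  define C where "C = (\<integral>z. p z \<partial>?P)"
  have V: "villain S (gauss \<beta>) = of_real C"
    using eqc[of 0] unfolding integral_complex_of_real by (simp add: C_def)
  have "(\<integral>z. of_real (p z) * exp (\<i> * of_real (t * s z)) \<partial>?P) = complex_of_real (C * exp (- c * t\<^sup>2))"
  proof (rule mgf_gaussian_imaginary)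
    show "sigma_finite_measure ?P" by (rule P.sigma_finite_measure_axioms)
    show "integrable ?P (\<lambda>z. p z * exp (t * s z))" for t
      using int[of t] by (simp only: complex_of_real_integrable_eq)
    show "(\<integral>z. p z * exp (t * s z) \<partial>?P) = C * exp (c * t\<^sup>2)" for t
      using eqc[of t] unfolding integral_complex_of_real V of_real_mult[symmetric] of_real_eq_iff by (simp add: mult.commute)
  qed (use sm pm in \<open>auto simp: p_def\<close>)
  moreover have "villain S (\<lambda>F. gauss \<beta> F * exp (\<i> * of_real (t * form_dot 2 F (ext_d b)))) = 
      (\<integral>z. of_real (p z) * exp (\<i> * of_real (t * s z)) \<partial>?P)"
  proof -
    have "gaussian (\<lambda>F. gauss \<beta> F * exp (\<i> * of_real (t * form_dot 2 F (ext_d b))))"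
    proof -
      have "(\<lambda>a. gauss \<beta> (field_strength (form_of 1 a) n) * exp (\<i> * of_real (t * form_dot 2 (field_strength (form_of 1 a) n) (ext_d b)))) \<in> borel_measurable (field_measure 1)" for n
        unfolding gauss_def by measurable
      moreover have "norm (gauss \<beta> F * exp (\<i> * of_real (t * form_dot 2 F (ext_d b)))) = norm (gauss \<beta> F)" for F
        unfolding norm_mult norm_exp_i by simp
      ultimately show ?thesis by (intro gaussian_norm_eq[OF gaussian_gauss[OF \<beta>]])
    qed
    from villain_eq_pair[OF S(1) this] show ?thesis by (simp add: gauss_def p_def s_def F_def)
  qed
  ultimately show ?thesis unfolding V c_def by (simp add: mult.commute)
qed

text \<open>All summands are nonnegative and the one at \<open>n0\<close> is positive. It allows the
  Gaussian normalisation to be cancelled between numerator and partition function.\<close>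

lemma villain_gauss_pos:
  fixes S :: "('n::finite) form set"
  assumes S: "S \<subseteq> int_forms 2" "n0 \<in> S" and \<beta>: "\<beta> > 0"
  shows "villain S (gauss \<beta>) \<noteq> 0"
proof -
  interpret M: prob_space "field_measure 1 :: ('n site \<times> dir list \<Rightarrow> real) measure" by (rule prob_space_field_measure)
  define f where "f = (\<lambda>n a. exp (- (\<beta> / 2) * form_dot 2 (field_strength (form_of 1 a) n) (field_strength (form_of 1 a :: 'n form) n)))"
  have f0: "f n a > 0" for n a by (simp add: f_def)
  have gf: "gauss \<beta> (field_strength (form_of 1 a) n) = of_real (f n a)" for n a by (simp add: gauss_def f_def)
  note vs = villain_sums[OF S(1) gaussian_gauss[OF \<beta>], unfolded gf]
  have int: "integrable (field_measure 1) (f n)" if "n \<in> S" for n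
    using vs(1)[OF that] by (simp only: complex_of_real_integrable_eq)
  have sum: "(\<lambda>n. \<integral>a. f n a \<partial>field_measure 1) summable_on S"
    using vs(2) f0 by (simp add: less_imp_le)
  have "(\<integral>a. f n0 a \<partial>field_measure 1) \<noteq> 0"
  proof
    assume "(\<integral>a. f n0 a \<partial>field_measure 1) = 0"
    then have "AE a in field_measure 1. f n0 a = 0"
      using integral_nonneg_eq_0_iff_AE[OF int[OF S(2)]] f0 by (simp add: less_imp_le)
    then have "AE a in (field_measure 1 :: ('n site \<times> dir list \<Rightarrow> real) measure). False"
      by eventually_elim (use f0[of n0] in \<open>simp add: less_le\<close>)
    then show False by simp
  qed
  moreover have "0 \<le> (\<integral>a. f n a \<partial>field_measure 1)" for n
    using f0 by (intro integral_nonneg_AE) (simp add: less_imp_le)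
  ultimately have "0 < (\<Sum>\<^sub>\<infinity>n\<in>{n0}. \<integral>a. f n a \<partial>field_measure 1)"
    by (simp add: less_le)
  also have "\<dots> \<le> (\<Sum>\<^sub>\<infinity>n\<in>S. \<integral>a. f n a \<partial>field_measure 1)"
    using sum S(2) f0 by (intro infsum_mono_neutral) (auto intro!: integral_nonneg_AE simp: less_imp_le)
  finally have "(\<Sum>\<^sub>\<infinity>n\<in>S. \<integral>a. f n a \<partial>field_measure 1) \<noteq> 0" by simp
  moreover have "villain S (gauss \<beta>) = of_real (\<Sum>\<^sub>\<infinity>n\<in>S. \<integral>a. f n a \<partial>field_measure 1)"
    unfolding villain_def gf integral_complex_of_real
    using infsum_comm_additive[of complex_of_real, OF additive.intro[OF of_real_add] _ sum] by (simp add: o_def)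
  ultimately show ?thesis by simp
qed

section \<open>Integrating out the 3-form\<close>

lemma pair_integral_mult:
  fixes f :: "'a \<Rightarrow> 'c::{real_normed_field, banach, second_countable_topology}" and g :: "'b \<Rightarrow> 'c"
  assumes "prob_space M" "prob_space N" and [measurable]: "f \<in> borel_measurable M" "g \<in> borel_measurable N"
    and b: "\<And>x. norm (f x) \<le> 1" "\<And>x. norm (g x) \<le> 1"
  shows "integrable (M \<Otimes>\<^sub>M N) (\<lambda>z. f (fst z) * g (snd z))"
    and "(\<integral>z. f (fst z) * g (snd z) \<partial>(M \<Otimes>\<^sub>M N)) = (\<integral>x. f x \<partial>M) * (\<integral>y. g y \<partial>N)"
proof -
  interpret M: prob_space M by fact
  interpret N: prob_space N by fact
  interpret P: pair_prob_space M N ..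
  have "norm (f x) * norm (g y) \<le> 1" for x y using mult_mono[OF b(1)[of x] b(2)[of y]] by simp
  then show int: "integrable (M \<Otimes>\<^sub>M N) (\<lambda>z. f (fst z) * g (snd z))"
    by (intro P.integrable_const_bound[where B = 1]) (auto simp: norm_mult)
  show "(\<integral>z. f (fst z) * g (snd z) \<partial>(M \<Otimes>\<^sub>M N)) = (\<integral>x. f x \<partial>M) * (\<integral>y. g y \<partial>N)"
    using P.integral_fst'[OF int] by simp
qed

text \<open>The 3-form enters only as a character with integer frequencies \<open>K n\<close>, whose
  average is 1 if \<open>K n\<close> vanishes and 0 otherwise. Keeping \<open>G\<close> and
  \<open>K\<close> general covers the numerator and the partition function at once.\<close>

lemma field_integral_constraint:
  fixes G :: "('n::finite) form \<Rightarrow> 'n form \<Rightarrow> complex"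
  assumes \<beta>: "\<beta> > 0"
    and bound: "\<And>A n. norm (G A n) = exp (- (\<beta> / 2) * form_dot 2 (field_strength A n) (field_strength A n))"
    and meas: "\<And>n. (\<lambda>a. G (form_of 1 a) n) \<in> borel_measurable (field_measure 1)"
    and K: "\<And>n. n \<in> int_forms 2 \<Longrightarrow> K n \<in> int_forms 3"
  shows "field_integral (\<lambda>A B. \<Sum>\<^sub>\<infinity>n\<in>int_forms 2. G A n * exp (\<i> * of_real (form_dot 3 B (K n)))) =
    (\<Sum>\<^sub>\<infinity>n\<in>{n \<in> int_forms 2. \<forall>x L. K n x L = 0}. \<integral>a. G (form_of 1 a) n \<partial>field_measure 1)"
    and "(\<lambda>n. \<integral>a. G (form_of 1 a) n \<partial>field_measure 1) summable_on int_forms 2"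
proof -
  let ?M1 = "field_measure 1 :: ('n site \<times> dir list \<Rightarrow> real) measure"
  let ?M3 = "field_measure 3 :: ('n site \<times> dir list \<Rightarrow> real) measure"
  define f where "f = (\<lambda>n a. G (form_of 1 a) n)"
  define h where "h = (\<lambda>n b. exp (\<i> * of_real (form_dot 3 (form_of 3 b) (K n))))"
  have P: "prob_space ?M1" "prob_space ?M3" by (rule prob_space_field_measure)+
  have fm: "f n \<in> borel_measurable ?M1" for n unfolding f_def by (rule meas)
  have f1: "norm (f n a) \<le> 1" for n a unfolding f_def bound using \<beta> form_dot_nonneg[of 2 "field_strength (form_of 1 a) n"] by simp
  have hm: "h n \<in> borel_measurable ?M3" for n
  proof -
    have [measurable]: "(\<lambda>b. form_dot 3 (form_of 3 b) (K n)) \<in> borel_measurable ?M3"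
      by (rule measurable_form_dot) measurable
    show ?thesis unfolding h_def by measurable
  qed
  have h1: "norm (h n b) = 1" for n b unfolding h_def by (rule norm_exp_i)
  note pm = pair_integral_mult[OF P fm hm f1 eq_refl[OF h1]]
  have hint: "(\<integral>b. h n b \<partial>?M3) = (if \<forall>x L. K n x L = 0 then 1 else 0)" if n: "n \<in> int_forms 2" for n
  proof -
    have Kn: "K n \<in> int_forms 3" by (rule K[OF n])
    have "(\<forall>c\<in>cells 3. K n (fst c) (snd c) = 0) \<longleftrightarrow> (\<forall>x L. K n x L = 0)"
    proof
      assume "\<forall>c\<in>cells 3. K n (fst c) (snd c) = 0"
      then have "K n x L = 0" if "L \<in> increasing_indices 3" for x L using that by (auto simp: cells_def)
      then show "\<forall>x L. K n x L = 0" using forms_3_vanish[OF int_forms_forms[OF Kn]] by blast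
    qed blast
    then show ?thesis
      unfolding h_def form_dot_form_of using integral_field_character[of "\<lambda>c. K n (fst c) (snd c)" 3] Kn
      by (simp add: int_forms_def)
  qed
  have eq: "(\<integral>z. f n (fst z) * h n (snd z) \<partial>(?M1 \<Otimes>\<^sub>M ?M3)) = (if \<forall>x L. K n x L = 0 then \<integral>a. f n a \<partial>?M1 else 0)"
    if "n \<in> int_forms 2" for n
    using pm(2)[of n n] hint[OF that] by (simp del: One_nat_def)
  have "countable (int_forms 2 :: 'n form set)" by (rule countable_int_forms)
  interpret M1: prob_space ?M1 by (rule P(1))
  interpret M3: prob_space ?M3 by (rule P(2))
  interpret PP: pair_prob_space ?M1 ?M3 ..
  have sig: "sigma_finite_measure (?M1 \<Otimes>\<^sub>M ?M3)" ..
  let ?b = "\<lambda>n :: 'n form. 1 * exp (\<beta> / 2 * box_const TYPE('n)) * exp (- (2 * pi\<^sup>2 * (\<beta> / 2)) * form_dot 2 n n)"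
  have bs: "?b summable_on (int_forms 2 :: 'n form set)"
    using \<beta> by (intro summable_on_cmult_right summable_gauss_forms) auto
  have fb: "(\<integral>a. norm (f n a) \<partial>?M1) \<le> ?b n" if n: "n \<in> int_forms 2" for n
    unfolding f_def
  proof (rule field_integral_bound(2)[where g = "\<lambda>a n. G (form_of 1 a) n", OF _ _ n])
    show "norm (G (form_of 1 a) n) \<le> 1 * exp (- (\<beta> / 2) * form_dot 2 (field_strength (form_of 1 a) n) (field_strength (form_of 1 a) n))" for a
      unfolding bound by simp
  qed (use \<beta> meas in auto)
  have "(\<lambda>n. norm (\<integral>a. f n a \<partial>?M1)) summable_on int_forms 2"
  proof (rule summable_on_comparison_test[OF bs])
    fix n :: "'n form" assume n: "n \<in> int_forms 2"
    show "norm (\<integral>a. f n a \<partial>?M1) \<le> ?b n" by (rule order_trans[OF integral_norm_bound fb[OF n]])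
  qed simp
  from abs_summable_summable[OF this]
  show "(\<lambda>n. \<integral>a. G (form_of 1 a) n \<partial>field_measure 1) summable_on int_forms 2" unfolding f_def .
  have s: "(\<lambda>n. \<integral>z. norm (f n (fst z) * h n (snd z)) \<partial>(?M1 \<Otimes>\<^sub>M ?M3)) summable_on int_forms 2"
  proof (rule summable_on_comparison_test[OF bs])
    fix n :: "'n form" assume n: "n \<in> int_forms 2"
    have [measurable]: "f n \<in> borel_measurable ?M1" by (rule fm)
    have "(\<integral>z. norm (f n (fst z) * h n (snd z)) \<partial>(?M1 \<Otimes>\<^sub>M ?M3)) = (\<integral>z. norm (f n (fst z)) * (1::real) \<partial>(?M1 \<Otimes>\<^sub>M ?M3))"
      by (simp add: norm_mult h1 del: One_nat_def)
    also have "\<dots> = (\<integral>a. norm (f n a) \<partial>?M1)"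
      using pair_integral_mult(2)[OF P, of "\<lambda>a. norm (f n a)" "\<lambda>_. 1 :: real"] f1 by (simp add: M3.prob_space del: One_nat_def)
    also have "\<dots> \<le> ?b n" by (rule fb[OF n])
    finally show "(\<integral>z. norm (f n (fst z) * h n (snd z)) \<partial>(?M1 \<Otimes>\<^sub>M ?M3)) \<le> ?b n" .
  qed (auto intro!: integral_nonneg_AE)
  have "field_integral (\<lambda>A B. \<Sum>\<^sub>\<infinity>n\<in>int_forms 2. G A n * exp (\<i> * of_real (form_dot 3 B (K n)))) =
    (\<integral>z. (\<Sum>\<^sub>\<infinity>n\<in>int_forms 2. f n (fst z) * h n (snd z)) \<partial>(?M1 \<Otimes>\<^sub>M ?M3))"
    unfolding field_integral_def f_def h_def ..
  also have "\<dots> = (\<Sum>\<^sub>\<infinity>n\<in>int_forms 2. \<integral>z. f n (fst z) * h n (snd z) \<partial>(?M1 \<Otimes>\<^sub>M ?M3))"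
    by (rule integral_infsum(3)[OF sig countable_int_forms pm(1) s])
  also have "\<dots> = (\<Sum>\<^sub>\<infinity>n\<in>{n \<in> int_forms 2. \<forall>x L. K n x L = 0}. \<integral>a. f n a \<partial>?M1)"
    by (rule infsum_cong_neutral) (auto simp: eq simp del: One_nat_def)
  finally show "field_integral (\<lambda>A B. \<Sum>\<^sub>\<infinity>n\<in>int_forms 2. G A n * exp (\<i> * of_real (form_dot 3 B (K n)))) =
    (\<Sum>\<^sub>\<infinity>n\<in>{n \<in> int_forms 2. \<forall>x L. K n x L = 0}. \<integral>a. G (form_of 1 a) n \<partial>field_measure 1)" unfolding f_def .
qed

section \<open>The algebra of the exponent\<close>

text \<open>Cup product density of two constant 2-forms, the intersection pairing of the 4-torus. As
  a quadratic form in six components it has signature (3,3).\<close>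

definition cup_const :: "(dir \<Rightarrow> dir \<Rightarrow> real) \<Rightarrow> (dir \<Rightarrow> dir \<Rightarrow> real) \<Rightarrow> real" where
  "cup_const a b = a X1 X2 * b X3 X4 - a X1 X3 * b X2 X4 + a X1 X4 * b X2 X3
     + a X2 X3 * b X1 X4 - a X2 X4 * b X1 X3 + a X3 X4 * b X1 X2"

text \<open>This is \<open>cup_commutator\<close> with the term containing \<open>ext_d\<close> of
  \<alpha> gone. It is the form in which non-commutativity is used from here on.\<close>

lemma cup_closed:
  assumes "\<alpha> \<in> forms 2" "\<beta> \<in> forms 2" "closed_form \<alpha>"
  shows "cup4 \<beta> \<alpha> + cupd \<alpha> \<beta> = cup4 \<alpha> \<beta>"
proof -
  have "ext_d \<alpha> = (\<lambda>x L. 0)" using assms(3) by (auto simp: closed_form_def)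
  then have "sum4 (cup1 3 2 (ext_d \<alpha>) \<beta>) = 0"
    using cup1_3_2[OF zero_forms assms(2)] by (simp add: sum4_def)
  then show ?thesis using cup_commutator[OF assms(1,2)] by simp
qed

lemma cupd_closed:
  assumes "\<alpha> \<in> forms 2" "closed_form \<beta>"
  shows "cupd \<alpha> \<beta> = 0"
proof -
  have "ext_d \<beta> = (\<lambda>x L. 0)" using assms(2) by (auto simp: closed_form_def)
  then show ?thesis using cup1_2_3[OF assms(1) zero_forms] by (simp add: sum4_def)
qed

lemma cup_exact_closed:
  assumes "a \<in> forms 1" "\<beta> \<in> forms 2" "closed_form \<beta>"
  shows "cup4 (ext_d a) \<beta> = 0"
proof -
  have "ext_d \<beta> = (\<lambda>x L. 0)" using assms(3) by (auto simp: closed_form_def)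
  then show ?thesis using stokes[OF assms(1,2)] sum4_cup_1_3[OF zero_forms] by simp
qed

lemma cup_closed_exact:
  assumes "a \<in> forms 1" "\<beta> \<in> forms 2" "closed_form \<beta>"
  shows "cup4 \<beta> (ext_d a) = 0"
  using cup_closed[OF ext_d_forms_2[OF assms(1)] assms(2) closed_ext_d[OF assms(1)]]
    cup_exact_closed[OF assms] cupd_closed[OF ext_d_forms_2[OF assms(1)] assms(3)] by simp

lemma cup_mean:
  assumes "\<alpha> \<in> forms 2" "\<beta> \<in> forms 2"
  shows "cup4 (mean \<alpha>) \<beta> = CARD('n site) * cup_const (\<lambda>\<mu> \<nu>. mean \<alpha> (0 :: ('n::finite) site) [\<mu>,\<nu>]) (\<lambda>\<mu> \<nu>. mean \<beta> 0 [\<mu>,\<nu>])"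
    and "cup4 \<beta> (mean \<alpha>) = CARD('n site) * cup_const (\<lambda>\<mu> \<nu>. mean \<beta> 0 [\<mu>,\<nu>]) (\<lambda>\<mu> \<nu>. mean \<alpha> 0 [\<mu>,\<nu>])"
proof -
  define c where "c = mean \<alpha> 0"
  have m: "mean \<alpha> x L = c L" for x L by (simp add: mean_def c_def)
  have s: "(\<Sum>x\<in>UNIV. \<beta> x L) = CARD('n site) * mean \<beta> 0 L" for L by (simp add: mean_def)
  have sh: "(\<Sum>x\<in>UNIV. \<beta> (x + t) L) = CARD('n site) * mean \<beta> 0 L" for t L
    using sum_site_shift[of "\<lambda>x. \<beta> x L" t] s by simp
  show "cup4 (mean \<alpha>) \<beta> = CARD('n site) * cup_const (\<lambda>\<mu> \<nu>. mean \<alpha> (0 :: 'n site) [\<mu>,\<nu>]) (\<lambda>\<mu> \<nu>. mean \<beta> 0 [\<mu>,\<nu>])"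
    unfolding sum4_cup_2_2[OF mean_forms_2[OF assms(1)] assms(2)] m
    by (simp only: sum.distrib sum_subtractf sum_distrib_left[symmetric] sh cup_const_def) (simp only: ring_distribs mult_ac)
  show "cup4 \<beta> (mean \<alpha>) = CARD('n site) * cup_const (\<lambda>\<mu> \<nu>. mean \<beta> 0 [\<mu>,\<nu>]) (\<lambda>\<mu> \<nu>. mean \<alpha> 0 [\<mu>,\<nu>])"
    unfolding sum4_cup_2_2[OF assms(2) mean_forms_2[OF assms(1)]] m
    by (simp only: sum.distrib sum_subtractf sum_distrib_right[symmetric] s cup_const_def) (simp only: ring_distribs mult_ac)
qed

lemma mean_codiff: "mean (codiff b) = (\<lambda>x L. 0)"
  by (simp add: mean_def sum_codiff)

lemma cup4_int:
  assumes "\<alpha> \<in> int_forms 2" "\<beta> \<in> int_forms 2"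
  shows "cup4 \<alpha> \<beta> \<in> \<int>"
  unfolding sum4_cup_2_2[OF int_forms_forms[OF assms(1)] int_forms_forms[OF assms(2)]]
  using assms by (intro Ints_sum Ints_add Ints_diff Ints_mult) (auto simp: int_forms_def)

lemma ext_d_int:
  assumes "\<alpha> \<in> int_forms 2" shows "ext_d \<alpha> \<in> int_forms 3"
proof -
  have "ext_d \<alpha> x L \<in> \<int>" for x L
    unfolding ext_d_def using assms by (intro Ints_sum Ints_mult Ints_diff Ints_power) (auto simp: int_forms_def)
  then show ?thesis using ext_d_forms_3[OF int_forms_forms[OF assms]] by (simp add: int_forms_def)
qed

lemma cupd_int:
  assumes "\<alpha> \<in> int_forms 2" "\<beta> \<in> int_forms 2"
  shows "cupd \<alpha> \<beta> \<in> \<int>"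
  unfolding sum4_def cup1_2_3[OF int_forms_forms[OF assms(1)] ext_d_forms_3[OF int_forms_forms[OF assms(2)]]]
  using assms(1) ext_d_int[OF assms(2)] by (intro Ints_sum Ints_add Ints_diff Ints_mult) (auto simp: int_forms_def)

lemma pontryagin_eq: "pontryagin n = cup4 n n + cupd n n"
  by (simp add: pontryagin_def sum4_def sum.distrib)

lemma top_charge_eq: "top_charge F n = 1 / (8 * pi\<^sup>2) * cup4 F F + 1 / (4 * pi) * sum4 (cup1 2 3 F (ext_d n))"
  by (simp add: top_charge_def sum4_def sum.distrib sum_distrib_left)

lemma mean_lin: "mean (lin a \<alpha> b \<beta>) = lin a (mean \<alpha>) b (mean \<beta>)"
  by (intro ext) (simp add: mean_def lin_def sum.distrib sum_distrib_left add_divide_distrib)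

lemma mean_mean: "mean (mean \<alpha>) = mean (\<alpha> :: ('n::finite) form)"
proof -
  have "real (CARD('n site)) \<noteq> 0" by simp
  then show ?thesis by (intro ext) (simp only: mean_def sum_constant, simp)
qed

lemma form_dot_mean:
  assumes "\<alpha> \<in> forms 2"
  shows "form_dot 2 (mean \<alpha>) \<beta> = CARD('n site) * (\<Sum>L\<in>increasing_indices 2. mean \<alpha> (0 :: ('n::finite) site) L * mean \<beta> 0 L)"
proof -
  have "form_dot 2 (mean \<alpha>) \<beta> = (\<Sum>L\<in>increasing_indices 2. \<Sum>x\<in>UNIV. mean \<alpha> 0 L * \<beta> x L)"
    unfolding form_dot_def by (subst sum.swap) (simp add: mean_def)
  also have "\<dots> = (\<Sum>L\<in>increasing_indices 2. mean \<alpha> 0 L * (CARD('n site) * mean \<beta> 0 L))"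
    unfolding sum_distrib_left[symmetric] by (simp add: mean_def)
  finally show ?thesis by (simp add: sum_distrib_left mult_ac)
qed

lemma form_dot_exact_mean:
  assumes "a \<in> forms 1" "\<alpha> \<in> forms 2"
  shows "form_dot 2 (mean \<alpha>) (ext_d a) = 0"
proof -
  have "mean (ext_d a) 0 L = 0" if "L \<in> increasing_indices 2" for L
    using that sum_ext_d_1[of a] unfolding increasing_indices_2 by (auto simp: mean_def)
  then show ?thesis unfolding form_dot_mean[OF assms(2)] by simp
qed

lemma form_dot_codiff_closed:
  assumes "b \<in> forms 3" "\<alpha> \<in> forms 2" "closed_form \<alpha>"
  shows "form_dot 2 (codiff b) \<alpha> = 0"
  using form_dot_codiff_3[OF assms(1,2)] assms(3) by (simp add: closed_form_def form_dot_def)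

section \<open>Flux sectors of closed integer forms\<close>

type_synonym flux6 = "(int \<times> int) \<times> (int \<times> int) \<times> (int \<times> int)"

lemma flux6_cases:
  fixes k :: flux6
  obtains a1 b1 a2 b2 a3 b3 where "k = ((a1, b1), (a2, b2), (a3, b3))"
  by (metis surj_pair)

text \<open>Each pair holds the fluxes through two complementary planes. The sign in the (X2, X4)
  entry makes the intersection form equal to 2 (a1 b1 + a2 b2 + a3 b3), so that the theta function
  factorises.\<close>

fun flux_fun :: "flux6 \<Rightarrow> dir \<Rightarrow> dir \<Rightarrow> real" where
  "flux_fun ((a1, b1), (a2, b2), (a3, b3)) X1 X2 = of_int a1"
| "flux_fun ((a1, b1), (a2, b2), (a3, b3)) X3 X4 = of_int b1"
| "flux_fun ((a1, b1), (a2, b2), (a3, b3)) X1 X3 = of_int a2"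
| "flux_fun ((a1, b1), (a2, b2), (a3, b3)) X2 X4 = - of_int b2"
| "flux_fun ((a1, b1), (a2, b2), (a3, b3)) X1 X4 = of_int a3"
| "flux_fun ((a1, b1), (a2, b2), (a3, b3)) X2 X3 = of_int b3"
| "flux_fun ((a1, b1), (a2, b2), (a3, b3)) X2 X1 = - of_int a1"
| "flux_fun ((a1, b1), (a2, b2), (a3, b3)) X4 X3 = - of_int b1"
| "flux_fun ((a1, b1), (a2, b2), (a3, b3)) X3 X1 = - of_int a2"
| "flux_fun ((a1, b1), (a2, b2), (a3, b3)) X4 X2 = of_int b2"
| "flux_fun ((a1, b1), (a2, b2), (a3, b3)) X4 X1 = - of_int a3"
| "flux_fun ((a1, b1), (a2, b2), (a3, b3)) X3 X2 = - of_int b3"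
| "flux_fun _ _ _ = 0"

lemma flux_fun_anti: "flux_fun k b a = - flux_fun k a b"
  by (cases k rule: flux6_cases; cases a; cases b) simp_all

lemma flux_fun_int: "flux_fun k a b \<in> \<int>"
  by (cases k rule: flux6_cases; cases a; cases b) simp_all

definition flux_of :: "('n::finite) form \<Rightarrow> flux6" where
  "flux_of c = ((\<lfloor>flux c X1 X2\<rfloor>, \<lfloor>flux c X3 X4\<rfloor>), (\<lfloor>flux c X1 X3\<rfloor>, \<lfloor>- flux c X2 X4\<rfloor>), (\<lfloor>flux c X1 X4\<rfloor>, \<lfloor>flux c X2 X3\<rfloor>))"

definition cocycles :: "('n::finite) form set" where
  "cocycles = {c \<in> int_forms 2. closed_form c}"

definition sector :: "flux6 \<Rightarrow> ('n::finite) form set" where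
  "sector k = {c \<in> cocycles. flux_of c = k}"

lemma flux_of:
  assumes "c \<in> int_forms 2" "L = [\<mu>, \<nu>]" "L \<in> increasing_indices 2"
  shows "flux c \<mu> \<nu> = flux_fun (flux_of c) \<mu> \<nu>"
proof -
  have e: "of_int \<lfloor>x\<rfloor> = x" if "x \<in> \<int>" for x :: real using that by (auto elim: Ints_cases)
  show ?thesis using assms(2,3)
    by (auto simp: flux_of_def increasing_indices_2 e flux_int[OF assms(1)] Ints_minus)
qed

lemma mean_flux:
  fixes c :: "('n::finite) form"
  assumes c: "c \<in> cocycles" and L: "[\<mu>, \<nu>] \<in> increasing_indices 2"
  shows "mean c x [\<mu>, \<nu>] = flux_fun (flux_of c) \<mu> \<nu> / (CARD('n))\<^sup>2"
proof -
  have ci: "c \<in> int_forms 2" "closed_form c" using c by (auto simp: cocycles_def)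
  have "\<mu> \<noteq> \<nu>" using L by (auto simp: increasing_indices_def)
  then have "(\<Sum>y\<in>UNIV. c y [\<mu>,\<nu>]) = (CARD('n))\<^sup>2 * flux c \<mu> \<nu>"
    using sum_flux[OF ci(2) _ int_forms_forms[OF ci(1)]] by simp
  then have "mean c x [\<mu>,\<nu>] = (CARD('n))\<^sup>2 * flux c \<mu> \<nu> / real (CARD('n) ^ 4)"
    unfolding mean_def card_site by simp
  then show ?thesis unfolding flux_of[OF ci(1) refl L] by (simp add: power2_eq_square power4_eq_xxxx)
qed

lemma mean_eq_sector:
  assumes "c \<in> sector k" "c' \<in> sector k"
  shows "mean c = mean (c' :: ('n::finite) form)"
proof -
  have c: "c \<in> cocycles" "c' \<in> cocycles" "flux_of c = flux_of c'" using assms by (auto simp: sector_def)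
  have f: "mean c \<in> forms 2" "mean c' \<in> forms 2"
    using c int_forms_forms mean_forms_2 by (auto simp: cocycles_def)
  have "mean c x L = mean c' x L" if L: "L \<in> increasing_indices 2" for x L
  proof -
    obtain \<mu> \<nu> where "L = [\<mu>, \<nu>]" using L unfolding increasing_indices_2 by blast
    then show ?thesis using L mean_flux[OF c(1), of \<mu> \<nu> x] mean_flux[OF c(2), of \<mu> \<nu> x] c(3) by simp
  qed
  then have "lin 1 (mean c) (-1) (mean c') x L = 0" if "L \<in> increasing_indices 2" for x L using that by (simp add: lin_def)
  then have 0: "lin 1 (mean c) (-1) (mean c') x L = 0" for x L
    using forms_2_vanish[OF lin_forms[OF f]] by blast
  have "mean c x L = mean c' x L" for x L using 0[of x L] by (simp add: lin_def)
  then show ?thesis by (intro ext)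
qed

lemma flux_lin: "flux (lin a \<alpha> b \<beta>) \<mu> \<nu> = a * flux \<alpha> \<mu> \<nu> + b * flux \<beta> \<mu> \<nu>"
  by (simp add: flux_def lin_def sum.distrib sum_distrib_left)

lemma flux_exact:
  fixes m :: "('n::finite) form"
  assumes "m \<in> forms 1" "\<mu> \<noteq> \<nu>" shows "flux (ext_d m) \<mu> \<nu> = 0"
  using sum_flux[OF closed_ext_d[OF assms(1)] assms(2) ext_d_forms_2[OF assms(1)]] sum_ext_d_1[of m \<mu> \<nu>] by simp

lemma flux_of_cong:
  assumes "\<And>\<mu> \<nu>. \<mu> \<noteq> \<nu> \<Longrightarrow> flux c \<mu> \<nu> = flux c' \<mu> \<nu>"
  shows "flux_of c = flux_of c'"
  by (simp add: flux_of_def assms)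

lemma ext_d_int_1:
  assumes "m \<in> int_forms 1" shows "ext_d m \<in> int_forms 2"
proof -
  have "ext_d m x L \<in> \<int>" for x L
    unfolding ext_d_def using assms by (intro Ints_sum Ints_mult Ints_diff Ints_power) (auto simp: int_forms_def)
  then show ?thesis using ext_d_forms_2[OF int_forms_forms[OF assms]] by (simp add: int_forms_def)
qed

lemma sector_invariant: "ext_d_invariant (sector k :: ('n::finite) form set)"
  unfolding ext_d_invariant_def
proof (intro ballI)
  fix c m :: "'n form" assume c: "c \<in> sector k" and m: "m \<in> int_forms 1"
  have "lin 1 c 1 (ext_d m) \<in> int_forms 2"
    using c ext_d_int_1[OF m] by (intro lin_int_forms) (auto simp: sector_def cocycles_def)
  moreover have "closed_form (lin 1 c 1 (ext_d m))"
    using c closed_ext_d[OF int_forms_forms[OF m]] by (intro closed_lin) (auto simp: sector_def cocycles_def)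
  moreover have "flux_of (lin 1 c 1 (ext_d m)) = flux_of c"
    by (rule flux_of_cong) (simp add: flux_lin flux_exact[OF int_forms_forms[OF m]])
  ultimately show "lin 1 c 1 (ext_d m) \<in> sector k" using c by (simp add: sector_def cocycles_def)
qed

lemma flux_form_sector: "(flux_form (flux_fun k) :: ('n::finite) form) \<in> sector k"
proof -
  let ?c = "flux_form (flux_fun k) :: 'n form"
  note ff = flux_form[of "flux_fun k", OF flux_fun_anti flux_fun_int]
  have "flux_of ?c = ((\<lfloor>flux_fun k X1 X2\<rfloor>, \<lfloor>flux_fun k X3 X4\<rfloor>), (\<lfloor>flux_fun k X1 X3\<rfloor>, \<lfloor>- flux_fun k X2 X4\<rfloor>), (\<lfloor>flux_fun k X1 X4\<rfloor>, \<lfloor>flux_fun k X2 X3\<rfloor>))"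
    by (simp add: flux_of_def ff(3))
  also have "\<dots> = k" by (cases k rule: flux6_cases) simp
  finally have "flux_of ?c = k" .
  then show ?thesis using ff(1,2) by (simp add: sector_def cocycles_def)
qed

lemma flux_of_iff:
  assumes "c \<in> int_forms 2"
  shows "flux_of c = ((a1, b1), (a2, b2), (a3, b3)) \<longleftrightarrow> flux c X1 X2 = of_int a1 \<and> flux c X3 X4 = of_int b1 \<and>
    flux c X1 X3 = of_int a2 \<and> flux c X2 X4 = - of_int b2 \<and> flux c X1 X4 = of_int a3 \<and> flux c X2 X3 = of_int b3"
proof -
  have f: "\<lfloor>x\<rfloor> = k \<longleftrightarrow> x = of_int k" if "x \<in> \<int>" for x :: real and k
    using that by (auto elim: Ints_cases)
  have "- flux c X2 X4 = of_int b2 \<longleftrightarrow> flux c X2 X4 = - of_int b2" by auto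
  then show ?thesis
    unfolding flux_of_def using flux_int[OF assms] by (simp add: f)
qed

lemma sector_bij:
  fixes c0 :: "('n::finite) form"
  assumes c0: "c0 \<in> sector k"
  shows "b \<in> sector ((0,0),(0,0),(0,0)) \<Longrightarrow> lin 1 b 1 c0 \<in> sector k"
    and "c \<in> sector k \<Longrightarrow> lin 1 c (-1) c0 \<in> sector ((0,0),(0,0),(0,0))"
proof -
  obtain a1 b1 a2 b2 a3 b3 where k: "k = ((a1, b1), (a2, b2), (a3, b3))" by (cases k rule: flux6_cases)
  have ci: "c \<in> int_forms 2" if "c \<in> sector j" for c :: "'n form" and j using that by (auto simp: sector_def cocycles_def)
  have cc: "closed_form c" if "c \<in> sector j" for c :: "'n form" and j using that by (auto simp: sector_def cocycles_def)
  have cf: "flux_of c = j" if "c \<in> sector j" for c :: "'n form" and j using that by (auto simp: sector_def)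
  note f0 = flux_of_iff[OF ci[OF c0], THEN iffD1, OF cf[OF c0, unfolded k]]
  {
    assume b: "b \<in> sector ((0,0),(0,0),(0,0))"
    note fb = flux_of_iff[OF ci[OF b], THEN iffD1, OF cf[OF b]]
    have i: "lin 1 b 1 c0 \<in> int_forms 2" using ci[OF b] ci[OF c0] by (intro lin_int_forms) auto
    have "flux_of (lin 1 b 1 c0) = k"
      unfolding k by (subst flux_of_iff[OF i]) (use f0 fb in \<open>simp add: flux_lin\<close>)
    then show "lin 1 b 1 c0 \<in> sector k"
      using i closed_lin[OF cc[OF b] cc[OF c0]] by (simp add: sector_def cocycles_def)
  }
  {
    assume c: "c \<in> sector k"
    note fc = flux_of_iff[OF ci[OF c], THEN iffD1, OF cf[OF c, unfolded k]]
    have i: "lin 1 c (-1) c0 \<in> int_forms 2" using ci[OF c] ci[OF c0] by (intro lin_int_forms) auto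
    have "flux_of (lin 1 c (-1) c0) = ((0,0),(0,0),(0,0))"
      by (subst flux_of_iff[OF i]) (use f0 fc in \<open>simp add: flux_lin\<close>)
    then show "lin 1 c (-1) c0 \<in> sector ((0,0),(0,0),(0,0))"
      using i closed_lin[OF cc[OF c] cc[OF c0]] by (simp add: sector_def cocycles_def)
  }
qed

lemma zero_sector: "(\<lambda>x L. 0) \<in> sector ((0,0),(0,0),(0,0))"
proof -
  have "(\<lambda>x L. 0) \<in> cocycles" by (simp add: cocycles_def int_forms_def zero_forms closed_form_def ext_d_def)
  then show ?thesis by (simp add: sector_def flux_of_def flux_def)
qed

section \<open>Evaluation of the numerator\<close>

text \<open>Here \<open>w = P\<^sub>\<partial> l\<close>, and \<open>ae(2)\<close> is the Hodge decomposition of \<open>l\<close>.\<close>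

locale spanned_loop =
  fixes \<gamma> :: "('n::finite) link list" and l w ae g0 b0 :: "'n form"
  assumes l: "l \<in> int_forms 2"
    and b0: "b0 \<in> forms 3" "w = codiff b0"
    and ae: "ae \<in> forms 1" "l = lin 1 w 1 (lin 1 (mean l) 1 (ext_d ae))"
    and g0: "g0 \<in> forms 1" "star w = ext_d g0"
    and loop_dot: "\<And>A. A \<in> forms 1 \<Longrightarrow> form_dot 1 (loop_form \<gamma>) A = - cup4 (ext_d A) l"
    and loop_cup: "\<And>B. B \<in> forms 3 \<Longrightarrow> sum4 (cup 1 3 (loop_form \<gamma>) B) = - form_dot 3 B (ext_d l)"
begin

definition W where "W = form_dot 2 w w"
definition u where "u = cupd w w"
definition y where "y = cup4 w (ext_d ae)"
definition v where "v = pontryagin l"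
definition N2 where "N2 = (real CARD('n))\<^sup>2"
text \<open>The normalisation under which a closed integer form would give its fluxes, as in
  \<open>mean_flux\<close>. As \<open>l\<close> bounds a loop it is in general not closed, and these
  numbers need not be integers.\<close>

definition lam where "lam \<mu> \<nu> = N2 * mean l 0 [\<mu>, \<nu>]"

lemma l2: "l \<in> forms 2" using l by (rule int_forms_forms)
lemma w2: "w \<in> forms 2" using b0 codiff_forms_2 by simp
lemma mean_w: "mean w = (\<lambda>x L. 0)" by (simp add: b0 mean_codiff)
lemma N2_pos: "N2 > 0" by (simp add: N2_def)
lemma N4: "real CARD('n site) = N2 * N2" unfolding card_site by (simp add: N2_def power2_eq_square power4_eq_xxxx)
lemma X2: "ext_d ae \<in> forms 2" by (rule ext_d_forms_2[OF ae(1)])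

lemma cup_w_mean: "h \<in> forms 2 \<Longrightarrow> cup4 (mean h) w = 0" "h \<in> forms 2 \<Longrightarrow> cup4 w (mean h) = 0"
  using cup_mean[of h w] w2 by (simp_all add: mean_w cup_const_def)

lemma cup_w_w: "cup4 w w = 0"
  unfolding b0(2) by (rule cup_codiff_codiff[OF b0(1) b0(1)])

lemma cupd_mean_w: "h \<in> forms 2 \<Longrightarrow> cupd (mean h) w = 0"
  using cup_closed[OF mean_forms_2 w2 closed_mean] cup_w_mean by force

text \<open>Puts the pairing with \<open>w\<close> into the shape of an inner product with an exact
  form, which is what \<open>villain_gauss_character\<close> evaluates.\<close>

lemma cup_exact_w: "E \<in> forms 2 \<Longrightarrow> cup4 E w = form_dot 2 E (ext_d g0)"
  using cup4_star[OF _ w2] g0(2) by simp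

lemma form_dot_g0: "form_dot 2 (ext_d g0) (ext_d g0) = W"
  using form_dot_star[OF w2] g0(2) by (simp add: W_def)

context
  fixes A c :: "'n form" and qm :: real
  assumes A: "A \<in> forms 1" and c: "c \<in> cocycles"
begin

definition H where "H = mean (lin (2 * pi) c (2 * pi * qm) l)"
text \<open>What remains of the field strength belonging to \<open>lin 1 c qm l\<close> once the
  constant part \<open>H\<close> and the coexact part 2 pi qm w are removed. In this form its
  exactness follows from the decompositions of \<open>c\<close> and \<open>l\<close>.\<close>

definition exact_part where "exact_part = lin 1 (field_strength A c) 1 (lin (- 2 * pi) (mean c) (2 * pi * qm) (ext_d ae))"

lemma c2: "c \<in> int_forms 2" "c \<in> forms 2" "closed_form c"
  using c int_forms_forms by (auto simp: cocycles_def)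

lemma exact_part_exact: "\<exists>a\<in>forms 1. exact_part = ext_d a"
proof -
  obtain ac where ac: "ac \<in> forms 1" "c = lin 1 (mean c) 1 (ext_d ac)"
    using closed_decomposition[OF c2(2,3)] by blast
  have "exact_part = lin 1 (lin 1 (ext_d A) (2 * pi) (lin 1 (mean c) 1 (ext_d ac))) 1 (lin (- 2 * pi) (mean c) (2 * pi * qm) (ext_d ae))"
    unfolding exact_part_def field_strength_lin using ac(2) by simp
  also have "\<dots> = ext_d (lin 1 A 1 (lin (2 * pi) ac (2 * pi * qm) ae))"
    unfolding ext_d_lin by (intro ext) (simp add: lin_def algebra_simps)
  finally show ?thesis using lin_forms[OF A lin_forms[OF ac(1) ae(1)]] by blast
qed

lemma exact_part_forms: "exact_part \<in> forms 2" "closed_form exact_part"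
  using exact_part_exact ext_d_forms_2 closed_ext_d by auto

lemma h2: "lin (2 * pi) c (2 * pi * qm) l \<in> forms 2" by (intro lin_forms c2 l2)

lemma H2: "H \<in> forms 2" "closed_form H"
  unfolding H_def by (intro mean_forms_2 h2) (rule closed_mean)

lemma H_eq: "H = lin (2 * pi) (mean c) (2 * pi * qm) (mean l)"
  by (simp add: H_def mean_lin)

lemma F_eq: "field_strength A (lin 1 c qm l) = lin 1 exact_part 1 (lin 1 H (2 * pi * qm) w)"
proof (intro ext)
  fix x L
  have "l x L = w x L + (mean l x L + ext_d ae x L)"
    by (subst ae(2)) (simp add: lin_def)
  then show "field_strength A (lin 1 c qm l) x L = lin 1 exact_part 1 (lin 1 H (2 * pi * qm) w) x L"
    unfolding exact_part_def H_eq field_strength_lin lin_apply by (simp add: algebra_simps)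
qed

lemma EH: "cup4 exact_part H = 0" "cup4 H exact_part = 0" "cup4 exact_part exact_part = 0" "form_dot 2 H exact_part = 0" "form_dot 2 w exact_part = 0" "form_dot 2 w H = 0"
  "cup4 exact_part (mean l) = 0" "cup4 exact_part (ext_d ae) = 0" "cup4 H (ext_d ae) = 0"
proof -
  obtain a where a: "a \<in> forms 1" "exact_part = ext_d a" using exact_part_exact by blast
  show "cup4 exact_part H = 0" "cup4 H exact_part = 0" "cup4 exact_part exact_part = 0" "cup4 exact_part (mean l) = 0"  "cup4 exact_part (ext_d ae) = 0"
    unfolding a(2) using cup_exact_closed[OF a(1)] cup_closed_exact[OF a(1)] H2 exact_part_forms[unfolded a(2)]
      mean_forms_2[OF l2] closed_mean[of l] X2 closed_ext_d[OF ae(1)] by simp_all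
  show "form_dot 2 H exact_part = 0" unfolding H_def a(2) by (rule form_dot_exact_mean[OF a(1) h2])
  show "form_dot 2 w exact_part = 0" "form_dot 2 w H = 0"
    unfolding b0(2) using form_dot_codiff_closed[OF b0(1)] exact_part_forms H2 by simp_all
  show "cup4 H (ext_d ae) = 0" using cup_closed_exact[OF ae(1) H2] .
qed

lemma norm_F: "form_dot 2 (field_strength A (lin 1 c qm l)) (field_strength A (lin 1 c qm l)) =
    form_dot 2 exact_part exact_part + form_dot 2 H H + 4 * pi\<^sup>2 * qm\<^sup>2 * W"
  unfolding F_eq form_dot_lin_left form_dot_lin_right
  using EH form_dot_commute[of 2 exact_part H] form_dot_commute[of 2 exact_part w] form_dot_commute[of 2 H w]
  by (simp add: W_def power2_eq_square algebra_simps)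

lemma cupd_exact_w: "cup4 w exact_part + cupd exact_part w = cup4 exact_part w"
  by (rule cup_closed[OF exact_part_forms(1) w2 exact_part_forms(2)])

lemma ext_d_n: "ext_d (lin 1 c qm l) = ext_d (lin qm w 0 w)"
proof (intro ext)
  fix x L
  have "ext_d l x L = ext_d w x L"
    by (subst ae(2), unfold ext_d_lin lin_apply)
       (use closed_mean[of l] closed_ext_d[OF ae(1)] in \<open>simp add: closed_form_def\<close>)
  then show "ext_d (lin 1 c qm l) x L = ext_d (lin qm w 0 w) x L"
    unfolding ext_d_lin lin_apply using c2(3) by (simp add: closed_form_def)
qed

text \<open>Write E for \<open>exact_part\<close>. The cup product of the field strength with itself
  contributes the symmetric combination of \<open>cup4 E w\<close> and \<open>cup4 w E\<close>, and
  the \<open>cup1\<close> term, by \<open>cup_closed\<close>, the antisymmetric one with equal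
  weight. Only \<open>cup4 E w\<close> is left, the same pairing that occurs in
  \<open>loop_F\<close>.\<close>

lemma top_charge_F: "top_charge (field_strength A (lin 1 c qm l)) (lin 1 c qm l) =
    1 / (8 * pi\<^sup>2) * cup4 H H + qm / (2 * pi) * cup4 exact_part w + qm\<^sup>2 / 2 * u"
proof -
  have Hw: "cup4 H w = 0" "cup4 w H = 0" "cupd H w = 0"
    unfolding H_def by (intro cup_w_mean cupd_mean_w h2)+
  note f2 = exact_part_forms(1) H2(1) w2 lin_forms
  have d: "sum4 (cup1 2 3 F (ext_d (lin 1 c qm l))) = qm * cupd F w" if "F \<in> forms 2" for F
    unfolding ext_d_n by (subst cupd_lin_right) (use that w2 in auto)
  have e: "cupd exact_part w = cup4 exact_part w - cup4 w exact_part" using cupd_exact_w by simp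
  have k1: "sum4 (cup1 2 3 (lin 1 exact_part 1 (lin 1 H (2 * pi * qm) w)) (ext_d (lin 1 c qm l))) = qm * (cup4 exact_part w - cup4 w exact_part + 2 * pi * qm * u)"
    by (simp add: d f2 cupd_lin_left Hw u_def e)
  have k2: "cup4 (lin 1 exact_part 1 (lin 1 H (2 * pi * qm) w)) (lin 1 exact_part 1 (lin 1 H (2 * pi * qm) w)) =
      cup4 H H + 2 * pi * qm * (cup4 exact_part w + cup4 w exact_part)"
    unfolding cup4_lin_left cup4_lin_right using EH Hw cup_w_w by (simp add: algebra_simps)
  show ?thesis
    unfolding top_charge_eq F_eq k1 k2 by (simp add: field_simps power2_eq_square)
qed

text \<open>\<open>loop_dot\<close> gives a cup product of dA with \<open>l\<close>; substituting F
  - 2 pi n for dA separates the integer \<open>cup4 n l\<close>, invisible in the phase for integral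
  \<open>n\<close>, from terms that depend on the decomposed field strength.\<close>

lemma loop_F: "form_dot 1 (loop_form \<gamma>) A =
    2 * pi * cup4 (lin 1 c qm l) l - (cup4 exact_part w + cup4 H (mean l) + 2 * pi * qm * y)"
proof -
  have "cup4 (field_strength A (lin 1 c qm l)) l = cup4 (ext_d A) l + 2 * pi * cup4 (lin 1 c qm l) l"
    unfolding field_strength_lin cup4_lin_left by simp
  moreover have "cup4 (field_strength A (lin 1 c qm l)) l = cup4 exact_part w + cup4 H (mean l) + 2 * pi * qm * y"
  proof -
    have "cup4 F l = cup4 F w + cup4 F (mean l) + cup4 F (ext_d ae)" for F
      by (subst ae(2)) (simp add: cup4_lin_right)
    then have "cup4 (field_strength A (lin 1 c qm l)) l = cup4 (lin 1 exact_part 1 (lin 1 H (2 * pi * qm) w)) w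
       + cup4 (lin 1 exact_part 1 (lin 1 H (2 * pi * qm) w)) (mean l) + cup4 (lin 1 exact_part 1 (lin 1 H (2 * pi * qm) w)) (ext_d ae)"
      unfolding F_eq .
    also have "\<dots> = cup4 exact_part w + cup4 H (mean l) + 2 * pi * qm * y"
      unfolding cup4_lin_left using EH cup_w_w cup_w_mean[OF l2] cup_w_mean(1)[OF h2, folded H_def]
      by (simp add: y_def)
    finally show ?thesis .
  qed
  ultimately show ?thesis using loop_dot[OF A] by simp
qed

definition kap where "kap \<mu> \<nu> = flux_fun (flux_of c) \<mu> \<nu> + qm * lam \<mu> \<nu>"

lemma H_kap: "[\<mu>, \<nu>] \<in> increasing_indices 2 \<Longrightarrow> H x [\<mu>, \<nu>] = 2 * pi / N2 * kap \<mu> \<nu>"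
proof -
  assume L: "[\<mu>, \<nu>] \<in> increasing_indices 2"
  have "mean l x [\<mu>, \<nu>] = lam \<mu> \<nu> / N2" using N2_pos by (simp add: lam_def mean_def)
  then show ?thesis
    unfolding H_eq lin_apply using mean_flux[OF c L, of x]
    by (simp add: kap_def N2_def[symmetric] field_simps add_divide_distrib)
qed

lemma H_values:
  "form_dot 2 H H = 4 * pi\<^sup>2 * ((kap X1 X2)\<^sup>2 + (kap X1 X3)\<^sup>2 + (kap X1 X4)\<^sup>2 + (kap X2 X3)\<^sup>2 + (kap X2 X4)\<^sup>2 + (kap X3 X4)\<^sup>2)"
  "cup4 H H = 4 * pi\<^sup>2 * cup_const kap kap"
  "cup4 H (mean l) = 2 * pi * cup_const kap lam"
proof -
  have mH: "mean H = H" unfolding H_def by (rule mean_mean)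
  have k: "H x [X1,X2] = 2 * pi / N2 * kap X1 X2" "H x [X1,X3] = 2 * pi / N2 * kap X1 X3"
    "H x [X1,X4] = 2 * pi / N2 * kap X1 X4" "H x [X2,X3] = 2 * pi / N2 * kap X2 X3"
    "H x [X2,X4] = 2 * pi / N2 * kap X2 X4" "H x [X3,X4] = 2 * pi / N2 * kap X3 X4" for x
    by (intro H_kap; simp add: increasing_indices_2)+
  have ml: "mean l 0 [\<mu>, \<nu>] = lam \<mu> \<nu> / N2" for \<mu> \<nu> using N2_pos by (simp add: lam_def)
  note cm = cup_mean(1)[OF h2, folded H_def, unfolded N4]
  show "form_dot 2 H H = 4 * pi\<^sup>2 * ((kap X1 X2)\<^sup>2 + (kap X1 X3)\<^sup>2 + (kap X1 X4)\<^sup>2 + (kap X2 X3)\<^sup>2 + (kap X2 X4)\<^sup>2 + (kap X3 X4)\<^sup>2)"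
    unfolding form_dot_2 k sum_constant N4 using N2_pos by (simp add: field_simps power2_eq_square)
  show "cup4 H H = 4 * pi\<^sup>2 * cup_const kap kap"
    unfolding cm[OF H2(1)] mH cup_const_def k using N2_pos by (simp add: field_simps power2_eq_square)
  show "cup4 H (mean l) = 2 * pi * cup_const kap lam"
    unfolding cm[OF mean_forms_2[OF l2]] mean_mean cup_const_def k ml using N2_pos by (simp add: field_simps power2_eq_square)
qed

text \<open>The intersection form of the 4-torus is even: exact parts drop out, and the value
  depends on the six integer fluxes alone.\<close>

lemma cup_c_c: "\<exists>j::int. cup4 c c = 2 * of_int j"
proof -
  obtain ac where ac: "ac \<in> forms 1" "c = lin 1 (mean c) 1 (ext_d ac)"
    using closed_decomposition[OF c2(2,3)] by blast
  have m2: "mean c \<in> forms 2" by (rule mean_forms_2[OF c2(2)])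
  have "cup4 c c = cup4 (lin 1 (mean c) 1 (ext_d ac)) (lin 1 (mean c) 1 (ext_d ac))"
    using ac(2) by simp
  also have "\<dots> = cup4 (mean c) (mean c)"
    unfolding cup4_lin_left cup4_lin_right
    using cup_exact_closed[OF ac(1)] cup_closed_exact[OF ac(1)] m2 closed_mean[of c] ext_d_forms_2[OF ac(1)] closed_ext_d[OF ac(1)] by simp
  also have "\<dots> = N2 * N2 * cup_const (\<lambda>\<mu> \<nu>. mean c 0 [\<mu>,\<nu>]) (\<lambda>\<mu> \<nu>. mean c 0 [\<mu>,\<nu>])"
    using cup_mean(1)[OF c2(2) m2] unfolding N4 mean_mean .
  also have "\<dots> = cup_const (flux_fun (flux_of c)) (flux_fun (flux_of c))"
  proof -
    have k: "mean c 0 [X1,X2] = flux_fun (flux_of c) X1 X2 / N2" "mean c 0 [X1,X3] = flux_fun (flux_of c) X1 X3 / N2"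
      "mean c 0 [X1,X4] = flux_fun (flux_of c) X1 X4 / N2" "mean c 0 [X2,X3] = flux_fun (flux_of c) X2 X3 / N2"
      "mean c 0 [X2,X4] = flux_fun (flux_of c) X2 X4 / N2" "mean c 0 [X3,X4] = flux_fun (flux_of c) X3 X4 / N2"
      unfolding N2_def of_nat_power[symmetric] by (subst mean_flux[OF c]; simp add: increasing_indices_2)+
    show ?thesis unfolding cup_const_def k using N2_pos by (simp add: field_simps)
  qed
  also obtain a1 b1 a2 b2 a3 b3 where k: "flux_of c = ((a1, b1), (a2, b2), (a3, b3))" by (rule flux6_cases)
  have "cup_const (flux_fun (flux_of c)) (flux_fun (flux_of c)) = 2 * of_int (a1 * b1 + a2 * b2 + a3 * b3)"
    unfolding k by (simp add: cup_const_def)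
  finally show ?thesis by blast
qed

text \<open>By \<open>cup_closed\<close> the cross terms add up to 2 qm cup4 c l, and the term
  quadratic in \<open>c\<close> is even. Modulo 2 only qm^2 v survives, so the parameter
  \<open>p\<close> affects the expectation value merely by a sign.\<close>

lemma pontryagin_n:
  assumes qm: "qm \<in> \<int>"
  shows "\<exists>j::int. pontryagin (lin 1 c qm l) = qm\<^sup>2 * v + 2 * of_int j"
proof -
  have "cupd (lin 1 c qm l) (lin 1 c qm l) = qm * cupd c l + qm\<^sup>2 * cupd l l"
    using cupd_closed[OF c2(2,3)] cupd_closed[OF l2 c2(3)] c2(2) l2
    by (simp add: cupd_lin_left cupd_lin_right lin_forms power2_eq_square algebra_simps)
  moreover have "qm * cup4 l c + qm * cupd c l = qm * cup4 c l"
    unfolding distrib_left[symmetric] cup_closed[OF c2(2) l2 c2(3)] ..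
  ultimately have "pontryagin (lin 1 c qm l) = qm\<^sup>2 * v + 2 * (qm * cup4 c l) + cup4 c c"
    unfolding pontryagin_eq v_def cup4_lin_left cup4_lin_right by (simp add: power2_eq_square algebra_simps)
  moreover have "qm * cup4 c l \<in> \<int>" using qm cup4_int[OF c2(1) l] by simp
  then obtain i where "qm * cup4 c l = of_int i" by (auto elim: Ints_cases)
  moreover obtain j where "cup4 c c = 2 * of_int j" using cup_c_c by blast
  ultimately have "pontryagin (lin 1 c qm l) = qm\<^sup>2 * v + 2 * of_int (i + j)" by simp
  then show ?thesis by blast
qed

end

end

section \<open>Factorisation of the weight into a theta summand and a Gaussian wave\<close>

lemma of_real_exp_mult: "of_real (exp r) * exp (\<i> * of_real s) = exp (Complex r s)"
  unfolding Complex_eq exp_add exp_of_real ..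

lemma Complex_add_simp: "Complex r s + Complex r' s' = Complex (r + r') (s + s')"
  by (simp add: complex_eq_iff)

lemma exp_2pi_int:
  assumes "x \<in> \<int>" shows "exp (\<i> * of_real (2 * pi * x)) = 1"
proof -
  obtain k where "x = of_int k" using assms by (auto elim: Ints_cases)
  then show ?thesis using exp_integer_2pi[of "of_int k"] by (simp add: mult_ac)
qed

context spanned_loop
begin

definition zl where "zl = ((lam X1 X2, lam X3 X4), (lam X1 X3, - lam X2 X4), (lam X1 X4, lam X2 X3))"

lemma theta6_term_kap:
  assumes c: "c \<in> cocycles"
  shows "theta6_term R T p qm zl (flux_of c) =
    exp (Complex (- pi * T * ((kap c qm X1 X2)\<^sup>2 + (kap c qm X1 X3)\<^sup>2 + (kap c qm X1 X4)\<^sup>2 + (kap c qm X2 X3)\<^sup>2 + (kap c qm X2 X4)\<^sup>2 + (kap c qm X3 X4)\<^sup>2))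
      (- 2 * pi * (R / 2 * cup_const (kap c qm) (kap c qm) + p * cup_const (kap c qm) lam)))"
proof -
  obtain a1 b1 a2 b2 a3 b3 where k: "flux_of c = ((a1, b1), (a2, b2), (a3, b3))" by (rule flux6_cases)
  have "theta6_term R T p qm zl (flux_of c) = theta2_term R T p qm (lam X1 X2) (lam X3 X4) (a1, b1) *
     (theta2_term R T p qm (lam X1 X3) (- lam X2 X4) (a2, b2) * theta2_term R T p qm (lam X1 X4) (lam X2 X3) (a3, b3))"
    by (simp add: theta6_term_def zl_def k)
  also have "\<dots> = exp (Complex (- pi * T * ((kap c qm X1 X2)\<^sup>2 + (kap c qm X1 X3)\<^sup>2 + (kap c qm X1 X4)\<^sup>2 + (kap c qm X2 X3)\<^sup>2 + (kap c qm X2 X4)\<^sup>2 + (kap c qm X3 X4)\<^sup>2))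
      (- 2 * pi * (R / 2 * cup_const (kap c qm) (kap c qm) + p * cup_const (kap c qm) lam)))"
    unfolding theta2_term_def Let_def fst_conv snd_conv of_real_exp_mult exp_add[symmetric] Complex_add_simp
    by (rule arg_cong[where f = exp]) (simp add: kap_def[OF zero_forms c] k cup_const_def power2_eq_square algebra_simps)
  finally show ?thesis .
qed

text \<open>The integrand after the factor depending on the 3-form has been split off; that factor
  is expressed through \<open>constraint\<close>.\<close>

definition G where
  "G qe p \<beta> \<theta> A n = exp (Complex (- (\<beta> / 2) * form_dot 2 (field_strength A n) (field_strength A n))
     (- \<theta> * top_charge (field_strength A n) n - of_int p * pi * pontryagin n + of_int qe * form_dot 1 (loop_form \<gamma>) A))"

definition prefactor :: "int \<Rightarrow> int \<Rightarrow> int \<Rightarrow> real \<Rightarrow> real \<Rightarrow> complex" where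
  "prefactor qe qm p \<beta> \<theta> = exp (Complex (- 2 * pi\<^sup>2 * \<beta> * (of_int qm)\<^sup>2 * W)
     (- (\<theta> / 2) * (of_int qm)\<^sup>2 * u - 2 * pi * of_int qe * of_int qm * y - of_int p * pi * (of_int qm)\<^sup>2 * v))"

text \<open>Minus the effective electric charge q_e + theta q_m / (2 pi) of the Witten effect. It is
  the coefficient with which the loop and the theta term together couple to the exact part.\<close>

definition tilt :: "int \<Rightarrow> int \<Rightarrow> real \<Rightarrow> real" where
  "tilt qe qm \<theta> = - (of_int qe + \<theta> * of_int qm / (2 * pi))"

definition wave where "wave \<beta> t F = gauss \<beta> F * exp (\<i> * of_real (t * form_dot 2 F (ext_d g0)))"

lemma G_eval:
  assumes A: "A \<in> forms 1" and c: "c \<in> cocycles"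
  shows "G qe p \<beta> \<theta> A (lin 1 c (of_int qm) l) = prefactor qe qm p \<beta> \<theta> *
    (theta6_term (\<theta> / (2 * pi)) (2 * pi * \<beta>) (of_int qe) (of_int qm) zl (flux_of c) *
     wave \<beta> (tilt qe qm \<theta>) (exact_part A c (of_int qm)))"
proof -
  let ?q = "of_int qm :: real" and ?p = "of_int p :: real" and ?e = "of_int qe :: real"
  let ?n = "lin 1 c ?q l"
  obtain j :: int where j: "pontryagin ?n = ?q\<^sup>2 * v + 2 * of_int j"
    using pontryagin_n[OF A c, of ?q] by auto
  \<comment> \<open>Collects the phases that are multiples of 2 pi: the integer part of the loop
    coupling and the even remainder of the Pontryagin square.\<close>
  define m where "m = of_int qe * cup4 ?n l - of_int p * of_int j"
  have "?n \<in> int_forms 2" using c l by (intro lin_int_forms) (auto simp: cocycles_def)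
  then have m: "m \<in> \<int>" unfolding m_def using cup4_int[OF _ l] by simp
  have wave: "wave \<beta> t (exact_part A c ?q) = exp (Complex (- (\<beta> / 2) * form_dot 2 (exact_part A c ?q) (exact_part A c ?q)) (t * cup4 (exact_part A c ?q) w))" for t
    unfolding wave_def gauss_def of_real_exp_mult cup_exact_w[OF exact_part_forms(1)[OF A c]] ..
  have "G qe p \<beta> \<theta> A ?n = prefactor qe qm p \<beta> \<theta> *
    (theta6_term (\<theta> / (2 * pi)) (2 * pi * \<beta>) ?e ?q zl (flux_of c) * wave \<beta> (tilt qe qm \<theta>) (exact_part A c ?q)) * exp (Complex 0 (2 * pi * m))"
    unfolding G_def prefactor_def theta6_term_kap[OF c] wave exp_add[symmetric] Complex_add_simp
      norm_F[OF A c] top_charge_F[OF A c] loop_F[OF A c, of ?q] H_values[OF A c] j m_def tilt_def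
    by (rule arg_cong[where f = exp]) (simp add: field_simps power2_eq_square)
  moreover have "exp (Complex 0 (2 * pi * m)) = 1"
    using exp_2pi_int[OF m] of_real_exp_mult[of 0 "2 * pi * m"] by simp
  ultimately show ?thesis by simp
qed

definition I0 where "I0 \<beta> = villain (sector ((0,0),(0,0),(0,0)) :: 'n form set) (gauss \<beta>)"

lemma gaussian_wave: "\<beta> > 0 \<Longrightarrow> gaussian (wave \<beta> t)"
proof (rule gaussian_norm_eq[OF gaussian_gauss])
  show "norm (wave \<beta> t F) = norm (gauss \<beta> F)" for F
    unfolding wave_def norm_mult norm_exp_i by simp
  show "(\<lambda>a. wave \<beta> t (field_strength (form_of 1 a) n)) \<in> borel_measurable (field_measure 1)" for n
    unfolding wave_def gauss_def by measurable
qed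

lemma sector_sub: "(sector k :: 'n form set) \<subseteq> int_forms 2"
  by (auto simp: sector_def cocycles_def)

text \<open>Subtracting a representative of the flux moves the sum to the zero-flux sector and turns
  \<open>exact_part\<close> into a field strength shifted by an exact form, which
  \<open>villain_shift\<close> removes. The result is the same for all \<open>k\<close> and
  \<open>qm\<close>, so it factors out of the theta sum.\<close>

lemma sector_sum:
  assumes \<beta>: "\<beta> > 0"
  shows "(\<Sum>\<^sub>\<infinity>c\<in>sector k. \<integral>a. wave \<beta> t (exact_part (form_of 1 a) c qm) \<partial>field_measure 1) =
    of_real (exp (- (W / (2 * \<beta>)) * t\<^sup>2)) * I0 \<beta>"
proof -
  define c0 where "c0 = (flux_form (flux_fun k) :: 'n form)"
  let ?Z = "sector ((0,0),(0,0),(0,0)) :: 'n form set"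
  have c0: "c0 \<in> sector k" unfolding c0_def by (rule flux_form_sector)
  then have cc: "c0 \<in> forms 2" "closed_form c0" using int_forms_forms by (auto simp: sector_def cocycles_def)
  obtain ac where ac: "ac \<in> forms 1" "c0 = lin 1 (mean c0) 1 (ext_d ac)"
    using closed_decomposition[OF cc] by blast
  \<comment> \<open>Potential of the residual shift: the exact parts of the representative
    \<open>c0\<close> and of the surface term.\<close>
  define a0 where "a0 = lin (2 * pi) ac (2 * pi * qm) ae"
  have a0: "a0 \<in> forms 1" unfolding a0_def by (intro lin_forms ac ae)
  have exact_part: "exact_part A (lin 1 b 1 c0) qm = lin 1 (field_strength A b) 1 (ext_d a0)" if "b \<in> ?Z" and A: "A \<in> forms 1" for A b
  proof -
    have cz: "lin 1 b 1 c0 \<in> cocycles" using sector_bij(1)[OF c0 that(1)] by (simp add: sector_def)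
    have m: "mean (lin 1 b 1 c0) = mean c0" by (rule mean_eq_sector[OF sector_bij(1)[OF c0 that(1)] c0])
    show ?thesis
    proof (intro ext)
      fix x L
      have "c0 x L = mean c0 x L + ext_d ac x L" by (subst ac(2)) (simp add: lin_def)
      then show "exact_part A (lin 1 b 1 c0) qm x L = lin 1 (field_strength A b) 1 (ext_d a0) x L"
        unfolding exact_part_def[OF A cz] m a0_def ext_d_lin field_strength_lin lin_apply by (simp add: algebra_simps)
    qed
  qed
  have "(\<Sum>\<^sub>\<infinity>c\<in>sector k. \<integral>a. wave \<beta> t (exact_part (form_of 1 a) c qm) \<partial>field_measure 1) =
    (\<Sum>\<^sub>\<infinity>b\<in>?Z. \<integral>a. wave \<beta> t (lin 1 (field_strength (form_of 1 a) b) 1 (ext_d a0)) \<partial>field_measure 1)"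
  proof (rule infsum_reindex_bij_witness[of _ "\<lambda>b. lin 1 b 1 c0" "\<lambda>c. lin 1 c (-1) c0"])
    fix c :: "'n form" assume c: "c \<in> sector k"
    show inv: "lin 1 (lin 1 c (- 1) c0) 1 c0 = c" by (intro ext) (simp add: lin_def)
    show z: "lin 1 c (- 1) c0 \<in> ?Z" by (rule sector_bij(2)[OF c0 c])
    show "(\<integral>a. wave \<beta> t (lin 1 (field_strength (form_of 1 a) (lin 1 c (- 1) c0)) 1 (ext_d a0)) \<partial>field_measure 1) = (\<integral>a. wave \<beta> t (exact_part (form_of 1 a) c qm) \<partial>field_measure 1)"
      unfolding exact_part[OF z form_of_1_forms, symmetric] inv ..
  next
    fix b :: "'n form" assume b: "b \<in> ?Z"
    show "lin 1 (lin 1 b 1 c0) (- 1) c0 = b" by (intro ext) (simp add: lin_def)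
    show "lin 1 b 1 c0 \<in> sector k" by (rule sector_bij(1)[OF c0 b])
  qed
  also have "\<dots> = villain ?Z (\<lambda>F. wave \<beta> t (lin 1 F 1 (ext_d a0)))" unfolding villain_def ..
  also have "\<dots> = villain ?Z (wave \<beta> t)"
    by (rule villain_shift[OF sector_sub sector_invariant gaussian_wave[OF \<beta>] a0])
  also have "\<dots> = of_real (exp (- (W / (2 * \<beta>)) * t\<^sup>2)) * I0 \<beta>"
    using villain_gauss_character[OF sector_sub sector_invariant \<beta> g0(1), of "((0,0),(0,0),(0,0))" t]
    unfolding form_dot_g0 I0_def wave_def[abs_def] .
  finally show ?thesis .
qed

lemma norm_G: "norm (G qe p \<beta> \<theta> A n) = exp (- (\<beta> / 2) * form_dot 2 (field_strength A n) (field_strength A n))"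
  by (simp add: G_def norm_exp_eq_Re)

lemma measurable_G: "(\<lambda>a. G qe p \<beta> \<theta> (form_of 1 a) n) \<in> borel_measurable (field_measure 1)"
proof -
  note [measurable] = measurable_top_charge
  have [measurable]: "(\<lambda>a. form_dot 1 (loop_form \<gamma>) (form_of 1 a)) \<in> borel_measurable (field_measure 1)"
    by (rule measurable_form_dot) measurable
  show ?thesis unfolding G_def of_real_exp_mult[symmetric] by measurable
qed

text \<open>The total integer coefficient of the 3-form, from the magnetic charge of the loop and
  from the Lagrange multiplier term.\<close>

definition constraint where
  "constraint qm n = lin (of_int qm) (ext_d l) (-1) (ext_d n)"

lemma constraint_int: "n \<in> int_forms 2 \<Longrightarrow> constraint qm n \<in> int_forms 3"
  unfolding constraint_def by (intro lin_int_forms ext_d_int l) auto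

text \<open>The constraint says that \<open>n\<close> is \<open>c + qm l\<close> with
  \<open>c\<close> closed. Grouping the closed integer forms by flux is legitimate by absolute
  summability; on each sector the theta summand is constant and \<open>sector_sum\<close> evaluates
  the rest.\<close>

lemma numerator_sum:
  assumes \<beta>: "\<beta> > 0"
  shows "(\<Sum>\<^sub>\<infinity>n\<in>{n \<in> int_forms 2. \<forall>x L. constraint qm n x L = 0}. \<integral>a. G qe p \<beta> \<theta> (form_of 1 a) n \<partial>field_measure 1) =
    prefactor qe qm p \<beta> \<theta> * (theta6 (\<theta> / (2 * pi)) (2 * pi * \<beta>) (of_int qe) (of_int qm) zl *
      (of_real (exp (- (W / (2 * \<beta>)) * (tilt qe qm \<theta>)\<^sup>2)) * I0 \<beta>))"
proof -
  let ?q = "of_int qm :: real"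
  let ?N = "{n \<in> int_forms 2. \<forall>x L. constraint qm n x L = 0}"
  let ?th = "theta6_term (\<theta> / (2 * pi)) (2 * pi * \<beta>) (of_int qe) (of_int qm) zl"
  define J where "J = (\<lambda>c. \<integral>a. G qe p \<beta> \<theta> (form_of 1 a) (lin 1 c ?q l) \<partial>field_measure 1)"
  have inv1: "lin 1 (lin 1 n (- ?q) l) ?q l = n" and inv2: "lin 1 (lin 1 n ?q l) (- ?q) l = n" for n
    by (intro ext; simp add: lin_def)+
  have toC: "lin 1 n (- ?q) l \<in> cocycles" if "n \<in> ?N" for n
  proof -
    have "lin 1 n (- ?q) l \<in> int_forms 2" using that l by (intro lin_int_forms) auto
    moreover have "ext_d (lin 1 n (- ?q) l) x L = - constraint qm n x L" for x L
      unfolding constraint_def ext_d_lin lin_apply by simp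
    ultimately show ?thesis using that by (simp add: cocycles_def closed_form_def)
  qed
  have toN: "lin 1 c ?q l \<in> ?N" if "c \<in> cocycles" for c
  proof -
    have "lin 1 c ?q l \<in> int_forms 2" using that l by (intro lin_int_forms) (auto simp: cocycles_def)
    moreover have "constraint qm (lin 1 c ?q l) x L = - ext_d c x L" for x L
      unfolding constraint_def ext_d_lin lin_apply by simp
    ultimately show ?thesis using that by (simp add: cocycles_def closed_form_def)
  qed
  have "(\<lambda>n. \<integral>a. G qe p \<beta> \<theta> (form_of 1 a) n \<partial>field_measure 1) summable_on int_forms 2"
    by (rule field_integral_constraint(2)[OF \<beta> norm_G measurable_G constraint_int])
  then have sN: "(\<lambda>n. \<integral>a. G qe p \<beta> \<theta> (form_of 1 a) n \<partial>field_measure 1) summable_on ?N"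
    by (rule summable_on_subset_banach) auto
  have e1: "(\<Sum>\<^sub>\<infinity>n\<in>?N. \<integral>a. G qe p \<beta> \<theta> (form_of 1 a) n \<partial>field_measure 1) = (\<Sum>\<^sub>\<infinity>c\<in>cocycles. J c)"
    by (rule infsum_reindex_bij_witness[of _ "\<lambda>c. lin 1 c ?q l" "\<lambda>n. lin 1 n (- ?q) l"])
       (use toC toN inv1 inv2 in \<open>auto simp: J_def\<close>)
  have sC: "J summable_on cocycles"
    using sN by (subst summable_on_reindex_bij_witness[of cocycles "\<lambda>n. lin 1 n (- ?q) l" "\<lambda>c. lin 1 c ?q l" ?N])
       (use toC toN inv1 inv2 in \<open>auto simp: J_def\<close>)
  let ?S = "Sigma UNIV sector :: (flux6 \<times> 'n form) set"
  have sS: "(\<lambda>z. J (snd z)) summable_on ?S"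
    using sC by (subst summable_on_reindex_bij_witness[of ?S "\<lambda>c. (flux_of c, c)" snd cocycles]) (auto simp: sector_def)
  have "(\<Sum>\<^sub>\<infinity>c\<in>cocycles. J c) = (\<Sum>\<^sub>\<infinity>z\<in>?S. J (snd z))"
    by (rule infsum_reindex_bij_witness[of _ snd "\<lambda>c. (flux_of c, c)"]) (auto simp: sector_def)
  also have "\<dots> = (\<Sum>\<^sub>\<infinity>k. \<Sum>\<^sub>\<infinity>c\<in>sector k. J c)"
    using infsum_Sigma_banach[OF sS] by simp
  also have "\<dots> = (\<Sum>\<^sub>\<infinity>k. prefactor qe qm p \<beta> \<theta> * (?th k * (of_real (exp (- (W / (2 * \<beta>)) * (tilt qe qm \<theta>)\<^sup>2)) * I0 \<beta>)))"
  proof (rule infsum_cong)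
    fix k
    have "J c = prefactor qe qm p \<beta> \<theta> * (?th k * (\<integral>a. wave \<beta> (tilt qe qm \<theta>) (exact_part (form_of 1 a) c ?q) \<partial>field_measure 1))"
      if "c \<in> sector k" for c
    proof -
      have c: "c \<in> cocycles" "flux_of c = k" using that by (auto simp: sector_def)
      show ?thesis unfolding J_def G_eval[OF form_of_1_forms c(1)] c(2) by (simp del: One_nat_def)
    qed
    then have "(\<Sum>\<^sub>\<infinity>c\<in>sector k. J c) = (\<Sum>\<^sub>\<infinity>c\<in>sector k. prefactor qe qm p \<beta> \<theta> * (?th k * (\<integral>a. wave \<beta> (tilt qe qm \<theta>) (exact_part (form_of 1 a) c ?q) \<partial>field_measure 1)))"
      by (rule infsum_cong)
    also have "\<dots> = prefactor qe qm p \<beta> \<theta> * (?th k * (\<Sum>\<^sub>\<infinity>c\<in>sector k. \<integral>a. wave \<beta> (tilt qe qm \<theta>) (exact_part (form_of 1 a) c ?q) \<partial>field_measure 1))"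
      by (simp only: infsum_cmult_right')
    finally show "(\<Sum>\<^sub>\<infinity>c\<in>sector k. J c) = prefactor qe qm p \<beta> \<theta> * (?th k * (of_real (exp (- (W / (2 * \<beta>)) * (tilt qe qm \<theta>)\<^sup>2)) * I0 \<beta>))"
      unfolding sector_sum[OF \<beta>] .
  qed
  also have "\<dots> = prefactor qe qm p \<beta> \<theta> * (theta6 (\<theta> / (2 * pi)) (2 * pi * \<beta>) (of_int qe) (of_int qm) zl *
      (of_real (exp (- (W / (2 * \<beta>)) * (tilt qe qm \<theta>)\<^sup>2)) * I0 \<beta>))"
    unfolding theta6_def by (simp only: infsum_cmult_right' infsum_cmult_left')
  finally show ?thesis using e1 by simp
qed

end

text \<open>The four spanning conditions express \<open>loop_form\<close> through
  \<open>ext_d l\<close>. With \<open>stokes\<close> the electric coupling becomes a cup product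
  with \<open>l\<close>; in the magnetic one the site shift is removed by translation invariance,
  which leaves an inner product.\<close>

lemma spanned_loop_exists:
  fixes l :: "('n::finite) form"
  assumes span: "spanned_by \<gamma> l"
  obtains ae g0 b0 where "spanned_loop \<gamma> l (codiff_proj l) ae g0 b0"
proof -
  let ?w = "codiff_proj l"
  have l: "l \<in> int_forms 2" using span by (simp add: spanned_by_def)
  have l2: "l \<in> forms 2" using l by (rule int_forms_forms)
  obtain b0 where b0: "b0 \<in> forms 3" "?w = codiff b0" using codiff_proj(1)[OF l2] by blast
  define z where "z = lin 1 l (-1) ?w"
  have z: "z \<in> forms 2" "closed_form z"
    unfolding z_def using codiff_proj(2)[OF l2] codiff_forms_2[OF b0(1)] l2 b0(2) lin_forms by auto
  obtain ae where ae: "ae \<in> forms 1" "z = lin 1 (mean z) 1 (ext_d ae)"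
    using closed_decomposition[OF z] by blast
  have "mean z = mean l" unfolding z_def mean_lin b0(2) mean_codiff by (intro ext) (simp add: lin_def)
  then have "z = lin 1 (mean l) 1 (ext_d ae)" using ae(2) by simp
  moreover have "l = lin 1 ?w 1 z" unfolding z_def by (intro ext) (simp add: lin_def)
  ultimately have le: "l = lin 1 ?w 1 (lin 1 (mean l) 1 (ext_d ae))" by simp
  obtain g0 where g0: "g0 \<in> forms 1" "star ?w = ext_d g0"
    using star_codiff_exact[OF b0(1)] b0(2) by metis
  have sp: "index_sign [\<mu>, \<nu>, \<rho>, \<sigma>] * ext_d l (x + hat \<mu>) [\<nu>, \<rho>, \<sigma>] = - loop_form \<gamma> x [\<mu>]"
    if "{\<mu>, \<nu>, \<rho>, \<sigma>} = UNIV" "\<nu> < \<rho>" "\<rho> < \<sigma>" for x \<mu> \<nu> \<rho> \<sigma>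
    using span that unfolding spanned_by_def by blast
  have loop: "loop_form \<gamma> x [X1] = - ext_d l (x + hat X1) [X2,X3,X4]" "loop_form \<gamma> x [X2] = ext_d l (x + hat X2) [X1,X3,X4]"
     "loop_form \<gamma> x [X3] = - ext_d l (x + hat X3) [X1,X2,X4]" "loop_form \<gamma> x [X4] = ext_d l (x + hat X4) [X1,X2,X3]" for x
    using sp[of X1 X2 X3 X4 x] sp[of X2 X1 X3 X4 x] sp[of X3 X1 X2 X4 x] sp[of X4 X1 X2 X3 x]
    by (auto simp: UNIV_dir index_sign_Cons insert_commute)
  have d3: "ext_d l \<in> forms 3" by (rule ext_d_forms_3[OF l2])
  have "form_dot 1 (loop_form \<gamma>) A = - cup4 (ext_d A) l" if A: "A \<in> forms 1" for A
    unfolding stokes[OF A l2] sum4_cup_1_3[OF d3] form_dot_1 sum_negf[symmetric]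
    by (intro sum.cong refl) (simp add: loop)
  moreover have "sum4 (cup 1 3 (loop_form \<gamma>) B) = - form_dot 3 B (ext_d l)" if B: "B \<in> forms 3" for B
  proof -
    have sh: "(\<Sum>x\<in>UNIV. B (x + s) L * ext_d l (x + s) L) = (\<Sum>x\<in>UNIV. B x L * ext_d l x L)" for s L
      using sum_site_shift[of "\<lambda>x. B x L * ext_d l x L" s] by simp
    have "sum4 (cup 1 3 (loop_form \<gamma>) B) = (\<Sum>x\<in>UNIV. - (B (x + hat X1) [X2,X3,X4] * ext_d l (x + hat X1) [X2,X3,X4])
       - B (x + hat X2) [X1,X3,X4] * ext_d l (x + hat X2) [X1,X3,X4] - B (x + hat X3) [X1,X2,X4] * ext_d l (x + hat X3) [X1,X2,X4]
       - B (x + hat X4) [X1,X2,X3] * ext_d l (x + hat X4) [X1,X2,X3])"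
      unfolding sum4_cup_1_3[OF B] loop by (intro sum.cong refl) (simp add: mult.commute)
    also have "\<dots> = - form_dot 3 B (ext_d l)"
      unfolding form_dot_3 by (simp add: sum_subtractf sum.distrib sum_negf sh)
    finally show ?thesis .
  qed
  ultimately have "spanned_loop \<gamma> l ?w ae g0 b0"
    using l b0 ae(1) le g0 by unfold_locales auto
  then show thesis by (rule that)
qed

lemma neg_one_powi: "exp (Complex 0 (- (pi * of_int k))) = (-1) powi k"
proof -
  have "exp (Complex 0 (- (pi * of_int k))) = cis (- (pi * of_int k))" by (simp add: cis_conv_exp Complex_eq)
  also have "\<dots> = (-1) powi k"
  proof (cases "even k")
    case True
    then obtain m where m: "k = 2 * m" by auto
    have "cis (- (pi * of_int k)) = cis (2 * pi * of_int (- m))" by (simp add: m mult_ac)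
    then show ?thesis using True cis_multiple_2pi[of "of_int (- m)"] by (simp only: power_int_minus_left) simp
  next
    case False
    then obtain m where m: "k = 2 * m + 1" by (auto elim: oddE)
    have "cis (- (pi * of_int k)) = cis (2 * pi * of_int (- m)) * cis (- pi)" unfolding cis_mult by (simp add: m algebra_simps)
    then show ?thesis using False cis_multiple_2pi[of "of_int (- m)"] by (simp only: power_int_minus_left) (simp add: cis.ctr complex_eq_iff)
  qed
  finally show ?thesis .
qed

lemma powi_parity: "even (j - k) \<Longrightarrow> (-1) powi j = ((-1) powi k :: complex)"
  by (simp add: power_int_minus_left)

text \<open>Comparing imaginary parts determines the magnetic charge, because Im \<tau> is nonzero,
  and then the electric one.\<close>

lemma charges_eq:
  assumes "Im \<tau> > 0" shows "charges (of_int a + \<tau> * of_int b) \<tau> = (a, b)"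
  unfolding charges_def
proof (rule the_equality)
  fix c :: "int \<times> int"
  assume eq: "of_int a + \<tau> * of_int b = of_int (fst c) + \<tau> * of_int (snd c)"
  then have "Im \<tau> * of_int b = Im \<tau> * of_int (snd c)" by (auto simp: complex_eq_iff)
  then have b: "b = snd c" using assms by simp
  then have "a = fst c" using eq by simp
  with b show "c = (a, b)" by simp
qed simp

section \<open>The expectation value as a quotient of theta functions\<close>

context spanned_loop
begin

lemma integrand_eq:
  assumes A: "A \<in> forms 1" and B: "B \<in> forms 3" and n: "n \<in> int_forms 2"
  shows "(let F = field_strength A n in
       exp (- of_real (\<beta> / 2 * form_dot 2 F F) - \<i> * of_real (\<theta> * top_charge F n)
            + \<i> * of_real (1 / (2 * pi) * form_dot 2 (codiff B) F) - \<i> * of_real (of_int p * pi * pontryagin n)) * dyonic_wilson \<gamma> qe qm A B)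
    = G qe p \<beta> \<theta> A n * exp (\<i> * of_real (form_dot 3 B (constraint qm n)))"
proof -
  have n2: "n \<in> forms 2" using n by (rule int_forms_forms)
  have "form_dot 3 B (ext_d (field_strength A n)) = 2 * pi * form_dot 3 B (ext_d n)"
    using closed_ext_d[OF A] unfolding field_strength_lin ext_d_lin form_dot_lin_right
    by (simp add: closed_form_def form_dot_def)
  then have "1 / (2 * pi) * form_dot 2 (codiff B) (field_strength A n) = - form_dot 3 B (ext_d n)"
    unfolding form_dot_codiff_3[OF B field_strength_forms[OF A n2]] by simp
  then show ?thesis
    unfolding Let_def dyonic_wilson_def G_def constraint_def loop_cup[OF B] form_dot_lin_right exp_add[symmetric]
    by (intro arg_cong[where f = exp]) (simp add: complex_eq_iff)
qed

lemma numerator_integral: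
  assumes \<beta>: "\<beta> > 0"
  shows "field_integral (\<lambda>Ae Am. \<Sum>\<^sub>\<infinity>n\<in>int_forms 2.
       let F = field_strength Ae n in
       exp (- of_real (\<beta> / 2 * form_dot 2 F F) - \<i> * of_real (\<theta> * top_charge F n)
            + \<i> * of_real (1 / (2 * pi) * form_dot 2 (codiff Am) F) - \<i> * of_real (of_int p * pi * pontryagin n)) * dyonic_wilson \<gamma> qe qm Ae Am) =
    prefactor qe qm p \<beta> \<theta> * (theta6 (\<theta> / (2 * pi)) (2 * pi * \<beta>) (of_int qe) (of_int qm) zl *
      (of_real (exp (- (W / (2 * \<beta>)) * (tilt qe qm \<theta>)\<^sup>2)) * I0 \<beta>))" (is "field_integral ?f = ?R")
proof -
  have "field_integral ?f = field_integral (\<lambda>A B. \<Sum>\<^sub>\<infinity>n\<in>int_forms 2. G qe p \<beta> \<theta> A n * exp (\<i> * of_real (form_dot 3 B (constraint qm n))))"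
    unfolding field_integral_def
    by (intro Bochner_Integration.integral_cong refl infsum_cong integrand_eq form_of_1_forms form_of_3_forms)
  also have "\<dots> = ?R"
    by (rule trans[OF field_integral_constraint(1)[OF \<beta> norm_G measurable_G constraint_int] numerator_sum[OF \<beta>]])
  finally show ?thesis .
qed

text \<open>On the constrained set \<open>n\<close> is closed, so the \<open>cup1\<close> term of
  the charge vanishes and the weight agrees with \<open>G\<close> at charges zero. The shift
  \<open>zl\<close> then carries coefficient 0, and writing it makes the quotient uniform.\<close>

lemma partition_integral:
  assumes \<beta>: "\<beta> > 0"
  shows "partition_fun TYPE('n) \<beta> \<theta> = theta6 (\<theta> / (2 * pi)) (2 * pi * \<beta>) 0 0 zl * I0 \<beta>"
proof -
  define G0 :: "'n form \<Rightarrow> 'n form \<Rightarrow> complex" where "G0 = (\<lambda>A n. let F = field_strength A n in exp (Complex (- (\<beta> / 2) * form_dot 2 F F) (- \<theta> / (8 * pi\<^sup>2) * cup4 F F)))"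
  have norm: "norm (G0 A n) = exp (- (\<beta> / 2) * form_dot 2 (field_strength A n) (field_strength A n))" for A n
    by (simp add: G0_def Let_def norm_exp_eq_Re)
  have meas: "(\<lambda>a. G0 (form_of 1 a) n) \<in> borel_measurable (field_measure 1)" for n
  proof -
    have [measurable]: "(\<lambda>a. cup 2 2 (field_strength (form_of 1 a) n) (field_strength (form_of 1 a) n) x L) \<in> borel_measurable (field_measure 1)" for x L
      by (rule measurable_cup) measurable
    show ?thesis unfolding G0_def Let_def of_real_exp_mult[symmetric] sum4_def by measurable
  qed
  have "partition_fun TYPE('n) \<beta> \<theta> = field_integral (\<lambda>A B. \<Sum>\<^sub>\<infinity>n\<in>int_forms 2. G0 A n * exp (\<i> * of_real (form_dot 3 B (constraint 0 n))))"
    unfolding partition_fun_def field_integral_def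
  proof (intro Bochner_Integration.integral_cong refl infsum_cong)
    fix ab :: "('n site \<times> dir list \<Rightarrow> real) \<times> ('n site \<times> dir list \<Rightarrow> real)" and n :: "'n form" assume n: "n \<in> int_forms 2"
    let ?A = "form_of 1 (fst ab) :: 'n form" and ?B = "form_of 3 (snd ab) :: 'n form"
    have n2: "n \<in> forms 2" using n by (rule int_forms_forms)
    have "form_dot 3 ?B (ext_d (field_strength ?A n)) = 2 * pi * form_dot 3 ?B (ext_d n)"
      using closed_ext_d[OF form_of_1_forms, of "fst ab"] unfolding field_strength_lin ext_d_lin form_dot_lin_right
      by (simp add: closed_form_def form_dot_def)
    then have e: "1 / (2 * pi) * form_dot 2 (codiff ?B) (field_strength ?A n) = - form_dot 3 ?B (ext_d n)"
      unfolding form_dot_codiff_3[OF form_of_3_forms field_strength_forms[OF form_of_1_forms n2]] by simp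
    show "(let F = field_strength ?A n in
       exp (- of_real (\<beta> / 2 * form_dot 2 F F) - \<i> * of_real (\<theta> / (8 * pi\<^sup>2) * sum4 (cup 2 2 F F))
            + \<i> * of_real (1 / (2 * pi) * form_dot 2 (codiff ?B) F))) = G0 ?A n * exp (\<i> * of_real (form_dot 3 ?B (constraint 0 n)))"
      unfolding Let_def G0_def constraint_def form_dot_lin_right exp_add[symmetric] e
      by (intro arg_cong[where f = exp]) (simp add: complex_eq_iff)
  qed
  also have "\<dots> = (\<Sum>\<^sub>\<infinity>n\<in>{n \<in> int_forms 2. \<forall>x L. constraint 0 n x L = 0}. \<integral>a. G0 (form_of 1 a) n \<partial>field_measure 1)"
    by (rule field_integral_constraint(1)[OF \<beta> norm meas constraint_int])
  also have "\<dots> = (\<Sum>\<^sub>\<infinity>n\<in>{n \<in> int_forms 2. \<forall>x L. constraint 0 n x L = 0}. \<integral>a. G 0 0 \<beta> \<theta> (form_of 1 a) n \<partial>field_measure 1)"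
  proof (intro infsum_cong Bochner_Integration.integral_cong refl)
    fix n :: "'n form" and a assume "n \<in> {n \<in> int_forms 2. \<forall>x L. constraint 0 n x L = 0}"
    then have n: "n \<in> forms 2" "\<And>x L. constraint 0 n x L = 0" using int_forms_forms by auto
    have "ext_d n x L = 0" for x L using n(2)[of x L] by (simp add: constraint_def lin_def)
    then have "closed_form n" by (simp add: closed_form_def)
    then have "sum4 (cup1 2 3 (field_strength (form_of 1 a) n) (ext_d n)) = 0"
      by (rule cupd_closed[OF field_strength_forms[OF form_of_1_forms n(1)]])
    then show "G0 (form_of 1 a) n = G 0 0 \<beta> \<theta> (form_of 1 a) n"
      unfolding G0_def G_def Let_def top_charge_eq by simp
  qed
  also have "\<dots> = theta6 (\<theta> / (2 * pi)) (2 * pi * \<beta>) 0 0 zl * I0 \<beta>"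
    unfolding numerator_sum[OF \<beta>, where qe = 0 and qm = 0 and p = 0]
    by (simp add: prefactor_def tilt_def Complex_eq)
  finally show ?thesis .
qed

lemma I0_nonzero: "\<beta> > 0 \<Longrightarrow> I0 \<beta> \<noteq> 0"
  unfolding I0_def by (rule villain_gauss_pos[OF sector_sub zero_sector])

lemma expectation_eq:
  assumes \<beta>: "\<beta> > 0"
  shows "wilson_expectation \<gamma> qe qm p \<beta> \<theta> = prefactor qe qm p \<beta> \<theta> * of_real (exp (- (W / (2 * \<beta>)) * (tilt qe qm \<theta>)\<^sup>2)) *
     (theta6 (\<theta> / (2 * pi)) (2 * pi * \<beta>) (of_int qe) (of_int qm) zl / theta6 (\<theta> / (2 * pi)) (2 * pi * \<beta>) 0 0 zl)"
  unfolding wilson_expectation_def numerator_integral[OF \<beta>] partition_integral[OF \<beta>]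
  using I0_nonzero[OF \<beta>] by simp

end

section \<open>Modular transformations\<close>

text \<open>With a = k1 + q x and b = k2 + q y one has -a b + q (a y + b x) = q^2 x y - k1 k2. The
  product of integers drops out of the phase and q^2 x y is common to all summands.\<close>

lemma theta2_term_T: "theta2_term (R + 1) T (p - q) q x y k = exp (\<i> * of_real (2 * pi * (q\<^sup>2 * (x * y)))) * theta2_term R T p q x y k"
proof -
  define a b where "a = of_int (fst k) + q * x" and "b = of_int (snd k) + q * y"
  have phase: "- 2 * pi * ((R + 1) * a * b + (p - q) * (a * y + b * x)) =
     2 * pi * (q\<^sup>2 * (x * y)) + - 2 * pi * (R * a * b + p * (a * y + b * x)) + 2 * pi * of_int (- (fst k * snd k))"
    by (simp add: a_def b_def power2_eq_square algebra_simps)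
  have one: "exp (\<i> * of_real (2 * pi * of_int (- (fst k * snd k)))) = 1" by (rule exp_2pi_int) simp
  have drop: "exp (\<i> * of_real (A + B + C)) = exp (\<i> * of_real A) * exp (\<i> * of_real B)" if "exp (\<i> * of_real C) = 1" for A B C :: real
    by (simp only: of_real_add distrib_left exp_add that mult_1_right)
  show ?thesis
    unfolding theta2_term_def Let_def a_def[symmetric] b_def[symmetric] phase drop[OF one] by (simp only: mult_ac)
qed

lemma theta6_T: "theta6 (R + 1) T (p - q) q ((x1, y1), (x2, y2), (x3, y3)) =
   exp (\<i> * of_real (2 * pi * (q\<^sup>2 * (x1 * y1 + x2 * y2 + x3 * y3)))) * theta6 R T p q ((x1, y1), (x2, y2), (x3, y3))"
proof -
  have e: "exp (\<i> * of_real (2 * pi * (q\<^sup>2 * (x1 * y1 + x2 * y2 + x3 * y3)))) =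
     exp (\<i> * of_real (2 * pi * (q\<^sup>2 * (x1 * y1)))) * (exp (\<i> * of_real (2 * pi * (q\<^sup>2 * (x2 * y2)))) * exp (\<i> * of_real (2 * pi * (q\<^sup>2 * (x3 * y3)))))"
    unfolding exp_add[symmetric] by (simp add: algebra_simps)
  have "theta6_term (R + 1) T (p - q) q ((x1, y1), (x2, y2), (x3, y3)) k =
     exp (\<i> * of_real (2 * pi * (q\<^sup>2 * (x1 * y1 + x2 * y2 + x3 * y3)))) * theta6_term R T p q ((x1, y1), (x2, y2), (x3, y3)) k" for k
  proof -
    obtain k1 k2 k3 where "k = (k1, k2, k3)" by (cases k) auto
    then show ?thesis unfolding theta6_term_def e by (simp only: split theta2_term_T mult_ac)
  qed
  then have "theta6_term (R + 1) T (p - q) q ((x1, y1), (x2, y2), (x3, y3)) =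
     (\<lambda>k. exp (\<i> * of_real (2 * pi * (q\<^sup>2 * (x1 * y1 + x2 * y2 + x3 * y3)))) * theta6_term R T p q ((x1, y1), (x2, y2), (x3, y3)) k)" by (rule ext)
  then show ?thesis unfolding theta6_def by (simp only: infsum_cmult_right')
qed

context spanned_loop
begin

definition s where "s = lam X1 X2 * lam X3 X4 - lam X1 X3 * lam X2 X4 + lam X1 X4 * lam X2 X3"

text \<open>Both \<open>cup4 l l\<close> and \<open>cupd l l\<close> are expanded by the Hodge
  decomposition, and \<open>cup_closed\<close> relates the two orders of pairing \<open>w\<close>
  with the exact part. The integer \<open>j\<close> is \<open>cupd l l\<close>; comparing with v,
  the sum of the two quantities, fixes the parity.\<close>

lemma linking_relation: "\<exists>j::int. 2 * y + 2 * s - u = v - 2 * of_int j"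
proof -
  let ?X = "ext_d ae" and ?M = "mean l"
  have M2: "?M \<in> forms 2" by (rule mean_forms_2[OF l2])
  have MX: "lin 1 ?M 1 ?X \<in> forms 2" by (rule lin_forms[OF M2 X2])
  note cl = closed_ext_d[OF ae(1)] closed_mean[of l]
  have "cup4 l l = cup4 (lin 1 w 1 (lin 1 ?M 1 ?X)) (lin 1 w 1 (lin 1 ?M 1 ?X))"
    using ae(2) by simp
  also have "\<dots> = y + cup4 ?X w + cup4 ?M ?M"
    unfolding cup4_lin_left cup4_lin_right
    using cup_exact_closed[OF ae(1) X2 cl(1)] cup_exact_closed[OF ae(1) M2 cl(2)] cup_closed_exact[OF ae(1) M2 cl(2)]
      cup_w_w cup_w_mean[OF l2] by (simp add: y_def)
  finally have ll: "cup4 l l = y + cup4 ?X w + cup4 ?M ?M" .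
  have "cupd l l = cupd (lin 1 w 1 (lin 1 ?M 1 ?X)) (lin 1 w 1 (lin 1 ?M 1 ?X))"
    using ae(2) by simp
  also have "\<dots> = u + cupd ?X w"
    unfolding cupd_lin_right[OF w2 MX lin_forms[OF w2 MX]] cupd_lin_right[OF M2 X2 lin_forms[OF w2 MX]]
      cupd_closed[OF lin_forms[OF w2 MX] cl(1)] cupd_closed[OF lin_forms[OF w2 MX] cl(2)]
      cupd_lin_left[OF w2 MX w2] cupd_lin_left[OF M2 X2 w2] cupd_mean_w[OF l2] by (simp add: u_def)
  finally have dl: "cupd l l = u + cupd ?X w" .
  obtain j :: int where j: "cupd l l = of_int j" using cupd_int[OF l l] by (auto elim: Ints_cases)
  have Xw: "y + cupd ?X w = cup4 ?X w" unfolding y_def by (rule cup_closed[OF X2 w2 cl(1)])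
  have ml: "mean l 0 [\<mu>, \<nu>] = lam \<mu> \<nu> / N2" for \<mu> \<nu> using N2_pos by (simp add: lam_def)
  have "cup4 ?M ?M = 2 * s"
    unfolding cup_mean(1)[OF l2 M2] N4 mean_mean cup_const_def ml s_def using N2_pos by (simp add: field_simps)
  then have "2 * y + 2 * s - u = v - 2 * of_int j"
    using ll dl j Xw unfolding v_def pontryagin_eq by simp
  then show ?thesis by blast
qed

text \<open>The function F at tau = R + iT and charges (a, b), freed from its signs. The fraction
  multiplied by \<open>W\<close> is |a + tau b|^2 / T.\<close>

definition reduced :: "real \<Rightarrow> real \<Rightarrow> real \<Rightarrow> real \<Rightarrow> complex" where
  "reduced R T a b = exp (Complex (pi * u * T * b\<^sup>2 - pi * W * ((T\<^sup>2 * b\<^sup>2 + (a + R * b)\<^sup>2) / T)) (- pi * R * b\<^sup>2 * u - 2 * pi * a * b * y)) *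
     (theta6 R T a b zl / theta6 R T 0 0 zl)"

lemma expectation_reduced:
  assumes T: "T > 0" and v': "of_int v' = v"
  shows "of_real (exp (2 * pi\<^sup>2 * u * (T / (2 * pi)) * (of_int qm)\<^sup>2)) * wilson_expectation \<gamma> qe qm p (T / (2 * pi)) (2 * pi * R) =
    (-1) powi (p * v' * qm\<^sup>2) * reduced R T (of_int qe) (of_int qm)"
proof -
  have b: "T / (2 * pi) > 0" using T by simp
  have p: "2 * pi * R / (2 * pi) = R" "2 * pi * (T / (2 * pi)) = T" by simp_all
  have real: "2 * pi\<^sup>2 * u * (T / (2 * pi)) * (of_int qm)\<^sup>2 + (- 2 * pi\<^sup>2 * (T / (2 * pi)) * (of_int qm)\<^sup>2 * W + - (W / (2 * (T / (2 * pi)))) * (tilt qe qm (2 * pi * R))\<^sup>2)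
     = pi * u * T * (of_int qm)\<^sup>2 - pi * W * ((T\<^sup>2 * (of_int qm)\<^sup>2 + (of_int qe + R * of_int qm)\<^sup>2) / T)"
    using T by (simp add: tilt_def field_simps power2_eq_square)
  have "exp (of_real (2 * pi\<^sup>2 * u * (T / (2 * pi)) * (of_int qm)\<^sup>2)) * (prefactor qe qm p (T / (2 * pi)) (2 * pi * R) * exp (of_real (- (W / (2 * (T / (2 * pi)))) * (tilt qe qm (2 * pi * R))\<^sup>2))) =
     exp (Complex 0 (- (pi * of_int (p * v' * qm\<^sup>2)))) * exp (Complex (pi * u * T * (of_int qm)\<^sup>2 - pi * W * ((T\<^sup>2 * (of_int qm)\<^sup>2 + (of_int qe + R * of_int qm)\<^sup>2) / T)) (- pi * R * (of_int qm)\<^sup>2 * u - 2 * pi * of_int qe * of_int qm * y))"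
    unfolding prefactor_def exp_add[symmetric] real[symmetric]
    by (rule arg_cong[where f = exp]) (simp add: complex_eq_iff v'[symmetric] algebra_simps)
  then show ?thesis
    unfolding expectation_eq[OF b] p reduced_def neg_one_powi exp_of_real[symmetric] by (simp only: mult.assoc[symmetric])
qed

lemma dyon_F_reduced:
  assumes \<tau>: "Im \<tau> > 0" and v': "of_int v' = v"
  shows "dyon_F \<gamma> u v' \<alpha>1 \<alpha>2 (of_int a + \<tau> * of_int b) \<tau> =
    (-1) powi (\<lfloor>2 * \<alpha>1\<rfloor> * v' * a\<^sup>2 + \<lfloor>2 * \<alpha>2\<rfloor> * v' * b\<^sup>2) * reduced (Re \<tau>) (Im \<tau>) (of_int a) (of_int b)"
proof -
  have "dyon_F \<gamma> u v' \<alpha>1 \<alpha>2 (of_int a + \<tau> * of_int b) \<tau> = (-1) powi (\<lfloor>2 * \<alpha>1\<rfloor> * v' * a\<^sup>2) *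
     (of_real (exp (2 * pi\<^sup>2 * u * (Im \<tau> / (2 * pi)) * (of_int b)\<^sup>2)) * wilson_expectation \<gamma> a b \<lfloor>2 * \<alpha>2\<rfloor> (Im \<tau> / (2 * pi)) (2 * pi * Re \<tau>))"
    unfolding dyon_F_def charges_eq[OF \<tau>] Let_def split by (simp only: mult_ac)
  also have "\<dots> = (-1) powi (\<lfloor>2 * \<alpha>1\<rfloor> * v' * a\<^sup>2) * ((-1) powi (\<lfloor>2 * \<alpha>2\<rfloor> * v' * b\<^sup>2) * reduced (Re \<tau>) (Im \<tau>) (of_int a) (of_int b))"
    unfolding expectation_reduced[OF \<tau> v'] ..
  finally show ?thesis by (simp add: power_int_add)
qed

text \<open>The exponent with \<open>W\<close> is |q|^2 / Im tau and thus invariant, and the real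
  exponents with \<open>u\<close> change by the modulus of exp(i u pi q^2/tau). The left-over phase,
  with contributions from \<open>y\<close>, from \<open>s\<close> through the theta quotient and
  from the cross term of q^2/tau, is exp(2 pi i a b (2y + 2s - u)), which is 1 by
  integrality.\<close>

lemma reduced_S:
  fixes R T :: real and a b :: int
  assumes T: "T > 0" and v': "of_int v' = v"
  defines "n \<equiv> R\<^sup>2 + T\<^sup>2" and "q \<equiv> of_int a + Complex R T * of_int b"
  shows "reduced (- R / n) (T / n) (of_int b) (- of_int a) =
     exp (\<i> * of_real u * of_real pi * (q\<^sup>2 / Complex R T)) * reduced R T (of_int a) (of_int b)"
proof -
  let ?a = "of_int a :: real" and ?b = "of_int b :: real"
  obtain j :: int where j: "2 * y + 2 * s - u = v - 2 * of_int j" using linking_relation by blast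
  have n: "n > 0" using T by (simp add: n_def add_nonneg_pos)
  have c: "of_real (sqrt (T / n) ^ 3) \<noteq> (0::complex)" "of_real (sqrt T ^ 3) \<noteq> (0::complex)" using T n by auto
  have zl: "zl = ((lam X1 X2, lam X3 X4), (lam X1 X3, - lam X2 X4), (lam X1 X4, lam X2 X3))" by (rule zl_def)
  have st: "of_real (sqrt (T / n) ^ 3) * theta6 (- R / n) (T / n) q' (- p') zl = exp (\<i> * of_real (4 * pi * p' * q' * s)) * (of_real (sqrt T ^ 3) * theta6 R T p' q' zl)" for p' q'
    using theta6_S[OF T, of R q' p' "lam X1 X2" "lam X3 X4" "lam X1 X3" "- lam X2 X4" "lam X1 X4" "lam X2 X3"] unfolding n_def zl s_def by simp
  have "theta6 (- R / n) (T / n) ?b (- ?a) zl / theta6 (- R / n) (T / n) 0 0 zl =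
     (of_real (sqrt (T / n) ^ 3) * theta6 (- R / n) (T / n) ?b (- ?a) zl) / (of_real (sqrt (T / n) ^ 3) * theta6 (- R / n) (T / n) 0 (- 0) zl)"
    using c(1) by simp
  also have "\<dots> = exp (\<i> * of_real (4 * pi * ?a * ?b * s)) * (theta6 R T ?a ?b zl / theta6 R T 0 0 zl)"
    unfolding st using c(2) by simp
  finally have ratio: "theta6 (- R / n) (T / n) ?b (- ?a) zl / theta6 (- R / n) (T / n) 0 0 zl =
     exp (\<i> * of_real (4 * pi * ?a * ?b * s)) * (theta6 R T ?a ?b zl / theta6 R T 0 0 zl)" .
  have one: "exp (\<i> * of_real (2 * pi * (?a * ?b * (v - 2 * of_int j)))) = 1"
    by (rule exp_2pi_int) (simp add: v'[symmetric])
  have W: "((T / n)\<^sup>2 * (- ?a)\<^sup>2 + (?b + - R / n * - ?a)\<^sup>2) / (T / n) = (T\<^sup>2 * ?b\<^sup>2 + (?a + R * ?b)\<^sup>2) / T"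
  proof -
    have "((T / n)\<^sup>2 * (- ?a)\<^sup>2 + (?b + - R / n * - ?a)\<^sup>2) / (T / n) = ((R\<^sup>2 + T\<^sup>2) * ?a\<^sup>2 / n + n * ?b\<^sup>2 + 2 * ?a * ?b * R) / T"
      using T n by (simp add: field_simps power2_eq_square)
    also have "(R\<^sup>2 + T\<^sup>2) * ?a\<^sup>2 / n = ?a\<^sup>2" using n unfolding n_def[symmetric] by simp
    also have "(?a\<^sup>2 + n * ?b\<^sup>2 + 2 * ?a * ?b * R) / T = (T\<^sup>2 * ?b\<^sup>2 + (?a + R * ?b)\<^sup>2) / T"
      by (simp add: n_def algebra_simps power2_eq_square)
    finally show ?thesis .
  qed
  have nz: "Complex R T \<noteq> 0" using T by (simp add: complex_eq_iff)
  have inv: "1 / Complex R T = Complex (R / n) (- T / n)" by (simp add: complex_eq_iff n_def Re_divide Im_divide)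
  have "q\<^sup>2 / Complex R T = (of_int a)\<^sup>2 * (1 / Complex R T) + 2 * of_int a * of_int b + (of_int b)\<^sup>2 * Complex R T"
    using nz by (simp add: q_def field_simps power2_eq_square)
  also have "\<dots> = of_real (?a\<^sup>2) * Complex (R / n) (- T / n) + of_real (2 * ?a * ?b) + of_real (?b\<^sup>2) * Complex R T" unfolding inv by simp
  also have "\<dots> = Complex (?a\<^sup>2 * (R / n) + 2 * ?a * ?b + ?b\<^sup>2 * R) (?b\<^sup>2 * T - ?a\<^sup>2 * (T / n))"
    by (simp only: complex_eq_iff) simp
  finally have qq: "q\<^sup>2 / Complex R T = Complex (?a\<^sup>2 * (R / n) + 2 * ?a * ?b + ?b\<^sup>2 * R) (?b\<^sup>2 * T - ?a\<^sup>2 * (T / n))" .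
  have "2 * pi * (?a * ?b * (v - 2 * of_int j)) = 2 * pi * (?a * ?b * (2 * y + 2 * s - u))" unfolding j ..
  then have ph: "2 * pi * (?a * ?b * (v - 2 * of_int j)) = 2 * pi * ?a * ?b * y * 2 + 4 * pi * ?a * ?b * s - 2 * pi * ?a * ?b * u" by (simp add: algebra_simps)
  define Z where "Z = pi * W * ((T\<^sup>2 * ?b\<^sup>2 + (?a + R * ?b)\<^sup>2) / T)"
  define r t where "r = R / n" and "t = T / n"
  have rt: "- R / n = - r" by (simp add: r_def)
  have "exp (Complex (pi * u * t * (- ?a)\<^sup>2 - Z) (- pi * - r * (- ?a)\<^sup>2 * u - 2 * pi * ?b * - ?a * y)) * exp (\<i> * of_real (4 * pi * ?a * ?b * s)) =
     exp (\<i> * of_real u * of_real pi * (q\<^sup>2 / Complex R T)) * exp (Complex (pi * u * T * ?b\<^sup>2 - Z) (- pi * R * ?b\<^sup>2 * u - 2 * pi * ?a * ?b * y)) * exp (\<i> * of_real (2 * pi * (?a * ?b * (v - 2 * of_int j))))"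
    unfolding exp_add[symmetric] qq ph r_def[symmetric] t_def[symmetric]
    by (rule arg_cong[where f = exp]) (simp add: complex_eq_iff algebra_simps)
  then have ex: "exp (Complex (pi * u * t * (- ?a)\<^sup>2 - Z) (- pi * - r * (- ?a)\<^sup>2 * u - 2 * pi * ?b * - ?a * y)) * exp (\<i> * of_real (4 * pi * ?a * ?b * s)) =
     exp (\<i> * of_real u * of_real pi * (q\<^sup>2 / Complex R T)) * exp (Complex (pi * u * T * ?b\<^sup>2 - Z) (- pi * R * ?b\<^sup>2 * u - 2 * pi * ?a * ?b * y))"
    unfolding one by simp
  show ?thesis
    unfolding reduced_def unfolding ratio W unfolding Z_def[symmetric] rt t_def[symmetric] mult.assoc[symmetric]
    unfolding ex ..
qed

text \<open>The effective charge a - b + (R + 1) b equals a + R b, so all moduli are unchanged. The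
  phases combine to exp(i pi b^2 (2y + 2s - u)), a sign that the parity in
  \<open>linking_relation\<close> expresses through v.\<close>

lemma reduced_T:
  fixes a b :: int
  assumes v': "of_int v' = v"
  shows "reduced (R + 1) T (of_int (a - b)) (of_int b) = (-1) powi (b\<^sup>2 * v') * reduced R T (of_int a) (of_int b)"
proof -
  let ?a = "of_int a :: real" and ?b = "of_int b :: real"
  obtain j :: int where j: "2 * y + 2 * s - u = v - 2 * of_int j" using linking_relation by blast
  have th: "theta6 (R + 1) T (p - q) q zl = exp (\<i> * of_real (2 * pi * (q\<^sup>2 * s))) * theta6 R T p q zl" for p q
    using theta6_T[of R T p q "lam X1 X2" "lam X3 X4" "lam X1 X3" "- lam X2 X4" "lam X1 X4" "lam X2 X3"] unfolding zl_def s_def by simp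
  have th0: "theta6 (R + 1) T 0 0 zl = theta6 R T 0 0 zl" using th[of 0 0] by simp
  have asc: "e1 * (e2 * t / t0) = (e1 * e2) * (t / t0)" for e1 e2 t t0 :: complex by simp
  have W: "?a - ?b + (R + 1) * ?b = ?a + R * ?b" by (simp add: algebra_simps)
  define Z where "Z = pi * u * T * ?b\<^sup>2 - pi * W * ((T\<^sup>2 * ?b\<^sup>2 + (?a + R * ?b)\<^sup>2) / T)"
  have k: "of_int (b\<^sup>2 * (2 * j - v')) = - (?b\<^sup>2 * (2 * y + 2 * s - u))" unfolding j v'[symmetric] by (simp add: algebra_simps)
  have "exp (Complex Z (- pi * (R + 1) * ?b\<^sup>2 * u - 2 * pi * (?a - ?b) * ?b * y)) * exp (\<i> * of_real (2 * pi * (?b\<^sup>2 * s))) =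
     exp (Complex 0 (- (pi * of_int (b\<^sup>2 * (2 * j - v'))))) * exp (Complex Z (- pi * R * ?b\<^sup>2 * u - 2 * pi * ?a * ?b * y))"
    unfolding exp_add[symmetric] k by (rule arg_cong[where f = exp]) (simp add: complex_eq_iff algebra_simps power2_eq_square)
  also have "exp (Complex 0 (- (pi * of_int (b\<^sup>2 * (2 * j - v'))))) = (-1) powi (b\<^sup>2 * v')"
    unfolding neg_one_powi by (rule powi_parity) (simp add: algebra_simps)
  finally have ex: "exp (Complex Z (- pi * (R + 1) * ?b\<^sup>2 * u - 2 * pi * (?a - ?b) * ?b * y)) * exp (\<i> * of_real (2 * pi * (?b\<^sup>2 * s))) =
     (-1) powi (b\<^sup>2 * v') * exp (Complex Z (- pi * R * ?b\<^sup>2 * u - 2 * pi * ?a * ?b * y))" .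
  show ?thesis
    unfolding reduced_def of_int_diff th th0 W Z_def[symmetric] asc ex by (rule mult.assoc)
qed

text \<open>The charges (a, b) become (b, -a), so the two sign exponents trade places; replacing the
  half-integer \<alpha>1 by its negative does not affect the sign, as only parity matters.\<close>

lemma dyon_F_S:
  assumes \<tau>: "Im \<tau> > 0" and v': "of_int v' = v" and q: "q = of_int a + \<tau> * of_int b" and \<alpha>: "2 * \<alpha>1 \<in> \<int>"
  shows "dyon_F \<gamma> u v' \<alpha>1 \<alpha>2 (q / \<tau>) (- 1 / \<tau>) = exp (\<i> * of_real u * of_real pi * (q\<^sup>2 / \<tau>)) * dyon_F \<gamma> u v' \<alpha>2 (- \<alpha>1) q \<tau>"
proof -
  have nz: "\<tau> \<noteq> 0" using \<tau> by auto
  have n: "(Re \<tau>)\<^sup>2 + (Im \<tau>)\<^sup>2 > 0" using \<tau> by (simp add: add_nonneg_pos)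
  have ri: "Re (- 1 / \<tau>) = - Re \<tau> / ((Re \<tau>)\<^sup>2 + (Im \<tau>)\<^sup>2)" "Im (- 1 / \<tau>) = Im \<tau> / ((Re \<tau>)\<^sup>2 + (Im \<tau>)\<^sup>2)"
    by (simp_all add: Re_divide Im_divide)
  have im: "Im (- 1 / \<tau>) > 0" unfolding ri using \<tau> n by simp
  have q': "q / \<tau> = of_int b + (- 1 / \<tau>) * of_int (- a)" using nz by (simp add: q field_simps)
  obtain m where m: "2 * \<alpha>1 = of_int m" using \<alpha> by (auto elim: Ints_cases)
  have fl: "\<lfloor>2 * \<alpha>1\<rfloor> = m" "\<lfloor>2 * - \<alpha>1\<rfloor> = - m" using m by (simp_all add: m)
  have r: "reduced (Re (- 1 / \<tau>)) (Im (- 1 / \<tau>)) (of_int b) (of_int (- a)) =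
     exp (\<i> * of_real u * of_real pi * (q\<^sup>2 / \<tau>)) * reduced (Re \<tau>) (Im \<tau>) (of_int a) (of_int b)"
    using reduced_S[OF \<tau> v', where R = "Re \<tau>" and a = a and b = b] unfolding ri q by simp
  have sg: "(-1) powi (m * v' * b\<^sup>2 + \<lfloor>2 * \<alpha>2\<rfloor> * v' * (- a)\<^sup>2) = ((-1) powi (\<lfloor>2 * \<alpha>2\<rfloor> * v' * a\<^sup>2 + - m * v' * b\<^sup>2) :: complex)"
    by (rule powi_parity) simp
  have "dyon_F \<gamma> u v' \<alpha>1 \<alpha>2 (q / \<tau>) (- 1 / \<tau>) = (-1) powi (\<lfloor>2 * \<alpha>2\<rfloor> * v' * a\<^sup>2 + - m * v' * b\<^sup>2) *
     (exp (\<i> * of_real u * of_real pi * (q\<^sup>2 / \<tau>)) * reduced (Re \<tau>) (Im \<tau>) (of_int a) (of_int b))"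
    unfolding q' dyon_F_reduced[OF im v'] fl r sg ..
  also have "\<dots> = exp (\<i> * of_real u * of_real pi * (q\<^sup>2 / \<tau>)) * dyon_F \<gamma> u v' \<alpha>2 (- \<alpha>1) (of_int a + \<tau> * of_int b) \<tau>"
    unfolding dyon_F_reduced[OF \<tau> v'] fl by (simp only: mult_ac)
  finally show ?thesis unfolding q .
qed

text \<open>The square of a - b has the parity of a^2 + b^2. This transfers 2 \<alpha>1 to the
  exponent of the magnetic charge, and the sign from \<open>reduced_T\<close> supplies the extra
  1/2.\<close>

lemma dyon_F_T:
  assumes \<tau>: "Im \<tau> > 0" and v': "of_int v' = v" and q: "q = of_int a + \<tau> * of_int b"
    and \<alpha>: "2 * \<alpha>1 \<in> \<int>" "2 * \<alpha>2 \<in> \<int>"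
  shows "dyon_F \<gamma> u v' \<alpha>1 \<alpha>2 q (\<tau> + 1) = dyon_F \<gamma> u v' \<alpha>1 (\<alpha>1 + \<alpha>2 + 1 / 2) q \<tau>"
proof -
  obtain m1 m2 where m: "2 * \<alpha>1 = of_int m1" "2 * \<alpha>2 = of_int m2" using \<alpha> by (auto elim!: Ints_cases)
  have "2 * (\<alpha>1 + \<alpha>2 + 1 / 2) = of_int (m1 + m2 + 1)" using m by simp
  then have fl: "\<lfloor>2 * \<alpha>1\<rfloor> = m1" "\<lfloor>2 * \<alpha>2\<rfloor> = m2" "\<lfloor>2 * (\<alpha>1 + \<alpha>2 + 1 / 2)\<rfloor> = m1 + m2 + 1"
    using m by (simp_all only: floor_of_int)
  have im: "Im (\<tau> + 1) > 0" using \<tau> by simp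
  have q': "q = of_int (a - b) + (\<tau> + 1) * of_int b" by (simp add: q algebra_simps)
  have r: "reduced (Re (\<tau> + 1)) (Im (\<tau> + 1)) (of_int (a - b)) (of_int b) = (-1) powi (b\<^sup>2 * v') * reduced (Re \<tau>) (Im \<tau>) (of_int a) (of_int b)"
    using reduced_T[OF v', of "Re \<tau>" "Im \<tau>" a b] by simp
  have sg: "(-1) powi (m1 * v' * (a - b)\<^sup>2 + m2 * v' * b\<^sup>2) * (-1) powi (b\<^sup>2 * v') = ((-1) powi (m1 * v' * a\<^sup>2 + (m1 + m2 + 1) * v' * b\<^sup>2) :: complex)"
    unfolding power_int_add[of "-1 :: complex", simplified, symmetric] by (rule powi_parity) (simp add: algebra_simps power2_eq_square)
  have "dyon_F \<gamma> u v' \<alpha>1 \<alpha>2 q (\<tau> + 1) = (-1) powi (m1 * v' * (a - b)\<^sup>2 + m2 * v' * b\<^sup>2) * (-1) powi (b\<^sup>2 * v') * reduced (Re \<tau>) (Im \<tau>) (of_int a) (of_int b)"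
    unfolding q' dyon_F_reduced[OF im v'] fl r mult.assoc ..
  also have "\<dots> = dyon_F \<gamma> u v' \<alpha>1 (\<alpha>1 + \<alpha>2 + 1 / 2) q \<tau>"
    unfolding q dyon_F_reduced[OF \<tau> v'] fl sg ..
  finally show ?thesis .
qed

end
theorem theorem6:
  fixes \<gamma> :: "('n::finite) link list"
    and l :: "'n form"
    and u \<beta> \<theta> \<alpha>1 \<alpha>2 :: real
    and v qe qm :: int
    and q \<tau> :: complex
  assumes "closed_loop \<gamma>"
    and "spanned_by \<gamma> l"
    and "u = sum4 (cup1 2 3 (codiff_proj l) (ext_d (codiff_proj l)))"
    and "of_int v = pontryagin l"
    and "\<beta> > 0"
    and "\<tau> = of_real (\<theta> / (2 * pi)) + 2 * of_real pi * \<i> * of_real \<beta>"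
    and "q = of_int qe + \<tau> * of_int qm"
    and "2 * \<alpha>1 \<in> \<int>"
    and "2 * \<alpha>2 \<in> \<int>"
  shows "dyon_F \<gamma> u v \<alpha>1 \<alpha>2 q \<tau> =
           of_real (exp (2 * pi\<^sup>2 * u * \<beta> * (of_int qm)\<^sup>2)) *
           (-1) powi (\<lfloor>2 * \<alpha>1\<rfloor> * v * qe\<^sup>2 + \<lfloor>2 * \<alpha>2\<rfloor> * v * qm\<^sup>2) *
           wilson_expectation \<gamma> qe qm 0 \<beta> \<theta> \<and>
         dyon_F \<gamma> u v \<alpha>1 \<alpha>2 (q / \<tau>) (- 1 / \<tau>) =
           exp (\<i> * of_real u * of_real pi * (q\<^sup>2 / \<tau>)) * dyon_F \<gamma> u v \<alpha>2 (- \<alpha>1) q \<tau> \<and>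
         dyon_F \<gamma> u v \<alpha>1 \<alpha>2 q (\<tau> + 1) = dyon_F \<gamma> u v \<alpha>1 (\<alpha>1 + \<alpha>2 + 1 / 2) q \<tau> \<and>
         (even v \<longrightarrow>
           (\<forall>\<alpha>1' \<alpha>2'. 2 * \<alpha>1' \<in> \<int> \<and> 2 * \<alpha>2' \<in> \<int> \<longrightarrow>
              dyon_F \<gamma> u v \<alpha>1' \<alpha>2' q \<tau> = dyon_F \<gamma> u v \<alpha>1 \<alpha>2 q \<tau>))"
proof -
  obtain ae g0 b0 where sl: "spanned_loop \<gamma> l (codiff_proj l) ae g0 b0"
    using spanned_loop_exists[OF assms(2)] .
  interpret sl: spanned_loop \<gamma> l "codiff_proj l" ae g0 b0 by (rule sl)
  have u: "u = sl.u" unfolding sl.u_def assms(3) ..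
  have v: "of_int v = sl.v" unfolding sl.v_def assms(4) ..
  have re: "Re \<tau> = \<theta> / (2 * pi)" and im: "Im \<tau> = 2 * pi * \<beta>" by (simp_all add: assms(6))
  have pos: "Im \<tau> > 0" using assms(5) by (simp add: im)
  have bt: "Im \<tau> / (2 * pi) = \<beta>" "2 * pi * Re \<tau> = \<theta>" by (simp_all add: re im)
  note F = sl.dyon_F_reduced[OF pos v, where a = qe and b = qm, folded assms(7) u]
  have E: "of_real (exp (2 * pi\<^sup>2 * u * \<beta> * (of_int qm)\<^sup>2)) * wilson_expectation \<gamma> qe qm 0 \<beta> \<theta> = sl.reduced (Re \<tau>) (Im \<tau>) (of_int qe) (of_int qm)"
    using sl.expectation_reduced[OF pos v, of qm qe 0 "Re \<tau>"] unfolding bt u by simp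
  have 1: "dyon_F \<gamma> u v \<alpha>1 \<alpha>2 q \<tau> = of_real (exp (2 * pi\<^sup>2 * u * \<beta> * (of_int qm)\<^sup>2)) *
           (-1) powi (\<lfloor>2 * \<alpha>1\<rfloor> * v * qe\<^sup>2 + \<lfloor>2 * \<alpha>2\<rfloor> * v * qm\<^sup>2) * wilson_expectation \<gamma> qe qm 0 \<beta> \<theta>"
    unfolding F E[symmetric] by (simp only: mult_ac)
  \<comment> \<open>For even v every sign exponent is even, so F is \<open>reduced\<close> whatever
    the half-integers are.\<close>
  have 4: "dyon_F \<gamma> u v \<alpha>1' \<alpha>2' q \<tau> = sl.reduced (Re \<tau>) (Im \<tau>) (of_int qe) (of_int qm)" if "even v" for \<alpha>1' \<alpha>2'
    unfolding F using that by (simp add: power_int_minus_left)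
  show ?thesis
    using 1 4 sl.dyon_F_S[OF pos v assms(7,8), folded u] sl.dyon_F_T[OF pos v assms(7,8,9), folded u] by auto
qed

end
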